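(* Let $C$ be a genus 2 curve in the locus $\mathcal{Y}_2$, with associated degree 5 cover $C\to E$ as in the definition of $\mathcal{Y}_2$. Then there is $a\in\mathbb{C}$ with $$a(9a-8)(a+8)(2a+1)(3a-1)(a-1)(a-2)\neq0$$ such that $C$ is given by $$y^2=x(x-1)(b_3x^3+b_2x^2+b_1x+b_0),$$ where $$\begin{aligned} b_3&=(2a+1)(9a-8)^2,\\ b_2&=-27a^6-54a^5+468a^4-958a^3+381a^2+400a-192,\\ b_1&=-18a^6+380a^5-1000a^4+726a^3+499a^2-752a+192,\\ b_0&=-(a+8)^2(a-1)^3(3a-1), \end{aligned}$$ and moreover $E$ is given by the equation $$s^2=t(t-1)\left(t-\frac{(3a-1)^3(a+8)^2(a-1)}{27a(a-2)^5}\right).$$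
   Context: All curves are over $\mathbb{C}$ and "given by" an equation means isomorphic to the smooth projective model of it. $\mathcal{M}_2$ is the moduli space of genus 2 curves. A degree 5 cover $\psi:C\to E$ from a genus 2 curve to a genus 1 curve induces a degree 5 cover $\phi:\mathbb{P}^1\to\mathbb{P}^1$ with $\phi\circ\pi_C=\pi_E\circ\psi$, where $\pi_C:C\to\mathbb{P}^1$, $\pi_E:E\to\mathbb{P}^1$ are the natural degree 2 covers. $\mathcal{Y}_2\subset\mathcal{M}_2$ is the locus of genus 2 curves $C$ admitting a degree 5 cover $\psi:C\to E$ to a genus 1 curve such that $\phi$ is of degenerate type II, i.e. has exactly four branch points, with ramification indices $>1$ over them given by $((2)^2,(2)^2,(2)\cdot(3),(2))$ (the third branch point has one point of index 2 and one of index 3 over it). *)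

theory Defs
  imports
    "HOL-Computational_Algebra.Computational_Algebra"
    "HOL-Library.Multiset"
    "Jordan_Normal_Form.Char_Poly"
begin

text \<open>
  A smooth projective curve over the complex numbers is represented by its function field: a
  field \<open>'k\<close> together with the embedding \<open>c :: complex \<Rightarrow> 'k\<close> of the
  constants. Under the usual anti-equivalence, a nonconstant morphism of curves \<open>X \<rightarrow> Y\<close>
  is the embedding over the constants of the function field of \<open>Y\<close> into that of
  \<open>X\<close>, isomorphic curves are those with isomorphic function fields, and the points of a
  curve are the normalized discrete valuations of its function field that are trivial on the
  constants.
\<close>


subsection \<open>Curves and covers\<close>

text \<open>The following lemma makes \<^const>\<open>vector_space.dim\<close> below meaningful.\<close>

lemma vector_space_field_hom:
  "field_hom h \<Longrightarrow> vector_space (\<lambda>a x. h a * x)"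
proof -
  assume "field_hom h"
  then interpret field_hom h .
  show ?thesis
    by unfold_locales (simp_all add: algebra_simps hom_distribs)
qed

definition curve_morphism ::
  "(complex \<Rightarrow> 'k::field) \<Rightarrow> (complex \<Rightarrow> 'l::field) \<Rightarrow> ('k \<Rightarrow> 'l) \<Rightarrow> bool" where
  "curve_morphism c d h \<longleftrightarrow> field_hom h \<and> (\<forall>a. h (c a) = d a)"

text \<open>
  The dimension is \<open>0\<close> if the extension is infinite, so a positive value
  expresses finiteness.
\<close>

definition cover_degree :: "('k::field \<Rightarrow> 'l::field) \<Rightarrow> nat" where
  "cover_degree h = vector_space.dim (\<lambda>a x. h a * x) UNIV"

definition is_cover ::
  "nat \<Rightarrow> (complex \<Rightarrow> 'k::field) \<Rightarrow> (complex \<Rightarrow> 'l::field) \<Rightarrow> ('k \<Rightarrow> 'l) \<Rightarrow> bool" where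
  "is_cover n c d h \<longleftrightarrow> curve_morphism c d h \<and> 0 < n \<and> cover_degree h = n"

text \<open>The projective line: the field \<^typ>\<open>complex poly fract\<close> with these constants.\<close>

definition P1 :: "complex \<Rightarrow> complex poly fract" where
  "P1 a = to_fract [:a:]"

text \<open>
  An algebraic function field of one variable is a finite extension of a rational function field.
\<close>

definition is_curve :: "(complex \<Rightarrow> 'k::field) \<Rightarrow> bool" where
  "is_curve c \<longleftrightarrow> field_hom c \<and> (\<exists>h n. is_cover n P1 c h)"


subsection \<open>Points and ramification\<close>

text \<open>
  Valuations are integer valued functions; the value at \<open>0\<close>, which should be infinite, is
  normalized to \<open>0\<close> so that distinct functions are distinct valuations.
\<close>

definition points :: "(complex \<Rightarrow> 'k::field) \<Rightarrow> ('k \<Rightarrow> int) set" where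
  "points c = {v.
     v 0 = 0 \<and>
     (\<forall>x y. x \<noteq> 0 \<longrightarrow> y \<noteq> 0 \<longrightarrow> v (x * y) = v x + v y) \<and>
     (\<forall>x y. x \<noteq> 0 \<longrightarrow> y \<noteq> 0 \<longrightarrow> x + y \<noteq> 0 \<longrightarrow> min (v x) (v y) \<le> v (x + y)) \<and>
     (\<forall>a. v (c a) = 0) \<and>
     surj v}"

definition has_ramification_index ::
  "('k \<Rightarrow> 'l) \<Rightarrow> ('k \<Rightarrow> int) \<Rightarrow> ('l \<Rightarrow> int) \<Rightarrow> nat \<Rightarrow> bool" where
  "has_ramification_index h v w e \<longleftrightarrow> 0 < e \<and> (\<forall>x. w (h x) = int e * v x)"

definition fibre ::
  "(complex \<Rightarrow> 'l::field) \<Rightarrow> ('k::field \<Rightarrow> 'l) \<Rightarrow> ('k \<Rightarrow> int) \<Rightarrow> ('l \<Rightarrow> int) set" where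
  "fibre d h v = {w \<in> points d. \<exists>e. has_ramification_index h v w e}"

definition ramification_index ::
  "('k \<Rightarrow> 'l) \<Rightarrow> ('k \<Rightarrow> int) \<Rightarrow> ('l \<Rightarrow> int) \<Rightarrow> nat" where
  "ramification_index h v w = (THE e. has_ramification_index h v w e)"

text \<open>The multiset of the ramification indices greater than \<open>1\<close> over the point \<open>v\<close>.\<close>

definition branching ::
  "(complex \<Rightarrow> 'l::field) \<Rightarrow> ('k::field \<Rightarrow> 'l) \<Rightarrow> ('k \<Rightarrow> int) \<Rightarrow> nat multiset" where
  "branching d h v =
     {# e \<in># image_mset (ramification_index h v) (mset_set (fibre d h v)). 1 < e #}"

definition branch_points ::
  "(complex \<Rightarrow> 'k::field) \<Rightarrow> (complex \<Rightarrow> 'l::field) \<Rightarrow> ('k \<Rightarrow> 'l) \<Rightarrow> ('k \<Rightarrow> int) set" where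
  "branch_points c d h = {v \<in> points c. branching d h v \<noteq> {#}}"

definition degenerate_type_II :: "(complex poly fract \<Rightarrow> complex poly fract) \<Rightarrow> bool" where
  "degenerate_type_II \<phi> \<longleftrightarrow> (\<exists>q1 q2 q3 q4.
     distinct [q1, q2, q3, q4] \<and>
     branch_points P1 P1 \<phi> = {q1, q2, q3, q4} \<and>
     branching P1 \<phi> q1 = {#2, 2#} \<and>
     branching P1 \<phi> q2 = {#2, 2#} \<and>
     branching P1 \<phi> q3 = {#2, 3#} \<and>
     branching P1 \<phi> q4 = {#2#})"


subsection \<open>Genus\<close>

definition divisors :: "(complex \<Rightarrow> 'k::field) \<Rightarrow> (('k \<Rightarrow> int) \<Rightarrow> int) set" where
  "divisors c = {D. finite {v. D v \<noteq> 0} \<and> {v. D v \<noteq> 0} \<subseteq> points c}"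

definition divisor_degree :: "(('k \<Rightarrow> int) \<Rightarrow> int) \<Rightarrow> int" where
  "divisor_degree D = (\<Sum>v | D v \<noteq> 0. D v)"

definition riemann_roch_space ::
  "(complex \<Rightarrow> 'k::field) \<Rightarrow> (('k \<Rightarrow> int) \<Rightarrow> int) \<Rightarrow> 'k set" where
  "riemann_roch_space c D = {f. f \<noteq> 0 \<longrightarrow> (\<forall>v\<in>points c. - D v \<le> v f)}"

definition riemann_roch_dim ::
  "(complex \<Rightarrow> 'k::field) \<Rightarrow> (('k \<Rightarrow> int) \<Rightarrow> int) \<Rightarrow> nat" where
  "riemann_roch_dim c D = vector_space.dim (\<lambda>a f. c a * f) (riemann_roch_space c D)"

text \<open>
  The genus is the maximum of \<open>deg D + 1 - dim L(D)\<close> over all divisors, the definition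
  that is usual for function fields. All points have degree \<open>1\<close> here, as the
  constants are algebraically closed.
\<close>

definition has_genus :: "(complex \<Rightarrow> 'k::field) \<Rightarrow> nat \<Rightarrow> bool" where
  "has_genus c g \<longleftrightarrow>
     (\<exists>D\<in>divisors c. divisor_degree D + 1 - int (riemann_roch_dim c D) = int g) \<and>
     (\<forall>D\<in>divisors c. divisor_degree D + 1 - int (riemann_roch_dim c D) \<le> int g)"


subsection \<open>Curves given by an equation\<close>

definition eval2 :: "(complex \<Rightarrow> 'k::field) \<Rightarrow> complex poly poly \<Rightarrow> 'k \<Rightarrow> 'k \<Rightarrow> 'k" where
  "eval2 c G x y = poly (map_poly (\<lambda>p. poly (map_poly c p) x) G) y"

text \<open>
  A polynomial in \<open>y\<close> over the polynomials in \<open>x\<close> stands for a polynomial in two variables.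
  The curve with constants \<open>c\<close> is isomorphic to the smooth projective model of
  \<open>F(x, y) = 0\<close> iff its function field is isomorphic over the constants to the fraction
  field of the quotient of the polynomial ring in two variables by the ideal generated by
  \<open>F\<close>, that is, iff it is generated as a field by elements \<open>x\<close> and \<open>y\<close>
  whose ideal of relations is generated by \<open>F\<close>.
\<close>

definition given_by :: "(complex \<Rightarrow> 'k::field) \<Rightarrow> complex poly poly \<Rightarrow> bool" where
  "given_by c F \<longleftrightarrow> (\<exists>x y.
     (\<forall>G. eval2 c G x y = 0 \<longleftrightarrow> F dvd G) \<and>
     (\<forall>z. \<exists>G H. eval2 c H x y \<noteq> 0 \<and> z = eval2 c G x y / eval2 c H x y))"

text \<open>The polynomial \<open>y\<^sup>2 - f(x)\<close>:\<close>

definition double_cover_eq :: "complex poly \<Rightarrow> complex poly poly" where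
  "double_cover_eq f = [:- f, 0, 1:]"


subsection \<open>The locus\<close>

text \<open>
  The curve \<open>C\<close> belongs to the locus through the degree \<open>5\<close> cover
  \<open>\<psi> : C \<rightarrow> E\<close>. The degree \<open>2\<close> covers of the projective line by a curve of
  genus 2 and by a curve of genus 1 are the natural ones, up to automorphisms of the line and
  the choice of the origin of the genus 1 curve. Composition of embeddings of function fields is
  in the order opposite to that of the maps of curves.
\<close>

definition in_Y2_via ::
  "(complex \<Rightarrow> 'c::field) \<Rightarrow> (complex \<Rightarrow> 'e::field) \<Rightarrow> ('e \<Rightarrow> 'c) \<Rightarrow> bool" where
  "in_Y2_via C E \<psi> \<longleftrightarrow>
     is_curve C \<and> has_genus C 2 \<and>
     is_curve E \<and> has_genus E 1 \<and>
     is_cover 5 E C \<psi> \<and>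
     (\<exists>\<pi>C \<pi>E \<phi>.
        is_cover 2 P1 C \<pi>C \<and> is_cover 2 P1 E \<pi>E \<and> curve_morphism P1 P1 \<phi> \<and>
        \<pi>C \<circ> \<phi> = \<psi> \<circ> \<pi>E \<and> degenerate_type_II \<phi>)"

end

theory Submission
  imports Defs
begin

text \<open>
  Write \<open>E\<close> as \<open>s\<^sup>2 = F(t)\<close>. Pulling \<open>F\<close> back along \<open>\<phi>\<close> gives
  an equation of \<open>C\<close>: \<open>y = \<psi>(s)\<close> satisfies \<open>y\<^sup>2 = F(\<phi>(x))\<close>. So
  everything is decided by the points of the line at which a rational function has odd order,
  since these determine it up to a square, hence they determine the double cover that it defines
  (\<open>odd_points_same_square\<close>).

  The genus enters only through the number of these points. If there are \<open>2n + 2\<close> of them,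
  one explicit divisor \<open>D\<close> has \<open>deg D + 1 - dim L(D) \<ge> n\<close>, so the genus is at least
  \<open>n\<close>; and with two of them the curve is rational and has genus \<open>0\<close>
  (\<open>double_cover_branch_points\<close>). Thus \<open>F\<close> has exactly four odd points and its
  pullback at most six. If \<open>\<phi>\<close> has degree \<open>d\<close>, the ramification data leave
  \<open>d - 4\<close> points of odd index over each of the first three branch points, \<open>d - 2\<close> over
  the fourth and \<open>d\<close> over any other point. Four of these numbers with sum at most six force
  \<open>d = 5\<close> and pick out the four branch points (\<open>type_II_branch_points\<close>).

  Move the branch points to \<open>0, \<infinity>, 1, l\<close>, the unramified points over the first two to
  \<open>0\<close> and \<open>\<infinity>\<close>, and the triple point to \<open>1\<close>. Then
  \<open>\<phi> = k\<^sup>2 x P\<^sup>2 / Q\<^sup>2\<close> with monic quadratic \<open>P\<close>, \<open>Q\<close> and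
  \<open>k\<^sup>2 x P\<^sup>2 - Q\<^sup>2 = k\<^sup>2 (x - 1)\<^sup>3 (x - w)\<^sup>2\<close>. Substituting
  \<open>x = z\<^sup>2\<close> factors the left hand side into \<open>k z P(z\<^sup>2) \<plusminus> Q(z\<^sup>2)\<close>,
  which are coprime and interchanged up to sign by \<open>z \<mapsto> - z\<close>. So one of them is
  \<open>k (z - 1)\<^sup>3 (z - \<omega>)\<^sup>2\<close> with \<open>\<omega>\<^sup>2 = w\<close>, and comparing coefficients
  expresses everything by \<open>\<omega>\<close> (\<open>type_II_square_root_factorization\<close>). The fourth
  critical point and the value \<open>l\<close> there follow by differentiation
  (\<open>type_II_fourth_critical_value\<close>), and \<open>a = \<omega> + 1\<close> is the parameter of the
  theorem. The six odd points of \<open>F(\<phi>(x))\<close> are \<open>0, \<infinity>, 1\<close> and the three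
  simple points over \<open>l\<close>, which are the roots of the cubic. The equation of \<open>E\<close> in the
  theorem uses the coordinate \<open>t / (t - 1)\<close>, which has the branch points
  \<open>0, 1, \<infinity>, l / (l - 1)\<close>.
\<close>

section \<open>Homomorphisms out of the rational function field\<close>

type_synonym ratfun = "complex poly fract"

definition X :: ratfun where
  "X = to_fract [:0, 1:]"

definition peval :: "(complex \<Rightarrow> 'l::field) \<Rightarrow> 'l \<Rightarrow> complex poly \<Rightarrow> 'l" where
  "peval c s p = poly (map_poly c p) s"

text \<open>
  The substitution of \<open>s\<close> for the variable, extended from polynomials to fractions. It makes
  sense if \<open>s\<close> is not a constant: the constants are algebraically closed, so \<open>s\<close> is then
  transcendental and no denominator vanishes (\<open>peval_nonzero\<close>).
\<close>

definition subst :: "(complex \<Rightarrow> 'l::field) \<Rightarrow> 'l \<Rightarrow> ratfun \<Rightarrow> 'l" where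
  "subst c s F = (THE z. \<exists>p q. q \<noteq> 0 \<and> F = Fract p q \<and> z = peval c s p / peval c s q)"

lemma field_hom_P1: "field_hom P1"
  by unfold_locales (auto simp: P1_def to_fract_def One_fract_def Zero_fract_def one_pCons
      mult.commute simp del: to_fract_add to_fract_mult)

interpretation P1: field_hom P1
  by (rule field_hom_P1)

lemma field_hom_fls_const: "field_hom (fls_const :: complex \<Rightarrow> complex fls)"
  by unfold_locales (auto simp: fls_const_mult_const fls_plus_const)

lemma peval_simps:
  assumes "field_hom c"
  shows "peval c s (p + q) = peval c s p + peval c s q"
    "peval c s (p * q) = peval c s p * peval c s q"
    "peval c s (pCons a p) = c a + s * peval c s p"
    "peval c s 0 = 0" "peval c s 1 = 1" "peval c s [:a:] = c a"
proof -
  interpret c: field_hom c by fact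
  interpret mc: map_poly_comm_ring_hom c ..
  show "peval c s (p + q) = peval c s p + peval c s q"
    "peval c s (p * q) = peval c s p * peval c s q"
    "peval c s (pCons a p) = c a + s * peval c s p"
    "peval c s 0 = 0" "peval c s 1 = 1" "peval c s [:a:] = c a"
    by (simp_all add: peval_def hom_distribs)
qed

lemma complex_poly_induct [consumes 1, case_names const linear_factor]:
  fixes p :: "complex poly"
  assumes "p \<noteq> 0" and "\<And>c. c \<noteq> 0 \<Longrightarrow> Q [:c:]"
    and "\<And>p a. p \<noteq> 0 \<Longrightarrow> Q p \<Longrightarrow> Q (p * [:-a, 1:])"
  shows "Q p"
  using assms(1)
proof (induction "degree p" arbitrary: p)
  case 0
  then obtain c where "p = [:c:]" by (metis degree_eq_zeroE)
  with 0 show ?case using assms(2) by auto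
next
  case (Suc n)
  then have "\<not> constant (poly p)" by (simp add: constant_degree)
  then obtain a where "poly p a = 0" using fundamental_theorem_of_algebra by blast
  then obtain q where q: "p = q * [:-a, 1:]"
    by (metis poly_eq_0_iff_dvd dvd_def mult.commute)
  with Suc.prems have "q \<noteq> 0" by auto
  moreover have "degree q = n"
    using Suc.hyps(2) \<open>q \<noteq> 0\<close> degree_mult_eq[of q "[:-a, 1:]"] by (simp add: q del: mult_pCons_right)
  ultimately show ?case using Suc.hyps(1) assms(3) q by metis
qed

lemma peval_nonzero:
  assumes "field_hom c" "s \<notin> range c" "p \<noteq> 0"
  shows "peval c s p \<noteq> 0"
proof -
  interpret c: field_hom c by fact
  show ?thesis
    using assms(3)
  proof (induction p rule: complex_poly_induct)
    case (const c) then show ?case by (simp add: peval_simps[OF assms(1)])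
  next
    case (linear_factor p a)
    have "s \<noteq> c a" using assms(2) by auto
    then show ?case using linear_factor by (simp add: peval_simps[OF assms(1)] hom_distribs del: mult_pCons_right)
  qed
qed

lemma subst_Fract:
  assumes "field_hom c" "s \<notin> range c" "q \<noteq> 0"
  shows "subst c s (Fract p q) = peval c s p / peval c s q"
  unfolding subst_def
proof (rule the_equality)
  fix z assume "\<exists>p' q'. q' \<noteq> 0 \<and> Fract p q = Fract p' q' \<and> z = peval c s p' / peval c s q'"
  then obtain p' q' where q': "q' \<noteq> 0" "Fract p q = Fract p' q'" "z = peval c s p' / peval c s q'"
    by blast
  then have "peval c s (p * q') = peval c s (p' * q)"
    using assms(3) by (simp add: eq_fract)
  then show "z = peval c s p / peval c s q"
    using peval_nonzero[OF assms(1,2)] assms(3) q'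
    by (simp add: peval_simps[OF assms(1)] frac_eq_eq)
qed (use assms(3) in blast)

lemma curve_morphism_subst:
  assumes "field_hom c" "s \<notin> range c"
  shows "curve_morphism P1 c (subst c s)"
proof -
  interpret c: field_hom c by fact
  note S = subst_Fract[OF assms] peval_simps[OF assms(1)] peval_nonzero[OF assms]
  have add: "subst c s (F + G) = subst c s F + subst c s G" for F G
    by (cases F; cases G) (simp add: S field_simps)
  have mult: "subst c s (F * G) = subst c s F * subst c s G" for F G
    by (cases F; cases G) (simp add: S field_simps)
  have P1: "subst c s (P1 a) = c a" for a
    by (simp add: P1_def to_fract_def S)
  have "subst c s 0 = 0" "subst c s 1 = 1"
    using P1[of 0] P1[of 1] by simp_all
  with add mult have "field_hom (subst c s)"
    by unfold_locales simp_all
  with P1 show ?thesis by (simp add: curve_morphism_def)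
qed

lemma subst_X:
  assumes "field_hom c" "s \<notin> range c"
  shows "subst c s X = s"
proof -
  interpret c: field_hom c by fact
  show ?thesis
    unfolding X_def to_fract_def
    by (subst subst_Fract) (use assms in \<open>auto simp: peval_simps\<close>)
qed

lemma to_fract_pCons: "to_fract (pCons a p) = P1 a + X * to_fract p"
  by (simp add: P1_def X_def flip: to_fract_add to_fract_mult)

lemma X_minus_P1: "X - P1 a = to_fract [:-a, 1:]"
  by (simp add: to_fract_pCons P1.hom_uminus)

lemma X_neq_P1 [simp]: "X - P1 a \<noteq> 0" "X \<noteq> P1 a"
proof -
  show "X - P1 a \<noteq> 0"
    unfolding X_minus_P1 by simp
  then show "X \<noteq> P1 a" by auto
qed

lemma P1_simps [simp]: "P1 a = P1 b \<longleftrightarrow> a = b" "P1 a = 0 \<longleftrightarrow> a = 0"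
  by (simp_all add: P1_def)

lemma X_neq_0 [simp]: "X \<noteq> 0"
  using X_neq_P1(1)[of 0] by simp

lemma
  assumes "curve_morphism P1 c h"
  shows morphism_to_fract: "h (to_fract p) = peval c (h X) p"
    and morphism_X_not_const: "h X \<notin> range c"
    and morphism_field_hom: "field_hom h" "field_hom c"
proof -
  interpret h: field_hom h using assms by (simp add: curve_morphism_def)
  have c: "h (P1 a) = c a" for a using assms by (simp add: curve_morphism_def)
  show "field_hom h" by unfold_locales
  show cc: "field_hom c"
    unfolding c[symmetric] by unfold_locales
      (simp_all add: hom_distribs flip: c)
  show "h (to_fract p) = peval c (h X) p"
    by (induction p) (simp_all add: peval_simps[OF cc] to_fract_pCons hom_distribs c)
  show "h X \<notin> range c"
  proof
    assume "h X \<in> range c"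
    then obtain a where "h X = h (P1 a)" by (auto simp: c)
    then show False by simp
  qed
qed

lemma morphism_Fract:
  assumes "curve_morphism P1 c h"
  shows "h (Fract p q) = peval c (h X) p / peval c (h X) q"
proof -
  interpret h: field_hom h using assms by (simp add: curve_morphism_def)
  have "h (Fract p q) = h (to_fract p) / h (to_fract q)"
    by (simp add: Fract_conv_to_fract divide_inverse h.hom_mult h.hom_inverse)
  then show ?thesis by (simp add: morphism_to_fract[OF assms])
qed

lemma morphism_eqI:
  assumes "curve_morphism P1 c h" "curve_morphism P1 c h'" "h X = h' X"
  shows "h = h'"
proof
  fix F show "h F = h' F"
    by (cases F) (simp add: morphism_Fract[OF assms(1)] morphism_Fract[OF assms(2)] assms(3))
qed

lemma curve_morphism_comp:
  assumes "curve_morphism c d h" "curve_morphism d e k"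
  shows "curve_morphism c e (k \<circ> h)"
proof -
  interpret h: field_hom h using assms by (simp add: curve_morphism_def)
  interpret k: field_hom k using assms by (simp add: curve_morphism_def)
  have "field_hom (k \<circ> h)" by unfold_locales (simp_all add: hom_distribs)
  with assms show ?thesis by (simp add: curve_morphism_def)
qed

text \<open>
  Over the complex numbers every rational function arises from a constant by multiplying and
  dividing by linear factors, so multiplicative statements need only be checked on
  \<open>X - P1 a\<close>.
\<close>

lemma ratfun_induct [consumes 1, case_names const times divide]:
  assumes "F \<noteq> 0" and "\<And>c. c \<noteq> 0 \<Longrightarrow> Q (P1 c)"
    and times: "\<And>F a. F \<noteq> 0 \<Longrightarrow> Q F \<Longrightarrow> Q (F * (X - P1 a))"
    and div: "\<And>F a. F \<noteq> 0 \<Longrightarrow> Q F \<Longrightarrow> Q (F / (X - P1 a))"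
  shows "Q F"
proof (cases F)
  case (Fract p q)
  with assms(1) have "p \<noteq> 0" "q \<noteq> 0" by (auto simp: Fract_conv_to_fract)
  have num: "Q (P1 d * to_fract p)" if "d \<noteq> 0" for d using \<open>p \<noteq> 0\<close>
  proof (induction p rule: complex_poly_induct)
    case (const c)
    with assms(2)[of "d * c"] that show ?case by (simp add: P1.hom_mult flip: P1_def)
  next
    case (linear_factor p a)
    with times[of "P1 d * to_fract p" a] that show ?case
      unfolding X_minus_P1 by (simp add: mult.assoc del: mult_pCons_right)
  qed
  have "Q (P1 d * to_fract p / to_fract q)" if "d \<noteq> 0" for d using \<open>q \<noteq> 0\<close> that
  proof (induction q arbitrary: d rule: complex_poly_induct)
    case (const c)
    then show ?case
      using num[of "d * inverse c"]
      by (simp add: P1.hom_mult P1.hom_inverse divide_inverse mult_ac flip: P1_def)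
  next
    case (linear_factor q a)
    with div[of "P1 d * to_fract p / to_fract q" a] \<open>p \<noteq> 0\<close> show ?case
      unfolding X_minus_P1 by (simp add: mult.assoc del: mult_pCons_right)
  qed
  from this[of 1] show ?thesis using Fract by (simp add: Fract_conv_to_fract)
qed

section \<open>Points of the projective line\<close>

text \<open>
  The valuations of \<^const>\<open>points\<close> without the normalization. Restricting a point of a curve
  along a cover gives such a function: a point of the base, multiplied by the ramification index.
\<close>

definition preval :: "(complex \<Rightarrow> 'k::field) \<Rightarrow> ('k \<Rightarrow> int) \<Rightarrow> bool" where
  "preval c v \<longleftrightarrow> v 0 = 0 \<and>
     (\<forall>x y. x \<noteq> 0 \<longrightarrow> y \<noteq> 0 \<longrightarrow> v (x * y) = v x + v y) \<and>
     (\<forall>x y. x \<noteq> 0 \<longrightarrow> y \<noteq> 0 \<longrightarrow> x + y \<noteq> 0 \<longrightarrow> min (v x) (v y) \<le> v (x + y)) \<and>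
     (\<forall>a. v (c a) = 0)"

lemma points_iff: "v \<in> points c \<longleftrightarrow> preval c v \<and> surj v"
  by (auto simp: points_def preval_def)

locale prevaluation =
  fixes c :: "complex \<Rightarrow> 'k::field" and v
  assumes c: "field_hom c" and v: "preval c v"
begin

interpretation c: field_hom c by (rule c)

lemma zero [simp]: "v 0 = 0"
  and mult: "x \<noteq> 0 \<Longrightarrow> y \<noteq> 0 \<Longrightarrow> v (x * y) = v x + v y"
  and add: "x \<noteq> 0 \<Longrightarrow> y \<noteq> 0 \<Longrightarrow> x + y \<noteq> 0 \<Longrightarrow> min (v x) (v y) \<le> v (x + y)"
  and const [simp]: "v (c a) = 0"
  using v by (auto simp: preval_def)

lemma one [simp]: "v 1 = 0"
  using const[of 1] by (simp del: const)

lemma const_mult [simp]: "a \<noteq> 0 \<Longrightarrow> v (c a * x) = v x"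
  by (cases "x = 0") (simp_all add: mult)

lemma uminus [simp]: "v (- x) = v x"
  using const_mult[of "-1" x] by (simp add: c.hom_uminus del: const_mult)

lemma inverse: "v (inverse x) = - v x"
  using mult[of x "inverse x"] by (cases "x = 0") auto

lemma divide: "x \<noteq> 0 \<Longrightarrow> y \<noteq> 0 \<Longrightarrow> v (x / y) = v x - v y"
  by (simp add: divide_inverse mult inverse)

lemma power: "v (x ^ n) = int n * v x"
  by (cases "x = 0"; induction n) (auto simp: mult algebra_simps)

lemma power_int: "v (x powi n) = n * v x"
  by (auto simp: power_int_def power inverse)

lemma add_less: "x \<noteq> 0 \<Longrightarrow> y \<noteq> 0 \<Longrightarrow> v x < v y \<Longrightarrow> v (x + y) = v x"
proof -
  assume *: "x \<noteq> 0" "y \<noteq> 0" "v x < v y"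
  then have "x + y \<noteq> 0" by (metis add_eq_0_iff less_irrefl uminus)
  then show ?thesis using * add[of x y] add[of "x + y" "- y"] by auto
qed

lemma prod: "finite A \<Longrightarrow> (\<And>a. a \<in> A \<Longrightarrow> f a \<noteq> 0) \<Longrightarrow> v (\<Prod>a\<in>A. f a) = (\<Sum>a\<in>A. v (f a))"
  by (induction A rule: finite_induct) (auto simp: mult)

lemma in_points:
  assumes "v t = 1"
  shows "v \<in> points c"
proof -
  have "v (t powi n) = n" for n using assms by (simp add: power_int)
  then have "surj v" by (metis surjI)
  with v show ?thesis by (simp add: points_iff)
qed

end

lemma prevaluation_point: "field_hom c \<Longrightarrow> v \<in> points c \<Longrightarrow> prevaluation c v"
  by (simp add: points_iff prevaluation_def)

lemma preval_comp:
  assumes "curve_morphism c d h" "preval d v"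
  shows "preval c (v \<circ> h)"
proof -
  interpret h: field_hom h using assms by (simp add: curve_morphism_def)
  have "h x + h y \<noteq> 0" if "x + y \<noteq> 0" for x y
    using that by (metis h.hom_add h.hom_0_iff)
  then show ?thesis using assms
    by (simp add: preval_def curve_morphism_def h.hom_mult h.hom_add)
qed

text \<open>
  Embedding a function field into the Laurent series \<open>\<complex>((u))\<close> and taking orders gives a
  valuation. All points that have to be constructed below come from such embeddings.
\<close>

lemma preval_subdegree: "preval fls_const (fls_subdegree :: complex fls \<Rightarrow> int)"
  by (auto simp: preval_def fls_plus_subdegree)

lemma fls_not_const: "fls_subdegree (t :: complex fls) \<noteq> 0 \<Longrightarrow> fls_const a + t \<notin> range fls_const"
  by (metis (no_types, lifting) add_diff_cancel_left' fls_const_subdegree fls_minus_const imageE)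

text \<open>
  The order at the point \<open>a\<close>: a local parameter \<open>u\<close> is introduced by \<open>X = a + u\<close>, and
  at infinity by \<open>X = 1 / u\<close>.
\<close>

definition ord_at :: "complex \<Rightarrow> ratfun \<Rightarrow> int" where
  "ord_at a = fls_subdegree \<circ> subst fls_const (fls_const a + fls_X)"

definition ord_inf :: "ratfun \<Rightarrow> int" where
  "ord_inf = fls_subdegree \<circ> subst fls_const fls_X_inv"

lemma prevaluation_subst_fls:
  fixes s :: "complex fls"
  assumes "s \<notin> range fls_const"
  shows "prevaluation P1 (fls_subdegree \<circ> subst fls_const s)"
  using preval_comp[OF curve_morphism_subst[OF field_hom_fls_const assms] preval_subdegree]
  by (simp add: prevaluation_def field_hom_P1)

lemma subst_fls_linear:
  fixes s :: "complex fls"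
  assumes "s \<notin> range fls_const"
  shows "subst fls_const s (X - P1 b) = s - fls_const b"
proof -
  note * = curve_morphism_subst[OF field_hom_fls_const assms]
  interpret h: field_hom "subst fls_const s" using * by (simp add: curve_morphism_def)
  show ?thesis using * assms by (simp add: curve_morphism_def hom_distribs subst_X field_hom_fls_const)
qed

lemma fls_X_inv_not_const: "(fls_X_inv :: complex fls) \<notin> range fls_const"
  using fls_not_const[of "fls_X_inv" 0] by simp

interpretation ord_at: prevaluation P1 "ord_at a" for a
  unfolding ord_at_def by (rule prevaluation_subst_fls) (simp add: fls_not_const)

interpretation ord_inf: prevaluation P1 ord_inf
  unfolding ord_inf_def by (rule prevaluation_subst_fls[OF fls_X_inv_not_const])

lemma ord_at_linear [simp]: "ord_at a (X - P1 b) = (if a = b then 1 else 0)"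
proof -
  have *: "fls_const a + fls_X \<notin> range (fls_const :: complex \<Rightarrow> _)"
    by (rule fls_not_const) simp
  have "fls_subdegree (fls_const (a - b) + fls_X) = 0" if "a \<noteq> b"
    using that by (intro fls_subdegree_eqI) auto
  moreover have eq: "fls_const a + fls_X - fls_const b = fls_const (a - b) + fls_X"
    by (simp flip: fls_minus_const)
  ultimately show ?thesis
    unfolding ord_at_def comp_apply subst_fls_linear[OF *] eq by simp
qed

lemma ord_inf_linear [simp]: "ord_inf (X - P1 b) = -1"
proof -
  have "fls_subdegree (fls_X_inv - fls_const b) = -1"
    by (intro fls_subdegree_eqI) auto
  then show ?thesis by (simp add: ord_inf_def subst_fls_linear[OF fls_X_inv_not_const])
qed

lemma ord_at_X [simp]: "ord_at a X = (if a = 0 then 1 else 0)" and ord_inf_X [simp]: "ord_inf X = -1"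
  using ord_at_linear[of a 0] ord_inf_linear[of 0] by (simp_all del: ord_at_linear ord_inf_linear)

lemma ord_at_point [simp]: "ord_at a \<in> points P1"
  using ord_at.in_points[of a "X - P1 a"] by simp

lemma ord_inf_point [simp]: "ord_inf \<in> points P1"
  by (rule ord_inf.in_points[of "inverse X"]) (simp add: ord_inf.inverse)

lemma preval_eq_multiple:
  assumes "preval P1 u" "preval P1 v" "\<And>a. u (X - P1 a) = n * v (X - P1 a)"
  shows "u F = n * v F"
proof (cases "F = 0")
  case True
  then show ?thesis using assms by (simp add: preval_def)
next
  case False
  interpret u: prevaluation P1 u using assms by (simp add: prevaluation_def field_hom_P1)
  interpret v: prevaluation P1 v using assms by (simp add: prevaluation_def field_hom_P1)
  from False show ?thesis
    by (induction F rule: ratfun_induct)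
      (simp_all add: u.mult v.mult u.divide v.divide assms(3) int_distrib)
qed

text \<open>
  If \<open>X - a\<close> has positive value, then \<open>X - b = (X - a) + (a - b)\<close> with \<open>b \<noteq> a\<close> is
  the sum of an element of positive value and a nonzero constant, so it has value \<open>0\<close>.
\<close>

lemma preval_finite_center:
  assumes "preval P1 u" "u (X - P1 a) > 0"
  shows "u F = u (X - P1 a) * ord_at a F"
proof (rule preval_eq_multiple[OF assms(1) ord_at.v])
  fix b
  interpret u: prevaluation P1 u using assms by (simp add: prevaluation_def field_hom_P1)
  have "u (X - P1 b) = 0" if "a \<noteq> b"
    using u.add_less[of "P1 (a - b)" "X - P1 a"] assms(2) that by (simp del: P1.hom_minus) (simp add: P1.hom_minus)
  then show "u (X - P1 b) = u (X - P1 a) * ord_at a (X - P1 b)" by simp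
qed

text \<open>
  If \<open>X\<close> has negative value, the constant \<open>b\<close> does not affect the value of \<open>X - b\<close>.
\<close>

lemma preval_infinite_center:
  assumes "preval P1 u" "u X < 0"
  shows "u F = - u X * ord_inf F"
proof (rule preval_eq_multiple[OF assms(1) ord_inf.v])
  fix b
  interpret u: prevaluation P1 u using assms by (simp add: prevaluation_def field_hom_P1)
  have "u (X - P1 b) = u X"
    using u.add_less[of X "P1 (-b)"] assms(2) by (cases "b = 0") (simp_all add: P1.hom_uminus)
  then show "u (X - P1 b) = - u X * ord_inf (X - P1 b)" by simp
qed

lemma preval_classification:
  assumes "preval P1 u"
  obtains a n where "n > 0" "u = (\<lambda>F. n * ord_at a F)" "u (X - P1 a) = n"
  | n where "n > 0" "u = (\<lambda>F. n * ord_inf F)" "u X = -n"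
  | "u = (\<lambda>F. 0)"
proof -
  interpret u: prevaluation P1 u using assms by (simp add: prevaluation_def field_hom_P1)
  consider a where "u (X - P1 a) > 0" | "u X < 0"
    | "\<And>a. u (X - P1 a) \<le> 0" "u X \<ge> 0" by (meson not_less)
  then show ?thesis
  proof cases
    case (1 a)
    have "u = (\<lambda>F. u (X - P1 a) * ord_at a F)"
      by (rule ext) (rule preval_finite_center[OF assms 1])
    then show ?thesis by (rule that(1)[OF 1]) (rule refl)
  next
    case 2
    have "u = (\<lambda>F. - u X * ord_inf F)"
      by (rule ext) (rule preval_infinite_center[OF assms 2])
    then show ?thesis by (rule that(2)[rotated]) (use 2 in simp_all)
  next
    case 3
    have *: "u (X - P1 a) = 0" for a
      using 3(1)[of a] 3(1)[of 0] 3(2) u.add[of X "P1 (-a)"] by (cases "a = 0") (auto simp: P1.hom_uminus intro: antisym)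
    have "u F = 0 * ord_inf F" for F
      by (rule preval_eq_multiple[OF assms ord_inf.v]) (simp add: *)
    then have "u = (\<lambda>F. 0)" by (simp add: fun_eq_iff)
    with that(3) show ?thesis .
  qed
qed

lemma ord_at_neq [simp]: "ord_at a = ord_at b \<longleftrightarrow> a = b" "ord_at a \<noteq> ord_inf" "ord_inf \<noteq> ord_at a"
proof -
  show "ord_at a = ord_at b \<longleftrightarrow> a = b" using ord_at_linear[of a a] ord_at_linear[of b a] by (metis zero_neq_one)
  show "ord_at a \<noteq> ord_inf" "ord_inf \<noteq> ord_at a" using ord_at_linear[of a "a+1"] ord_inf_linear[of "a+1"] by (auto simp del: ord_at_linear ord_inf_linear)
qed

lemma points_P1: "points P1 = insert ord_inf (range ord_at)"
proof (intro equalityI subsetI)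
  fix u assume u: "u \<in> points P1"
  then have p: "preval P1 u" and s: "surj u" by (auto simp: points_iff)
  have *: "n = 1" if "n > 0" "u = (\<lambda>F. n * v F)" for v n
  proof -
    obtain F where "u F = 1" using s by (metis surjD)
    with that have "n dvd 1" by (metis dvd_triv_left)
    with that(1) show ?thesis by simp
  qed
  from p show "u \<in> insert ord_inf (range ord_at)"
  proof (cases rule: preval_classification)
    case (1 a n) with *[of n "ord_at a"] show ?thesis by auto
  next
    case (2 n) with *[of n ord_inf] show ?thesis by auto
  next
    case 3 with s show ?thesis by (metis surjD zero_neq_one)
  qed
qed auto

section \<open>Divisors of rational functions\<close>

lemma ratfun_factorization_aux:
  assumes "F \<noteq> 0"
  shows "\<exists>c Z n. c \<noteq> 0 \<and> finite Z \<and> F = P1 c * (\<Prod>a\<in>Z. (X - P1 a) powi n a)"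
  using assms
proof (induction F rule: ratfun_induct)
  case (const c)
  then show ?case by (intro exI[of _ c] exI[of _ "{}"]) auto
next
  have step: "\<exists>c' Z' n'. c' \<noteq> 0 \<and> finite Z' \<and>
      (P1 c * (\<Prod>a\<in>Z. (X - P1 a) powi n a)) * (X - P1 b) powi k = P1 c' * (\<Prod>a\<in>Z'. (X - P1 a) powi n' a)"
    if "c \<noteq> 0" "finite Z" for c Z n b k
  proof (cases "b \<in> Z")
    case True
    have "(\<Prod>a\<in>Z. (X - P1 a) powi (n(b := n b + k)) a) =
        (X - P1 b) powi (n b + k) * (\<Prod>a\<in>Z - {b}. (X - P1 a) powi n a)"
      using that True by (subst prod.remove[of _ b]) (auto intro!: prod.cong)
    moreover have "(\<Prod>a\<in>Z. (X - P1 a) powi n a) =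
        (X - P1 b) powi n b * (\<Prod>a\<in>Z - {b}. (X - P1 a) powi n a)"
      using that True by (subst prod.remove[of _ b]) auto
    ultimately show ?thesis using that
      by (intro exI[of _ c] exI[of _ Z] exI[of _ "n(b := n b + k)"]) (simp add: power_int_add)
  next
    case False
    have "(\<Prod>a\<in>insert b Z. (X - P1 a) powi (n(b := k)) a) =
        (X - P1 b) powi k * (\<Prod>a\<in>Z. (X - P1 a) powi n a)"
      using that False by (auto intro!: prod.cong)
    then show ?thesis using that
      by (intro exI[of _ c] exI[of _ "insert b Z"] exI[of _ "n(b := k)"]) simp
  qed
  {
    case (times F b)
    then show ?case using step[where k=1 and b=b] by force
  next
    case (divide F b)
    then show ?case using step[where k="-1" and b=b] by (force simp: divide_inverse)
  }
qed

lemma ord_at_prod_powi: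
  "finite Z \<Longrightarrow> ord_at b (\<Prod>a\<in>Z. (X - P1 a) powi n a) = (if b \<in> Z then n b else 0)"
  by (simp add: ord_at.prod ord_at.power_int if_distrib cong: if_cong)

lemma ord_inf_prod_powi:
  "finite Z \<Longrightarrow> ord_inf (\<Prod>a\<in>Z. (X - P1 a) powi n a) = - (\<Sum>a\<in>Z. n a)"
  by (simp add: ord_inf.prod ord_inf.power_int sum_negf)

lemma ratfun_factorization:
  assumes "F \<noteq> 0"
  obtains c where "c \<noteq> 0" "finite {a. ord_at a F \<noteq> 0}"
    "F = P1 c * (\<Prod>a | ord_at a F \<noteq> 0. (X - P1 a) powi ord_at a F)"
proof -
  obtain c Z n where *: "c \<noteq> 0" "finite Z" "F = P1 c * (\<Prod>a\<in>Z. (X - P1 a) powi n a)"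
    using ratfun_factorization_aux[OF assms] by blast
  then have v: "ord_at b F = (if b \<in> Z then n b else 0)" for b
    by (simp add: ord_at_prod_powi)
  then have "{a. ord_at a F \<noteq> 0} \<subseteq> Z" by auto
  moreover from this have "(\<Prod>a | ord_at a F \<noteq> 0. (X - P1 a) powi ord_at a F) = (\<Prod>a\<in>Z. (X - P1 a) powi n a)"
    using *(2) by (intro prod.mono_neutral_cong_left) (auto simp: v)
  ultimately show thesis using that[of c] * finite_subset by metis
qed

lemma ratfun_finite_support: "finite {a. ord_at a F \<noteq> 0}"
  by (cases "F = 0") (auto elim: ratfun_factorization)

text \<open>
  Principal divisors have degree \<open>0\<close>, since each linear factor has one zero and a simple
  pole at infinity.
\<close>

lemma ratfun_degree:
  assumes "F \<noteq> 0" "finite Z" "{a. ord_at a F \<noteq> 0} \<subseteq> Z"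
  shows "(\<Sum>a\<in>Z. ord_at a F) = - ord_inf F"
proof -
  obtain c where c: "c \<noteq> 0" and F: "F = P1 c * (\<Prod>a | ord_at a F \<noteq> 0. (X - P1 a) powi ord_at a F)"
    by (rule ratfun_factorization[OF assms(1)])
  have "ord_inf F = ord_inf (\<Prod>a | ord_at a F \<noteq> 0. (X - P1 a) powi ord_at a F)"
    using c by (subst F) simp
  also have "\<dots> = - (\<Sum>a | ord_at a F \<noteq> 0. ord_at a F)"
    by (simp add: ord_inf_prod_powi ratfun_finite_support)
  also have "(\<Sum>a | ord_at a F \<noteq> 0. ord_at a F) = (\<Sum>a\<in>Z. ord_at a F)"
    using assms by (intro sum.mono_neutral_left) auto
  finally show ?thesis by simp
qed

text \<open>
  The quotient has no zeros or poles at finite points, so its factorization has no factors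
  besides the constant.
\<close>

lemma ratfun_same_divisor:
  assumes "F \<noteq> 0" "G \<noteq> 0" "\<And>a. ord_at a F = ord_at a G"
  obtains c where "c \<noteq> 0" "F = P1 c * G"
proof -
  have "F / G \<noteq> 0" using assms by simp
  then obtain c where c: "c \<noteq> 0"
      "F / G = P1 c * (\<Prod>a | ord_at a (F / G) \<noteq> 0. (X - P1 a) powi ord_at a (F / G))"
    by (rule ratfun_factorization)
  then have "F / G = P1 c" using assms by (simp add: ord_at.divide)
  with that[of c] c(1) assms show ?thesis by (simp add: field_simps)
qed

text \<open>
  Halve all exponents of the factorization; the constant has a square root.
\<close>

lemma ratfun_square:
  assumes "F \<noteq> 0" "\<And>a. even (ord_at a F)"
  obtains G where "F = G ^ 2"
proof -
  have half: "(x powi (n div 2))\<^sup>2 = x powi n" if "even n" for x :: ratfun and n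
  proof -
    have "x powi n = x powi (n div 2 * 2)" using that by simp
    also have "\<dots> = (x powi (n div 2)) powi 2" by (rule power_int_mult)
    finally show ?thesis by simp
  qed
  obtain c where c: "c \<noteq> 0" and F: "F = P1 c * (\<Prod>a | ord_at a F \<noteq> 0. (X - P1 a) powi ord_at a F)"
    by (rule ratfun_factorization[OF assms(1)])
  let ?G = "P1 (csqrt c) * (\<Prod>a | ord_at a F \<noteq> 0. (X - P1 a) powi (ord_at a F div 2))"
  have "?G ^ 2 = P1 (csqrt c ^ 2) * (\<Prod>a | ord_at a F \<noteq> 0. ((X - P1 a) powi (ord_at a F div 2)) ^ 2)"
    by (simp only: power_mult_distrib P1.hom_power prod_power_distrib)
  also have "\<dots> = P1 c * (\<Prod>a | ord_at a F \<noteq> 0. (X - P1 a) powi ord_at a F)"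
    using assms(2) by (simp add: half)
  finally have "?G ^ 2 = P1 c * (\<Prod>a | ord_at a F \<noteq> 0. (X - P1 a) powi ord_at a F)" .
  from trans[OF F this[symmetric]] show ?thesis by (rule that)
qed

section \<open>Automorphisms of the projective line\<close>

text \<open>
  Changes of coordinate on the line. Composing a valuation with \<open>\<mu>\<close> expresses the point in
  the new coordinate.
\<close>

definition aut :: "(ratfun \<Rightarrow> ratfun) \<Rightarrow> bool" where
  "aut \<mu> \<longleftrightarrow> curve_morphism P1 P1 \<mu> \<and> bij \<mu>"

lemma curve_morphism_id: "field_hom c \<Longrightarrow> curve_morphism c c id"
proof -
  assume "field_hom c"
  have "field_hom (id :: 'a \<Rightarrow> 'a)" by unfold_locales simp_all
  then show ?thesis by (simp add: curve_morphism_def)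
qed

lemma aut_id: "aut id"
  by (simp add: aut_def curve_morphism_id field_hom_P1)

lemma aut_comp: "aut \<mu> \<Longrightarrow> aut \<nu> \<Longrightarrow> aut (\<mu> \<circ> \<nu>)"
  by (auto simp: aut_def intro: curve_morphism_comp bij_comp)

lemma aut_inv:
  assumes "aut \<mu>"
  shows "aut (inv_into UNIV \<mu>)"
proof -
  interpret m: field_hom \<mu> using assms by (simp add: aut_def curve_morphism_def)
  have [simp]: "\<mu> (inv_into UNIV \<mu> F) = F" "inv_into UNIV \<mu> (\<mu> F) = F" for F
    using assms by (simp_all add: aut_def bij_is_surj surj_f_inv_f bij_is_inj)
  have [simp]: "inv_into UNIV \<mu> F = G \<longleftrightarrow> F = \<mu> G" for F G by auto
  have "field_hom (inv_into UNIV \<mu>)"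
    by unfold_locales (simp_all add: m.hom_add m.hom_mult)
  then show ?thesis
    using assms by (auto simp: aut_def curve_morphism_def bij_imp_bij_inv)
qed

lemma points_comp:
  assumes "curve_morphism c d h" "surj h" "v \<in> points d"
  shows "v \<circ> h \<in> points c"
  using assms preval_comp[of c d h v] comp_surj[of h v] by (simp add: points_iff)

lemma points_comp_aut: "aut \<mu> \<Longrightarrow> v \<in> points P1 \<Longrightarrow> v \<circ> \<mu> \<in> points P1"
  by (auto simp: aut_def bij_is_surj intro: points_comp)

lemma comp_surj_cancel: "surj h \<Longrightarrow> v \<circ> h = w \<circ> h \<longleftrightarrow> v = w"
  by (metis fun.map_comp surj_iff comp_id)

lemma aut_comp_cancel: "aut \<mu> \<Longrightarrow> v \<circ> \<mu> = w \<circ> \<mu> \<longleftrightarrow> v = w"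
  by (auto simp: aut_def bij_is_surj comp_surj_cancel)

lemma not_const_if_val: "v \<in> points P1 \<Longrightarrow> v s \<noteq> 0 \<Longrightarrow> s \<notin> range P1"
  by (auto simp: points_def)

text \<open>
  The composites of the two substitutions fix \<open>X\<close>, so they are the identity.
\<close>

lemma aut_subst:
  assumes "s \<notin> range P1" "t \<notin> range P1" "subst P1 s t = X" "subst P1 t s = X"
  shows "aut (subst P1 s)"
proof -
  note m = curve_morphism_subst[OF field_hom_P1 assms(1)] curve_morphism_subst[OF field_hom_P1 assms(2)]
  have "subst P1 s \<circ> subst P1 t = id" "subst P1 t \<circ> subst P1 s = id"
    using assms m by (auto intro!: morphism_eqI curve_morphism_comp curve_morphism_id
        simp: field_hom_P1 subst_X)
  then have "bij (subst P1 s)" by (metis o_bij)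
  with m show ?thesis by (simp add: aut_def)
qed

lemma subst_P1_simps:
  assumes "s \<notin> range P1"
  shows "subst P1 s (P1 a) = P1 a" "subst P1 s X = s"
    "subst P1 s (F + G) = subst P1 s F + subst P1 s G"
    "subst P1 s (F - G) = subst P1 s F - subst P1 s G"
    "subst P1 s (F * G) = subst P1 s F * subst P1 s G"
    "subst P1 s (inverse F) = inverse (subst P1 s F)"
    "subst P1 s (F / G) = subst P1 s F / subst P1 s G"
proof -
  note m = curve_morphism_subst[OF field_hom_P1 assms]
  interpret h: field_hom "subst P1 s" using m by (simp add: curve_morphism_def)
  show "subst P1 s (P1 a) = P1 a" using m by (simp add: curve_morphism_def)
  show "subst P1 s X = s" using assms by (simp add: subst_X field_hom_P1)
  show "subst P1 s (F + G) = subst P1 s F + subst P1 s G"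
    "subst P1 s (F - G) = subst P1 s F - subst P1 s G"
    "subst P1 s (F * G) = subst P1 s F * subst P1 s G"
    "subst P1 s (inverse F) = inverse (subst P1 s F)"
    "subst P1 s (F / G) = subst P1 s F / subst P1 s G"
    by (simp_all add: h.hom_add h.hom_minus h.hom_mult h.hom_inverse divide_inverse)
qed

text \<open>
  A finite point \<open>b\<close> becomes infinity in the coordinate \<open>1 / (X - b)\<close>.
\<close>

lemma point_to_infinity:
  assumes "v \<in> points P1"
  obtains \<mu> where "aut \<mu>" "v \<circ> \<mu> = ord_inf"
proof -
  from assms consider "v = ord_inf" | b where "v = ord_at b" by (auto simp: points_P1)
  then show thesis
  proof cases
    case 1
    then show thesis using that[of id] aut_id by simp
  next
    case (2 b)
    let ?s = "inverse (X - P1 b)" and ?t = "P1 b + inverse X"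
    have s: "?s \<notin> range P1" by (rule not_const_if_val[OF ord_inf_point]) (simp add: ord_inf.inverse)
    have t: "?t \<notin> range P1"
    proof (rule not_const_if_val[OF ord_at_point])
      show "ord_at 0 ?t \<noteq> 0"
        using ord_at.add_less[of "inverse X" "P1 b" 0] by (cases "b = 0") (simp_all add: ord_at.inverse add.commute)
    qed
    have a: "aut (subst P1 ?s)"
      by (rule aut_subst[OF s t]) (simp_all add: subst_P1_simps[OF s] subst_P1_simps[OF t])
    have "preval P1 (v \<circ> subst P1 ?s)" "v (subst P1 ?s X) = -1"
      using 2 points_comp_aut[OF a assms] by (auto simp: points_iff subst_P1_simps[OF s] ord_at.inverse)
    then have "v \<circ> subst P1 ?s = ord_inf"
      using preval_infinite_center[of "v \<circ> subst P1 ?s"] by (simp add: fun_eq_iff)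
    with a show thesis by (rule that)
  qed
qed

text \<open>
  Once \<open>b\<close> is at infinity and \<open>a\<close>, \<open>c\<close> are at \<open>\<alpha>\<close>, \<open>\<gamma>\<close>, the affine
  coordinate \<open>(X - \<alpha>) / (\<gamma> - \<alpha>)\<close> does the rest.
\<close>

lemma three_points_normalization:
  assumes "a \<in> points P1" "b \<in> points P1" "c \<in> points P1" "a \<noteq> b" "a \<noteq> c" "b \<noteq> c"
  obtains \<mu> where "aut \<mu>" "a \<circ> \<mu> = ord_at 0" "b \<circ> \<mu> = ord_inf" "c \<circ> \<mu> = ord_at 1"
proof -
  obtain \<mu> where \<mu>: "aut \<mu>" "b \<circ> \<mu> = ord_inf" using point_to_infinity[OF assms(2)] .
  have "a \<circ> \<mu> \<in> insert ord_inf (range ord_at)" "c \<circ> \<mu> \<in> insert ord_inf (range ord_at)"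
    using points_comp_aut[OF \<mu>(1)] assms by (simp_all only: points_P1)
  moreover have "a \<circ> \<mu> \<noteq> ord_inf" "c \<circ> \<mu> \<noteq> ord_inf"
    unfolding \<mu>(2)[symmetric] aut_comp_cancel[OF \<mu>(1)] using assms by auto
  ultimately have "a \<circ> \<mu> \<in> range ord_at" "c \<circ> \<mu> \<in> range ord_at" by auto
  then obtain \<alpha> \<gamma> where \<alpha>: "a \<circ> \<mu> = ord_at \<alpha>" and \<gamma>: "c \<circ> \<mu> = ord_at \<gamma>" by blast
  have "\<alpha> \<noteq> \<gamma>" using assms \<alpha> \<gamma> aut_comp_cancel[OF \<mu>(1)] by metis
  define k l where "k = \<gamma> - \<alpha>" and "l = inverse k"
  have k: "k \<noteq> 0" "l \<noteq> 0" and \<gamma>_eq: "P1 \<gamma> = P1 \<alpha> + P1 k"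
    using \<open>\<alpha> \<noteq> \<gamma>\<close> by (simp_all add: k_def l_def P1.hom_minus)
  have k1: "P1 l * P1 k = 1"
    unfolding P1.hom_mult[symmetric] using k(1) by (simp add: l_def)
  let ?s = "P1 l * (X - P1 \<alpha>)" and ?t = "P1 k * X + P1 \<alpha>"
  have s: "?s \<notin> range P1"
    by (rule not_const_if_val[OF ord_inf_point]) (simp add: ord_inf.const_mult k)
  have t: "?t \<notin> range P1"
  proof (rule not_const_if_val[OF ord_inf_point])
    have "ord_inf (P1 k * X) = -1" using k by (simp add: ord_inf.const_mult)
    then show "ord_inf ?t \<noteq> 0"
      using ord_inf.add_less[of "P1 k * X" "P1 \<alpha>"] k by (cases "\<alpha> = 0") simp_all
  qed
  have ts: "subst P1 ?t ?s = X"
    unfolding subst_P1_simps[OF t] using k1 by (simp add: mult.assoc[symmetric])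
  have st: "subst P1 ?s ?t = X"
    unfolding subst_P1_simps[OF s] using k1
    by (simp add: mult.assoc[symmetric] mult.commute[of "P1 k"])
  note au = aut_subst[OF s t st ts]
  let ?\<nu> = "subst P1 ?s"
  have pre: "preval P1 (v \<circ> ?\<nu>)" if "v \<in> points P1" for v
    using points_comp_aut[OF au that] by (simp add: points_iff)
  have "ord_inf \<circ> ?\<nu> = ord_inf"
    using preval_infinite_center[OF pre[OF ord_inf_point]] ord_inf.const_mult[OF k(2), of "X - P1 \<alpha>"]
    by (simp add: subst_P1_simps[OF s] fun_eq_iff)
  moreover have "ord_at \<alpha> \<circ> ?\<nu> = ord_at 0"
    using preval_finite_center[OF pre[OF ord_at_point], where a=0] ord_at.const_mult[OF k(2), of \<alpha> "X - P1 \<alpha>"]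
    by (simp add: subst_P1_simps[OF s] fun_eq_iff)
  moreover have "ord_at \<gamma> \<circ> ?\<nu> = ord_at 1"
  proof -
    have "P1 l * (X - P1 \<gamma>) = P1 l * (X - P1 \<alpha>) - P1 l * P1 k"
      by (simp add: \<gamma>_eq algebra_simps)
    then have "?\<nu> (X - P1 1) = P1 l * (X - P1 \<gamma>)"
      unfolding subst_P1_simps[OF s] k1 by simp
    then have "ord_at \<gamma> (?\<nu> (X - P1 1)) = 1"
      by (simp add: ord_at.const_mult k)
    then show ?thesis
      using preval_finite_center[OF pre[OF ord_at_point], where a=1] by (simp add: fun_eq_iff)
  qed
  ultimately have "aut (\<mu> \<circ> ?\<nu>)" "a \<circ> (\<mu> \<circ> ?\<nu>) = ord_at 0" "b \<circ> (\<mu> \<circ> ?\<nu>) = ord_inf" "c \<circ> (\<mu> \<circ> ?\<nu>) = ord_at 1"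
    using aut_comp[OF \<mu>(1) au] by (simp_all add: comp_assoc[symmetric] \<alpha> \<gamma> \<mu>(2))
  then show thesis by (rule that)
qed

section \<open>Double covers of the projective line\<close>

text \<open>
  The field with constants \<open>c\<close> is the quadratic extension of the rational functions,
  embedded by \<open>h\<close>, that is generated by the square root \<open>y\<close> of \<open>F\<close>.
\<close>

definition double_cover ::
  "(complex \<Rightarrow> 'l::field) \<Rightarrow> (ratfun \<Rightarrow> 'l) \<Rightarrow> 'l \<Rightarrow> ratfun \<Rightarrow> bool" where
  "double_cover c h y F \<longleftrightarrow> curve_morphism P1 c h \<and> y \<notin> range h \<and> y\<^sup>2 = h F \<and>
     (\<forall>z. \<exists>a b. z = h a + h b * y)"

lemma double_cover_rep:
  assumes "double_cover c h y F"
  obtains a b where "z = h a + h b * y"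
  using assms unfolding double_cover_def by blast

text \<open>
  In a basis \<open>u, w\<close> write \<open>1 = a u + b w\<close>. One of \<open>a\<close>, \<open>b\<close> is nonzero, so one of
  the basis vectors can be exchanged for \<open>1\<close>.
\<close>

lemma degree_2_basis:
  assumes "is_cover 2 P1 c h"
  obtains y where "y \<notin> range h" "\<And>z. \<exists>a b. z = h a + h b * y"
proof -
  have m: "curve_morphism P1 c h" and deg: "cover_degree h = 2" using assms by (auto simp: is_cover_def)
  interpret h: field_hom h using m by (simp add: curve_morphism_def)
  interpret V: vector_space "\<lambda>a x. h a * x"
    by (rule vector_space_field_hom) (rule h.field_hom_axioms)
  obtain B where B: "UNIV \<subseteq> V.span B" "card B = 2"
    using V.basis_exists[of UNIV] deg by (metis cover_degree_def)
  then obtain u w where uw: "B = {u, w}" by (auto simp: card_2_iff)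
  have span: "\<exists>a b. z = h a * u + h b * w" for z
  proof -
    have "z \<in> V.span {u, w}" using B uw by auto
    then obtain a where "z - h a * u \<in> V.span {w}" unfolding V.span_breakdown_eq by blast
    then obtain b where "z - h a * u - h b * w = 0" unfolding V.span_breakdown_eq V.span_empty by blast
    then show ?thesis by (intro exI[of _ a] exI[of _ b]) (simp add: algebra_simps)
  qed
  have *: "\<exists>y. \<forall>z. \<exists>a b. z = h a + h b * y"
    if ab: "h a * u + h b * w = 1" "a \<noteq> 0" and span: "\<And>z. \<exists>a b. z = h a * u + h b * w" for a b u w
  proof (intro exI[of _ w] allI)
    fix z
    obtain a' b' where "z = h a' * u + h b' * w" using span by blast
    moreover have "u = h (inverse a) - h (b / a) * w"
    proof -
      have "u = h (inverse a) * (h a * u)" using ab(2) by (simp add: h.hom_inverse)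
      also have "h a * u = 1 - h b * w" using ab(1) by (simp add: algebra_simps)
      finally show ?thesis by (simp add: divide_inverse h.hom_mult algebra_simps)
    qed
    ultimately have "z = h (a' * inverse a) + h (b' - a' * (b / a)) * w"
      by (simp add: h.hom_mult h.hom_minus algebra_simps del: times_divide_eq_right)
    then show "\<exists>a b. z = h a + h b * w" by blast
  qed
  obtain a b where ab: "h a * u + h b * w = 1" using span by metis
  then have "a \<noteq> 0 \<or> b \<noteq> 0" by auto
  then have "\<exists>y. \<forall>z. \<exists>a b. z = h a + h b * y"
  proof
    assume "a \<noteq> 0"
    from *[OF ab this span] show ?thesis .
  next
    assume "b \<noteq> 0"
    have "h b * w + h a * u = 1" using ab by (simp add: add.commute)
    from *[OF this \<open>b \<noteq> 0\<close>] show ?thesis using span by (metis add.commute)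
  qed
  then obtain y where y: "\<And>z. \<exists>a b. z = h a + h b * y" by blast
  moreover have "y \<notin> range h"
  proof
    assume "y \<in> range h"
    then obtain g where g: "y = h g" by blast
    have "z \<in> V.span {1}" for z
    proof -
      obtain a b where "z = h a + h b * y" using y by blast
      then have "z = h (a + b * g) * 1" by (simp add: g h.hom_add h.hom_mult)
      then show ?thesis by (metis V.span_base V.span_scale insertI1)
    qed
    then have "V.dim UNIV \<le> card {1 :: 'a}" by (intro V.dim_le_card) auto
    with deg show False by (simp add: cover_degree_def)
  qed
  ultimately show thesis using that by blast
qed

lemma double_cover_generator:
  assumes "double_cover c h y0 F0" "y \<notin> range h" "y\<^sup>2 = h F"
  shows "double_cover c h y F"
proof -
  interpret h: field_hom h using assms(1) by (simp add: double_cover_def curve_morphism_def)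
  obtain a b where ab: "y = h a + h b * y0" by (rule double_cover_rep[OF assms(1)])
  with assms(2) have "b \<noteq> 0" by auto
  have y0: "y0 = h (- (inverse b * a)) + h (inverse b) * y"
  proof -
    have "y0 = h (inverse b) * (h b * y0)" using \<open>b \<noteq> 0\<close> by (simp add: h.hom_inverse)
    also have "h b * y0 = y - h a" using ab by simp
    finally show ?thesis by (simp add: h.hom_mult h.hom_uminus algebra_simps)
  qed
  have "\<exists>a' b'. z = h a' + h b' * y" for z
  proof -
    obtain p q where "z = h p + h q * y0" by (rule double_cover_rep[OF assms(1)])
    then have "z = h (p + q * (- (inverse b * a))) + h (q * inverse b) * y"
      unfolding y0 by (simp add: h.hom_add h.hom_mult h.hom_uminus h.hom_minus algebra_simps)
    then show ?thesis by blast
  qed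
  with assms show ?thesis by (simp add: double_cover_def)
qed

text \<open>
  Completing the square in the quadratic equation of any generator.
\<close>

lemma degree_2_double_cover:
  assumes "is_cover 2 P1 c h"
  obtains y F where "double_cover c h y F"
proof -
  obtain y0 where y0: "y0 \<notin> range h" "\<And>z. \<exists>a b. z = h a + h b * y0"
    using degree_2_basis[OF assms] by blast
  have m: "curve_morphism P1 c h" using assms by (simp add: is_cover_def)
  interpret h: field_hom h using m by (simp add: curve_morphism_def)
  obtain a b where ab: "y0\<^sup>2 = h a + h b * y0" using y0 by blast
  define d where "d = P1 (1 / 2) * b"
  have b: "b = d + d"
    unfolding d_def distrib_right[symmetric] P1.hom_add[symmetric] by simp
  define y where "y = y0 - h d"
  have "y\<^sup>2 = h (a + d\<^sup>2)"
    unfolding y_def power2_diff ab by (simp add: h.hom_add h.hom_power b algebra_simps power2_eq_square h.hom_mult h.hom_numeral)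
  moreover have "y \<notin> range h"
  proof
    assume "y \<in> range h"
    then obtain g where "y = h g" by blast
    then have "y0 = h (g + d)" by (simp add: y_def h.hom_add algebra_simps)
    with y0 show False by blast
  qed
  moreover have "\<exists>a' b'. z = h a' + h b' * y" for z
  proof -
    obtain p q where "z = h p + h q * y0" using y0 by blast
    then have "z = h (p + q * d) + h q * y"
      by (simp add: y_def h.hom_add h.hom_mult algebra_simps)
    then show ?thesis by blast
  qed
  ultimately have "double_cover c h y (a + d\<^sup>2)" using m by (simp add: double_cover_def)
  then show thesis by (rule that)
qed

lemma double_cover_unique:
  assumes "double_cover c h y F" "h a + h b * y = 0"
  shows "a = 0" "b = 0"
proof -
  interpret h: field_hom h using assms(1) by (simp add: double_cover_def curve_morphism_def)
  show "b = 0"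
  proof (rule ccontr)
    assume "b \<noteq> 0"
    then have "y = h (inverse b) * (h b * y)" by (simp add: h.hom_inverse)
    also have "h b * y = - h a" using assms(2) by (simp add: eq_neg_iff_add_eq_0 add.commute)
    finally have "y = h (inverse b * (- a))" by (simp add: h.hom_mult h.hom_uminus)
    with assms(1) show False by (simp add: double_cover_def)
  qed
  with assms(2) show "a = 0" by simp
qed

lemma double_cover_nonzero: "double_cover c h y F \<Longrightarrow> F \<noteq> 0"
proof
  assume *: "double_cover c h y F" "F = 0"
  interpret h: field_hom h using * by (simp add: double_cover_def curve_morphism_def)
  from * have "y = h 0" by (simp add: double_cover_def)
  with * show False unfolding double_cover_def by blast
qed

text \<open>
  Only the class of \<open>F\<close> modulo squares matters.
\<close>

lemma double_cover_square:
  assumes "double_cover c h y (F * G\<^sup>2)"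
  shows "double_cover c h (y / h G) F"
proof -
  interpret h: field_hom h using assms by (simp add: double_cover_def curve_morphism_def)
  have G: "G \<noteq> 0" using double_cover_nonzero[OF assms] by auto
  show ?thesis
  proof (rule double_cover_generator[OF assms])
    show "y / h G \<notin> range h"
    proof
      assume "y / h G \<in> range h"
      then obtain g where "y / h G = h g" by blast
      then have "y = h (g * G)" using G by (simp add: h.hom_mult field_simps)
      with assms show False by (simp add: double_cover_def)
    qed
    show "(y / h G)\<^sup>2 = h F"
      using assms G by (simp add: double_cover_def power_divide h.hom_mult h.hom_power)
  qed
qed

lemma double_cover_aut:
  assumes "double_cover c h y (\<mu> F)" "aut \<mu>"
  shows "double_cover c (h \<circ> \<mu>) y F"
proof -
  have s: "surj \<mu>" using assms(2) by (simp add: aut_def bij_is_surj)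
  then have r: "range (h \<circ> \<mu>) = range h" by (metis image_comp)
  have "\<exists>a b. z = h (\<mu> a) + h (\<mu> b) * y" for z
    using assms(1) s unfolding double_cover_def by (metis surjD)
  then show ?thesis
    using assms curve_morphism_comp[of P1 P1 \<mu> c h] unfolding double_cover_def aut_def r by simp
qed

lemma double_cover_eq_division:
  "\<exists>r0 r1 Q. G = double_cover_eq f * Q + [:r0, r1:]"
proof (induction G)
  case 0
  then show ?case by (intro exI[of _ 0]) simp
next
  case (pCons a G)
  then obtain r0 r1 Q where "G = double_cover_eq f * Q + [:r0, r1:]" by blast
  then have "pCons a G = double_cover_eq f * (pCons r1 Q) + [:a + f * r1, r0:]"
    by (simp add: double_cover_eq_def algebra_simps)
  then show ?case by blast
qed

text \<open>
  Since \<open>y\<^sup>2 - f\<close> is monic in \<open>y\<close>, a polynomial relation can be reduced to one that is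
  linear in \<open>y\<close>, and this vanishes because \<open>1\<close> and \<open>y\<close> are linearly independent.
\<close>

lemma double_cover_given_by:
  assumes "double_cover c h y (to_fract f)"
  shows "given_by c (double_cover_eq f)"
proof -
  note m = assms[unfolded double_cover_def, THEN conjunct1]
  interpret h: field_hom h using m by (simp add: curve_morphism_def)
  interpret \<kappa>: comm_ring_hom "\<lambda>p. h (to_fract p)"
    by unfold_locales (simp_all add: h.hom_add h.hom_mult)
  interpret mk: map_poly_comm_ring_hom "\<lambda>p. h (to_fract p)" ..
  have e: "eval2 c G (h X) y = poly (map_poly (\<lambda>p. h (to_fract p)) G) y" for G
    by (simp add: eval2_def morphism_to_fract[OF m] peval_def)
  have lin: "eval2 c [:r0, r1:] (h X) y = h (to_fract r0) + h (to_fract r1) * y" for r0 r1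
    by (simp add: e \<kappa>.map_poly_pCons_hom mult.commute)
  have zero: "eval2 c (double_cover_eq f * Q) (h X) y = 0" for Q
  proof -
    have "eval2 c (double_cover_eq f) (h X) y = 0"
      using assms by (simp add: e \<kappa>.map_poly_pCons_hom double_cover_eq_def double_cover_def
          power2_eq_square h.hom_uminus)
    then show ?thesis by (simp only: e mk.hom_mult poly_mult mult_zero_left)
  qed
  have add: "eval2 c (G + H) (h X) y = eval2 c G (h X) y + eval2 c H (h X) y" for G H
    by (simp add: e mk.hom_add)
  have "eval2 c G (h X) y = 0 \<longleftrightarrow> double_cover_eq f dvd G" for G
  proof
    assume 0: "eval2 c G (h X) y = 0"
    obtain r0 r1 Q where G: "G = double_cover_eq f * Q + [:r0, r1:]"
      using double_cover_eq_division by blast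
    with 0 have "h (to_fract r0) + h (to_fract r1) * y = 0" by (simp add: add zero lin)
    from double_cover_unique[OF assms this] have "r0 = 0" "r1 = 0" by simp_all
    with G show "double_cover_eq f dvd G" by simp
  qed (auto simp: zero elim!: dvdE)
  moreover have "\<exists>G H. eval2 c H (h X) y \<noteq> 0 \<and> z = eval2 c G (h X) y / eval2 c H (h X) y" for z
  proof -
    obtain a b where z: "z = h a + h b * y" by (rule double_cover_rep[OF assms])
    obtain p1 q1 where a: "a = to_fract p1 / to_fract q1" "q1 \<noteq> 0"
      by (cases a) (simp add: Fract_conv_to_fract)
    obtain p2 q2 where b: "b = to_fract p2 / to_fract q2" "q2 \<noteq> 0"
      by (cases b) (simp add: Fract_conv_to_fract)
    have "eval2 c [:q1 * q2, 0:] (h X) y \<noteq> 0"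
      unfolding lin using a b by (simp add: h.hom_mult)
    moreover have "z = eval2 c [:p1 * q2, p2 * q1:] (h X) y / eval2 c [:q1 * q2, 0:] (h X) y"
    proof -
      have hd: "h (u / v) = h u / h v" for u v
        by (simp add: divide_inverse h.hom_mult h.hom_inverse)
      have frac: "A / B + A' / B' * y = (A * B' + A' * B * y) / (B * B')"
        if "B \<noteq> 0" "B' \<noteq> 0" for A B A' B'
        using that by (simp add: field_simps)
      have "h (to_fract q1) \<noteq> 0" "h (to_fract q2) \<noteq> 0" using a(2) b(2) by simp_all
      from frac[OF this] show ?thesis
        by (simp only: lin z a(1) b(1) hd to_fract_mult h.hom_mult to_fract_0 h.hom_zero
            mult_zero_left add_0_right)
    qed
    ultimately show ?thesis by blast
  qed
  ultimately show ?thesis unfolding given_by_def by blast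
qed

section \<open>Branch points of a double cover\<close>

text \<open>
  For the double cover \<open>y\<^sup>2 = F\<close> these are the branch points. They do not change if \<open>F\<close>
  is multiplied by a square.
\<close>

definition odd_points :: "ratfun \<Rightarrow> (ratfun \<Rightarrow> int) set" where
  "odd_points F = {v \<in> points P1. odd (v F)}"

text \<open>
  Otherwise \<open>F\<close> would be a square \<open>G\<^sup>2\<close> and \<open>y = \<plusminus> G\<close> would not generate a proper
  extension.
\<close>

lemma odd_points_nonempty:
  assumes "double_cover c h y F"
  shows "odd_points F \<noteq> {}"
proof
  assume e: "odd_points F = {}"
  interpret h: field_hom h using assms(1) by (simp add: double_cover_def curve_morphism_def)
  have "even (ord_at a F)" for a
    using e ord_at_point[of a] unfolding odd_points_def by blast
  then obtain G where G: "F = G\<^sup>2"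
    using ratfun_square[OF double_cover_nonzero[OF assms]] by blast
  have "y\<^sup>2 = (h G)\<^sup>2"
    using assms unfolding double_cover_def G h.hom_power by blast
  then have "y = h G \<or> y = h (- G)" by (simp add: power2_eq_iff h.hom_uminus)
  with assms show False unfolding double_cover_def by blast
qed

definition branch_product :: "complex set \<Rightarrow> ratfun" where
  "branch_product S = (\<Prod>a\<in>S. X - P1 a)"

lemma branch_product_nonzero [simp]: "finite S \<Longrightarrow> branch_product S \<noteq> 0"
  by (simp add: branch_product_def)

lemma ord_at_branch_product: "finite S \<Longrightarrow> ord_at b (branch_product S) = (if b \<in> S then 1 else 0)"
  by (simp add: branch_product_def ord_at.prod)

lemma ord_inf_branch_product: "finite S \<Longrightarrow> ord_inf (branch_product S) = - int (card S)"
  by (simp add: branch_product_def ord_inf.prod)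

lemma odd_points_aut:
  assumes "aut \<mu>"
  shows "odd_points F = (\<lambda>v. v \<circ> \<mu>) ` odd_points (\<mu> F)"
proof (intro equalityI subsetI)
  fix u assume u: "u \<in> odd_points F"
  have "u = u \<circ> inv_into UNIV \<mu> \<circ> \<mu>"
    using assms by (simp add: aut_def bij_is_inj comp_assoc)
  moreover have "u \<circ> inv_into UNIV \<mu> \<in> odd_points (\<mu> F)"
    using u points_comp_aut[OF aut_inv[OF assms]] assms
    by (simp add: odd_points_def aut_def bij_is_inj)
  ultimately show "u \<in> (\<lambda>v. v \<circ> \<mu>) ` odd_points (\<mu> F)" by blast
qed (use points_comp_aut[OF assms] in \<open>auto simp: odd_points_def\<close>)

text \<open>
  With one branch point moved to infinity and square factors absorbed into \<open>y\<close>, the equation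
  becomes \<open>y\<^sup>2 = \<Prod>\<^sub>S (X - a)\<close>, where \<open>S\<close> consists of the finite branch points. The
  degree is odd precisely because infinity is a branch point; this is what makes the order of
  \<open>a + b y\<close> at infinity computable from \<open>a\<close> and \<open>b\<close> by parity.
\<close>

lemma double_cover_normal_form:
  assumes "double_cover c h y F"
  obtains h' y' S where "finite S" "odd (card S)" "double_cover c h' y' (branch_product S)"
    "finite (odd_points F)" "card (odd_points F) = card S + 1"
proof -
  obtain v where v: "v \<in> odd_points F" using odd_points_nonempty[OF assms] by blast
  then obtain \<mu> where \<mu>: "aut \<mu>" "v \<circ> \<mu> = ord_inf"
    using point_to_infinity[of v] by (auto simp: odd_points_def)
  have bij: "bij \<mu>" using \<mu>(1) by (simp add: aut_def)
  define F' where "F' = inv_into UNIV \<mu> F"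
  have F: "F = \<mu> F'" using bij by (simp add: F'_def bij_is_surj surj_f_inv_f)
  have dc: "double_cover c (h \<circ> \<mu>) y F'"
    using double_cover_aut[of c h y \<mu> F'] assms \<mu>(1) by (simp add: F)
  have F'0: "F' \<noteq> 0" using double_cover_nonzero[OF dc] .
  have odd: "odd_points F' = (\<lambda>v. v \<circ> \<mu>) ` odd_points F"
    using odd_points_aut[OF \<mu>(1), of F'] by (simp add: F)
  have inj: "inj_on (\<lambda>v. v \<circ> \<mu>) (odd_points F)"
    using aut_comp_cancel[OF \<mu>(1)] by (auto intro: inj_onI)
  define S where "S = {a. odd (ord_at a F')}"
  have fin: "finite S"
    by (rule finite_subset[OF _ ratfun_finite_support[of F']]) (auto simp: S_def)
  have ord_inf: "ord_inf \<in> odd_points F'"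
    using v \<mu>(2) unfolding odd by (metis imageI)
  have odd': "odd_points F' = insert ord_inf (ord_at ` S)"
    using ord_inf unfolding odd_points_def S_def points_P1 by auto
  have inj_ord_at: "inj_on ord_at S" by (auto intro: inj_onI)
  have "ord_inf \<notin> ord_at ` S" by auto
  then have card: "card (odd_points F') = card S + 1" "finite (odd_points F')"
    using fin inj_ord_at by (simp_all add: odd' card_image)
  let ?P = "branch_product S"
  have "even (ord_at b (F' / ?P))" for b
    using F'0 fin by (simp add: ord_at.divide ord_at_branch_product S_def)
  moreover have "F' / ?P \<noteq> 0" using F'0 fin by simp
  ultimately obtain G where "F' / ?P = G\<^sup>2" by (metis ratfun_square)
  then have FG: "F' = ?P * G\<^sup>2" using fin by (simp add: field_simps)
  then have G: "G \<noteq> 0" using F'0 by auto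
  have "double_cover c (h \<circ> \<mu>) (y / (h \<circ> \<mu>) G) ?P"
    using double_cover_square dc unfolding FG by blast
  moreover have "odd (card S)"
  proof -
    have "ord_inf F' = - int (card S) + 2 * ord_inf G"
      using FG G fin by (simp add: ord_inf.mult ord_inf_branch_product ord_inf.power)
    moreover have "odd (ord_inf F')" using ord_inf by (simp add: odd_points_def)
    ultimately show ?thesis by simp
  qed
  moreover have "card (odd_points F) = card S + 1" "finite (odd_points F)"
    using card inj by (simp_all add: odd card_image finite_image_iff)
  ultimately show thesis using that fin by blast
qed

section \<open>Points of a double cover\<close>

text \<open>
  The universal property of adjoining a square root.
\<close>

lemma double_cover_extension:
  assumes "double_cover c h y F" "curve_morphism P1 d k" "\<sigma>\<^sup>2 = k F"
  obtains j where "curve_morphism c d j" "\<And>a b. j (h a + h b * y) = k a + k b * \<sigma>"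
proof -
  note m = assms(1)[unfolded double_cover_def, THEN conjunct1]
  interpret h: field_hom h using m by (simp add: curve_morphism_def)
  interpret k: field_hom k using assms(2) by (simp add: curve_morphism_def)
  define j where "j z = (THE x. \<exists>a b. z = h a + h b * y \<and> x = k a + k b * \<sigma>)" for z
  have j: "j (h a + h b * y) = k a + k b * \<sigma>" for a b
    unfolding j_def
  proof (rule the_equality)
    fix x assume "\<exists>a' b'. h a + h b * y = h a' + h b' * y \<and> x = k a' + k b' * \<sigma>"
    then obtain a' b' where ab: "h a + h b * y = h a' + h b' * y" "x = k a' + k b' * \<sigma>" by blast
    then have "h (a - a') + h (b - b') * y = 0"
      by (simp add: h.hom_minus algebra_simps)
    from double_cover_unique[OF assms(1) this] ab show "x = k a + k b * \<sigma>" by simp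
  qed blast
  have jc: "j (c a) = d a" for a
    using j[of "P1 a" 0] m assms(2) by (simp add: curve_morphism_def)
  have F: "y * y = h F" "\<sigma> * \<sigma> = k F"
    using assms by (simp_all add: double_cover_def power2_eq_square)
  have "field_hom j"
  proof
    fix z w
    obtain a b where z: "z = h a + h b * y" by (rule double_cover_rep[OF assms(1)])
    obtain a' b' where w: "w = h a' + h b' * y" by (rule double_cover_rep[OF assms(1)])
    have "z + w = h (a + a') + h (b + b') * y"
      by (simp add: z w h.hom_add algebra_simps)
    then have "j (z + w) = k (a + a') + k (b + b') * \<sigma>" by (simp only: j)
    also have "\<dots> = j z + j w" unfolding z w j by (simp add: k.hom_add algebra_simps)
    finally show "j (z + w) = j z + j w" .
    have "z * w = h a * h a' + (h a * h b' + h b * h a') * y + h b * h b' * (y * y)"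
      by (simp add: z w algebra_simps)
    also have "\<dots> = h (a * a' + b * b' * F) + h (a * b' + b * a') * y"
      unfolding F by (simp add: h.hom_add h.hom_mult algebra_simps)
    finally have "j (z * w) = k (a * a' + b * b' * F) + k (a * b' + b * a') * \<sigma>"
      by (simp only: j)
    also have "\<dots> = k a * k a' + (k a * k b' + k b * k a') * \<sigma> + k b * k b' * (\<sigma> * \<sigma>)"
      unfolding F by (simp add: k.hom_add k.hom_mult algebra_simps)
    also have "\<dots> = j z * j w" unfolding z w j by (simp add: algebra_simps)
    finally show "j (z * w) = j z * j w" .
  next
    show "j 0 = 0" "j 1 = 1" using j[of 0 0] j[of 1 0] by simp_all
  qed
  with jc have "curve_morphism c d j" by (simp add: curve_morphism_def)
  then show thesis using j by (rule that)
qed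

text \<open>
  Split off the even power \<open>u\<^bsup>2m\<^esup>\<close>; the remaining power series has nonzero constant term, so it
  has a square root.
\<close>

lemma fls_square_root:
  fixes g :: "complex fls"
  assumes "even (fls_subdegree g)" "g \<noteq> 0"
  obtains \<sigma> where "\<sigma>\<^sup>2 = g"
proof -
  obtain m where m: "fls_subdegree g = m + m" using assms(1) by (metis evenE mult_2)
  let ?b = "fls_base_factor_to_fps g"
  let ?r = "fps_radical (\<lambda>n z. csqrt z) (Suc 1) ?b"
  have b0: "?b $ 0 \<noteq> 0" using assms(2) by (simp add: fls_base_factor_to_fps_nth)
  have "csqrt (?b $ 0) ^ Suc 1 = ?b $ 0"
    by (simp only: Suc_1 power2_csqrt)
  then have "?r ^ Suc 1 = ?b"
    by (rule power_radical[OF b0, of "\<lambda>n z. csqrt z", THEN iffD1])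
  then have "?r * ?r = ?b" by (simp only: Suc_1 power2_eq_square)
  then have "(fls_shift (-m) (fps_to_fls ?r))\<^sup>2 = fls_shift (- m + - m) (fps_to_fls ?b)"
    unfolding power2_eq_square fls_times_both_shifted_simp by (simp flip: fls_times_fps_to_fls)
  also have "- m + - m = - fls_subdegree g" using m by simp
  also have "fls_shift (- fls_subdegree g) (fps_to_fls ?b) = g"
    by (rule fls_conv_base_factor_to_fps_shift_subdegree[symmetric])
  finally show thesis by (rule that)
qed

text \<open>
  The values form a nontrivial subgroup of the integers. Dividing by its positive generator makes
  the valuation surjective.
\<close>

lemma preval_normalize:
  fixes c :: "complex \<Rightarrow> 'k::field"
  assumes "field_hom c" "preval c u" "u t \<noteq> 0"
  obtains n w where "n > 0" "w \<in> points c" "\<And>z. u z = n * w z"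
proof -
  interpret u: prevaluation c u using assms by (simp add: prevaluation_def)
  define m where "m = (LEAST n. n > 0 \<and> (\<exists>z. u z = int n))"
  have "\<exists>n>0. \<exists>z. u z = int n"
  proof (cases "u t > 0")
    case True
    then show ?thesis by (intro exI[of _ "nat (u t)"]) auto
  next
    case False
    with assms(3) show ?thesis
      by (intro exI[of _ "nat (- u t)"]) (auto intro!: exI[of _ "inverse t"] simp: u.inverse)
  qed
  then have "m > 0 \<and> (\<exists>z. u z = int m)" unfolding m_def by (rule LeastI_ex)
  then obtain z0 where m: "m > 0" "u z0 = int m" by blast
  have min: "n \<le> 0 \<or> int m \<le> n" if "u z = n" for z n
  proof (rule ccontr)
    assume "\<not> ?thesis"
    then have n: "0 < nat n" "u z = int (nat n)" "nat n < m" using that by auto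
    then have "m \<le> nat n" unfolding m_def by (intro Least_le) blast
    with n show False by simp
  qed
  have z0: "z0 \<noteq> 0" using m by auto
  have dvd: "int m dvd u z" for z
  proof (cases "z = 0")
    case False
    have "u (z * z0 powi (- (u z div int m))) = u z mod int m"
      using False z0 by (simp add: u.mult u.power_int m(2) minus_div_mult_eq_mod[symmetric])
    from min[OF this] m(1) have "u z mod int m = 0"
      by (metis Euclidean_Rings.pos_mod_bound Euclidean_Rings.pos_mod_sign antisym not_less of_nat_0_less_iff)
    then show ?thesis by (simp add: mod_eq_0_iff_dvd)
  qed simp
  define w where "w z = u z div int m" for z :: 'k
  have uw: "u z = int m * w z" for z using dvd by (simp add: w_def)
  have m0: "int m > 0" using m by simp
  have "preval c w"
    unfolding preval_def
  proof (intro conjI allI impI)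
    show "w 0 = 0" by (simp add: w_def)
    show "w (c a) = 0" for a by (simp add: w_def)
    fix x y :: 'k assume xy: "x \<noteq> 0" "y \<noteq> 0"
    have "int m * w (x * y) = int m * (w x + w y)"
      using u.mult[OF xy] by (simp only: uw distrib_left)
    then show "w (x * y) = w x + w y" using m0 by simp
    assume "x + y \<noteq> 0"
    from u.add[OF xy this] have "int m * w x \<le> int m * w (x + y) \<or> int m * w y \<le> int m * w (x + y)"
      by (simp only: uw min_le_iff_disj)
    then show "min (w x) (w y) \<le> w (x + y)" using m0 by (simp add: min_le_iff_disj)
  qed
  then interpret w: prevaluation c w using assms by (simp add: prevaluation_def)
  have "w z0 = 1" using m by (simp add: w_def)
  from w.in_points[OF this] show thesis using that[of "int m" w] m0 uw by blast
qed

section \<open>The genus of a double cover\<close>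

lemma ord_inf_to_fract: "p \<noteq> 0 \<Longrightarrow> ord_inf (to_fract p) = - int (degree p)"
proof (induction p rule: complex_poly_induct)
  case (const c)
  then show ?case by (simp flip: P1_def)
next
  case (linear_factor p a)
  then have "to_fract p \<noteq> 0" by simp
  then have "ord_inf (to_fract (p * [:-a, 1:])) = ord_inf (to_fract p) - 1"
    unfolding to_fract_mult X_minus_P1[symmetric] by (simp add: ord_inf.mult)
  moreover have "degree (p * [:-a, 1:]) = degree p + 1"
    using linear_factor(1) by (subst degree_mult_eq) auto
  ultimately show ?case using linear_factor(2) by simp
qed

lemma ratfun_polynomial:
  assumes "F \<noteq> 0" "\<And>a. ord_at a F \<ge> 0"
  obtains p where "F = to_fract p"
proof -
  obtain c where c: "c \<noteq> 0" "finite {a. ord_at a F \<noteq> 0}"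
    and F: "F = P1 c * (\<Prod>a | ord_at a F \<noteq> 0. (X - P1 a) powi ord_at a F)"
    by (rule ratfun_factorization[OF assms(1)])
  have "(X - P1 a) powi ord_at a F = to_fract ([:-a, 1:] ^ nat (ord_at a F))" for a
  proof -
    have "(X - P1 a) powi ord_at a F = (X - P1 a) ^ nat (ord_at a F)"
      using assms(2)[of a] by (simp add: power_int_def)
    also have "\<dots> = to_fract ([:-a, 1:] ^ n)" if "n = nat (ord_at a F)" for n
      unfolding that[symmetric] X_minus_P1 by (induction n) (simp_all del: mult_pCons_left mult_pCons_right)
    finally show ?thesis by simp
  qed
  moreover have "(\<Prod>a\<in>A. to_fract (q a)) = to_fract (\<Prod>a\<in>A. q a)" for A and q :: "complex \<Rightarrow> complex poly"
    by (induction A rule: infinite_finite_induct) simp_all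
  ultimately have "F = to_fract ([:c:] * (\<Prod>a | ord_at a F \<noteq> 0. [:-a, 1:] ^ nat (ord_at a F)))"
    by (subst F) (simp only: P1_def to_fract_mult)
  then show thesis by (rule that)
qed

text \<open>
  The substitution \<open>X = a + u\<^sup>2\<close> doubles all orders. Hence every rational function becomes a
  Laurent series of even order, which has a square root, whether or not \<open>a\<close> is a branch point:
  a double cover can be embedded over this substitution uniformly in \<open>a\<close>.
\<close>

lemma subdegree_subst_finite:
  "fls_subdegree (subst fls_const (fls_const a + fls_X ^ 2) F) = 2 * ord_at a F"
  "fls_const a + fls_X ^ 2 \<notin> range (fls_const :: complex \<Rightarrow> _)"
proof -
  show n: "fls_const a + fls_X ^ 2 \<notin> range (fls_const :: complex \<Rightarrow> _)"
    by (rule fls_not_const) simp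
  let ?u = "fls_subdegree \<circ> subst fls_const (fls_const a + fls_X ^ 2 :: complex fls)"
  interpret u: prevaluation P1 ?u by (rule prevaluation_subst_fls[OF n])
  have "?u (X - P1 a) = 2" by (simp add: subst_fls_linear[OF n])
  with preval_finite_center[OF u.v, of a F]
  show "fls_subdegree (subst fls_const (fls_const a + fls_X ^ 2) F) = 2 * ord_at a F" by simp
qed

lemma subdegree_subst_infinite:
  "fls_subdegree (subst fls_const (fls_X_inv ^ 2) F) = 2 * ord_inf F"
  "fls_X_inv ^ 2 \<notin> range (fls_const :: complex \<Rightarrow> _)"
proof -
  show n: "fls_X_inv ^ 2 \<notin> range (fls_const :: complex \<Rightarrow> _)"
    using fls_not_const[of "fls_X_inv ^ 2" 0] by simp
  let ?u = "fls_subdegree \<circ> subst fls_const (fls_X_inv ^ 2 :: complex fls)"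
  interpret u: prevaluation P1 ?u by (rule prevaluation_subst_fls[OF n])
  have "?u X = -2" by (simp add: subst_X[OF field_hom_fls_const n])
  with preval_infinite_center[OF u.v, of F]
  show "fls_subdegree (subst fls_const (fls_X_inv ^ 2) F) = 2 * ord_inf F" by simp
qed

lemma divisor_single:
  "v \<in> points c \<Longrightarrow> (\<lambda>w. if w = v then n else 0) \<in> divisors c"
  "divisor_degree (\<lambda>w. if w = v then n else 0) = n"
proof -
  have s: "{w. (if w = v then n else 0) \<noteq> 0} = (if n = 0 then {} else {v})" by auto
  then show "v \<in> points c \<Longrightarrow> (\<lambda>w. if w = v then n else 0) \<in> divisors c"
    by (simp add: divisors_def)
  show "divisor_degree (\<lambda>w. if w = v then n else 0) = n"
    by (simp add: divisor_degree_def s)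
qed

lemma fls_subdegree_add_nonneg:
  "fls_subdegree (x :: complex fls) \<ge> 0 \<Longrightarrow> fls_subdegree y \<ge> 0 \<Longrightarrow> fls_subdegree (x + y) \<ge> 0"
  by (cases "x + y = 0") (use fls_plus_subdegree[of x y] in auto)

text \<open>
  Let \<open>w\<close> be the point over infinity. On \<open>y\<^sup>2 = f(x)\<close> with \<open>deg f = 2 g + 1\<close>, the divisor
  \<open>D = 2 g w\<close> has \<open>L(D)\<close> spanned by \<open>1, x, \<dots>, x\<^sup>g\<close>, so
  \<open>deg D + 1 - dim L(D) \<ge> g\<close>. Indeed, let \<open>z = a + b y\<close> belong to \<open>L(D)\<close>. Over each
  finite \<open>\<alpha>\<close> the two embeddings \<open>y \<mapsto> \<plusminus> \<sigma>\<close> show that \<open>a\<close> and \<open>b y\<close> have no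
  poles, and as \<open>f\<close> is squarefree, \<open>a\<close> and \<open>b\<close> are polynomials. At \<open>w\<close> the order of
  \<open>a\<close> is even and that of \<open>b y\<close> is odd and less than \<open>- 2 g\<close> unless \<open>b = 0\<close>.
\<close>

lemma double_cover_genus_ge:
  assumes dc: "double_cover c h y (branch_product S)" and S: "finite S" "card S = 2 * g + 1"
    and genus: "has_genus c n"
  shows "g \<le> n"
proof -
  note m = dc[unfolded double_cover_def, THEN conjunct1]
  have fc: "field_hom c" by (rule morphism_field_hom(2)[OF m])
  interpret c: field_hom c by (rule fc)
  interpret h: field_hom h by (rule morphism_field_hom(1)[OF m])
  interpret V: vector_space "\<lambda>a f. c a * f" by (rule vector_space_field_hom[OF fc])
  let ?P = "branch_product S"
  have P0: "?P \<noteq> 0" using S by simp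
  note ni = subdegree_subst_infinite(2)
  note ki = curve_morphism_subst[OF field_hom_fls_const ni]
  interpret ki: field_hom "subst fls_const (fls_X_inv ^ 2 :: complex fls)"
    by (rule morphism_field_hom(1)[OF ki])
  obtain \<tau> where \<tau>: "\<tau>\<^sup>2 = subst fls_const (fls_X_inv ^ 2) ?P"
  proof (rule fls_square_root)
    show "subst fls_const (fls_X_inv ^ 2 :: complex fls) ?P \<noteq> 0" using P0 by simp
  qed (simp add: subdegree_subst_infinite)
  obtain j where j: "curve_morphism c fls_const j"
    "\<And>a b. j (h a + h b * y) = subst fls_const (fls_X_inv ^ 2) a + subst fls_const (fls_X_inv ^ 2) b * \<tau>"
    using double_cover_extension[OF dc ki \<tau>] by blast
  interpret j: field_hom j using j(1) by (simp add: curve_morphism_def)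
  define w where "w = fls_subdegree \<circ> j"
  have "preval c w" unfolding w_def by (rule preval_comp[OF j(1) preval_subdegree])
  then interpret w: prevaluation c w using fc by (simp add: prevaluation_def)
  have wh: "w (h a) = 2 * ord_inf a" for a
    using j(2)[of a 0] subdegree_subst_infinite(1)[of a] by (simp add: w_def)
  have y0: "y \<noteq> 0" using dc h.hom_zero unfolding double_cover_def by (metis rangeI)
  have wy: "w y = - int (2 * g + 1)"
  proof -
    have "2 * w y = w (h ?P)" using dc w.power[of y 2] by (simp add: double_cover_def)
    also have "\<dots> = - (2 * int (2 * g + 1))" using S by (simp add: wh ord_inf_branch_product)
    finally show ?thesis by simp
  qed
  \<comment> \<open>An element of order \<open>- (2 g + 1) + 2 (g + 1) = 1\<close>, so that \<open>w\<close> is surjective.\<close>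
  have "w (y * h X powi (- int (g + 1))) = 1"
    using y0 by (simp add: w.mult w.power_int wy wh)
  then have w: "w \<in> points c" by (rule w.in_points)
  define D where "D = (\<lambda>v. if v = w then 2 * int g else 0)"
  have D: "D \<in> divisors c" "divisor_degree D = 2 * int g"
    unfolding D_def using divisor_single w by blast+
  have main: "\<exists>p. z = h (to_fract p) \<and> degree p \<le> g" if z: "z \<in> riemann_roch_space c D" for z
  proof (cases "z = 0")
    case True
    then show ?thesis by (intro exI[of _ 0]) simp
  next
    case False
    obtain a b where ab: "z = h a + h b * y" by (rule double_cover_rep[OF dc])
    have pos: "ord_at \<alpha> a \<ge> 0 \<and> ord_at \<alpha> b \<ge> 0" for \<alpha>
    proof -
      let ?k = "subst fls_const (fls_const \<alpha> + fls_X ^ 2 :: complex fls)"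
      note nf = subdegree_subst_finite(2)[of \<alpha>]
      note kf = curve_morphism_subst[OF field_hom_fls_const nf]
      interpret k: field_hom ?k by (rule morphism_field_hom(1)[OF kf])
      obtain \<sigma> where \<sigma>: "\<sigma>\<^sup>2 = ?k ?P"
        by (rule fls_square_root[of "?k ?P"]) (use P0 in \<open>simp_all add: subdegree_subst_finite(1)\<close>)
      have nonneg: "fls_subdegree (?k a + ?k b * \<rho>) \<ge> 0" if \<rho>: "\<rho>\<^sup>2 = ?k ?P" for \<rho>
      proof -
        obtain i where i: "curve_morphism c fls_const i" "\<And>a b. i (h a + h b * y) = ?k a + ?k b * \<rho>"
          using double_cover_extension[OF dc kf \<rho>] by blast
        have pre: "preval c (fls_subdegree \<circ> i)" by (rule preval_comp[OF i(1) preval_subdegree])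
        have ih: "(fls_subdegree \<circ> i) (h f) = 2 * ord_at \<alpha> f" for f
          using i(2)[of f 0] subdegree_subst_finite(1)[of \<alpha> f] by simp
        have "(fls_subdegree \<circ> i) (h (X - P1 \<alpha>)) \<noteq> 0" unfolding ih by simp
        then obtain n v where v: "n > 0" "v \<in> points c" "\<And>z. (fls_subdegree \<circ> i) z = n * v z"
          using preval_normalize[OF fc pre] by metis
        have "n * v (h X) \<ge> 0" unfolding v(3)[symmetric] ih by simp
        moreover have "w (h X) < 0" unfolding wh by simp
        ultimately have "v \<noteq> w" using v(1) by (auto simp: zero_le_mult_iff)
        then have "v z \<ge> 0" using z v(2) False by (auto simp: riemann_roch_space_def D_def)
        then have "(fls_subdegree \<circ> i) z \<ge> 0" using v(1) by (simp only: v(3)) simp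
        then show ?thesis by (simp add: ab i(2))
      qed
      have two: "fls_subdegree (2 * x) = fls_subdegree x" for x :: "complex fls"
        by (cases "x = 0") simp_all
      \<comment> \<open>Both square roots of \<open>f\<close> are allowed, which separates the two summands.\<close>
      have 1: "fls_subdegree (?k a + ?k b * \<sigma>) \<ge> 0" by (rule nonneg[OF \<sigma>])
      have 2: "fls_subdegree (?k a + ?k b * (- \<sigma>)) \<ge> 0" by (rule nonneg) (simp add: \<sigma>)
      have "fls_subdegree (2 * ?k a) \<ge> 0"
        using fls_subdegree_add_nonneg[OF 1 2] by simp
      then have "fls_subdegree (?k a) \<ge> 0" by (simp only: two)
      then have a: "ord_at \<alpha> a \<ge> 0" by (simp add: subdegree_subst_finite(1))
      have 3: "fls_subdegree (- (?k a + ?k b * (- \<sigma>))) \<ge> 0" using 2 by (simp only: fls_uminus_subdegree)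
      have "fls_subdegree (2 * (?k b * \<sigma>)) \<ge> 0"
        using fls_subdegree_add_nonneg[OF 1 3] by (simp add: algebra_simps)
      then have "fls_subdegree (?k b * \<sigma>) \<ge> 0"
        by (simp only: two)
      moreover have "fls_subdegree ((?k b * \<sigma>)\<^sup>2) = 2 * fls_subdegree (?k b * \<sigma>)"
        by (simp add: fls_subdegree_pow)
      moreover have "(?k b * \<sigma>)\<^sup>2 = ?k (b\<^sup>2 * ?P)"
        by (simp add: power_mult_distrib \<sigma> k.hom_mult k.hom_power)
      ultimately have "ord_at \<alpha> (b\<^sup>2 * ?P) \<ge> 0" by (simp add: subdegree_subst_finite(1))
      then have "ord_at \<alpha> b \<ge> 0"
        using P0 S by (cases "b = 0") (auto simp: ord_at.mult ord_at.power ord_at_branch_product split: if_splits)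
      with a show ?thesis by simp
    qed
    have wz: "w z \<ge> - 2 * int g"
      using z w False by (auto simp: riemann_roch_space_def D_def)
    have "b = 0"
    proof (rule ccontr)
      assume b: "b \<noteq> 0"
      have "ord_inf b \<le> 0"
        using ratfun_degree[OF b ratfun_finite_support[of b] subset_refl] pos
          sum_nonneg[of "{a. ord_at a b \<noteq> 0}" "\<lambda>a. ord_at a b"] by auto
      moreover have hby: "w (h b * y) = 2 * ord_inf b - int (2 * g + 1)"
        using b y0 by (simp add: w.mult wh wy)
      ultimately have lt: "w (h b * y) < - 2 * int g" by simp
      show False
      proof (cases "a = 0")
        case True
        then show False using lt wz ab by simp
      next
        case False
        have "w (h a) \<noteq> w (h b * y)" unfolding hby wh by presburger
        then consider "w (h a) < w (h b * y)" | "w (h b * y) < w (h a)" by linarith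
        then have "w z = w (h a) \<and> w (h a) < w (h b * y) \<or> w z = w (h b * y)"
        proof cases
          case 1
          then show ?thesis using w.add_less[of "h a" "h b * y"] False b y0 ab by simp
        next
          case 2
          then show ?thesis using w.add_less[of "h b * y" "h a"] False b y0 ab by (simp add: add.commute)
        qed
        then show False using lt wz by auto
      qed
    qed
    with ab False have z': "z = h a" and a0: "a \<noteq> 0" by auto
    obtain p where p: "a = to_fract p" using ratfun_polynomial[OF a0] pos by blast
    have "p \<noteq> 0" using a0 p by auto
    from ord_inf_to_fract[OF this] wz have "degree p \<le> g" by (simp add: z' wh p)
    with z' p show ?thesis by blast
  qed
  have "riemann_roch_space c D \<subseteq> V.span ((\<lambda>i. h X ^ i) ` {..g})"
  proof
    fix z assume "z \<in> riemann_roch_space c D"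
    then obtain p where p: "z = h (to_fract p)" "degree p \<le> g" using main by blast
    have "z = (\<Sum>i\<le>degree p. c (coeff p i) * h X ^ i)"
      by (simp add: p morphism_to_fract[OF m] peval_def poly_altdef c.degree_map_poly_hom c.coeff_map_poly_hom)
    also have "\<dots> \<in> V.span ((\<lambda>i. h X ^ i) ` {..g})"
      using p(2) by (intro V.span_sum V.span_scale V.span_base) auto
    finally show "z \<in> V.span ((\<lambda>i. h X ^ i) ` {..g})" .
  qed
  then have "V.dim (riemann_roch_space c D) \<le> card ((\<lambda>i. h X ^ i) ` {..g})"
    by (intro V.dim_le_card) auto
  also have "\<dots> \<le> g + 1" using card_image_le[of "{..g}"] by simp
  finally have "riemann_roch_dim c D \<le> g + 1" by (simp add: riemann_roch_dim_def)
  moreover have "divisor_degree D + 1 - int (riemann_roch_dim c D) \<le> int n"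
    using genus D(1) by (simp add: has_genus_def)
  ultimately show ?thesis using D(2) by simp
qed

text \<open>
  Transported to the line, a divisor \<open>D\<close> of degree \<open>d \<ge> 0\<close> becomes \<open>e\<close>. The function
  \<open>G\<close> whose divisor is \<open>- e\<close> at the finite points identifies \<open>L(D)\<close> with the polynomials
  of degree at most \<open>d\<close>, whose dimension is \<open>d + 1\<close>.
\<close>

lemma rational_genus:
  assumes m: "curve_morphism P1 c j" and "surj j" and genus: "has_genus c n"
  shows "n = 0"
proof -
  have fc: "field_hom c" by (rule morphism_field_hom(2)[OF m])
  interpret c: field_hom c by (rule fc)
  interpret j: field_hom j by (rule morphism_field_hom(1)[OF m])
  interpret V: vector_space "\<lambda>a f. c a * f" by (rule vector_space_field_hom[OF fc])
  have ji [simp]: "j (inv_into UNIV j z) = z" "inv_into UNIV j (j a) = a" for z a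
    using \<open>surj j\<close> by (simp_all add: surj_f_inv_f j.injectivity inj_def)
  have jc: "j (P1 a) = c a" for a using m by (simp add: curve_morphism_def)
  have mi: "curve_morphism c P1 (inv_into UNIV j)"
  proof -
    have *: "inv_into UNIV j z = a \<longleftrightarrow> z = j a" for z a by auto
    have "field_hom (inv_into UNIV j)"
      by unfold_locales (simp_all add: * j.hom_add j.hom_mult)
    then show ?thesis by (simp add: curve_morphism_def * jc)
  qed
  let ?t = "\<lambda>u. u \<circ> inv_into UNIV j"
  have si: "surj (inv_into UNIV j)" by (rule surjI[of _ j]) simp
  have pts: "points c = ?t ` points P1"
  proof (intro equalityI subsetI)
    fix v assume "v \<in> points c"
    then have "v \<circ> j \<in> points P1" by (rule points_comp[OF m \<open>surj j\<close>])
    moreover have "v = ?t (v \<circ> j)" by (simp add: fun_eq_iff)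
    ultimately show "v \<in> ?t ` points P1" by blast
  qed (auto intro: points_comp[OF mi si])
  have inj_t: "?t u = ?t v \<longleftrightarrow> u = v" for u v :: "ratfun \<Rightarrow> int"
    by (rule comp_surj_cancel[OF si])
  have "divisor_degree D + 1 - int (riemann_roch_dim c D) \<le> 0" if D: "D \<in> divisors c" for D
  proof (cases "divisor_degree D < 0")
    case True
    then show ?thesis by simp
  next
    case False
    define e where "e u = D (?t u)" for u
    define Z where "Z = {\<alpha>. e (ord_at \<alpha>) \<noteq> 0}"
    have finD: "finite {v. D v \<noteq> 0}" "{v. D v \<noteq> 0} \<subseteq> points c" using D by (auto simp: divisors_def)
    have "inj_on (\<lambda>\<alpha>. ?t (ord_at \<alpha>)) Z" by (auto intro!: inj_onI simp: inj_t)
    moreover have "(\<lambda>\<alpha>. ?t (ord_at \<alpha>)) ` Z \<subseteq> {v. D v \<noteq> 0}" by (auto simp: Z_def e_def)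
    ultimately have finZ: "finite Z" using finD(1) by (metis finite_imageD finite_subset)
    have supp: "{v. D v \<noteq> 0} \<subseteq> ?t ` insert ord_inf (ord_at ` Z)"
    proof
      fix v assume v: "v \<in> {v. D v \<noteq> 0}"
      with finD(2) obtain u where u: "u \<in> points P1" "v = ?t u" unfolding pts by blast
      with v show "v \<in> ?t ` insert ord_inf (ord_at ` Z)" by (auto simp: points_P1 Z_def e_def)
    qed
    define d where "d = nat (divisor_degree D)"
    have deg: "int d = e ord_inf + (\<Sum>\<alpha>\<in>Z. e (ord_at \<alpha>))"
    proof -
      have "divisor_degree D = sum D (?t ` insert ord_inf (ord_at ` Z))"
        unfolding divisor_degree_def using finZ supp by (intro sum.mono_neutral_left) auto
      also have "\<dots> = (\<Sum>u\<in>insert ord_inf (ord_at ` Z). e u)"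
        by (subst sum.reindex) (auto intro!: inj_onI simp: inj_t e_def)
      also have "\<dots> = e ord_inf + (\<Sum>u\<in>ord_at ` Z. e u)"
        using finZ by (subst sum.insert) auto
      also have "(\<Sum>u\<in>ord_at ` Z. e u) = (\<Sum>\<alpha>\<in>Z. e (ord_at \<alpha>))"
        by (subst sum.reindex) (auto intro!: inj_onI)
      finally show ?thesis using False by (simp add: d_def)
    qed
    define G where "G = (\<Prod>\<alpha>\<in>Z. (X - P1 \<alpha>) powi (- e (ord_at \<alpha>)))"
    have G0: "G \<noteq> 0" using finZ by (simp add: G_def)
    have Gf: "ord_at \<alpha> G = - e (ord_at \<alpha>)" for \<alpha>
      using finZ by (simp add: G_def ord_at_prod_powi) (simp add: Z_def)
    have Gi: "ord_inf G = int d - e ord_inf"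
      using finZ deg by (simp add: G_def ord_inf_prod_powi sum_negf)
    have L: "j a \<in> riemann_roch_space c D \<longleftrightarrow> (a \<noteq> 0 \<longrightarrow> (\<forall>\<alpha>. ord_at \<alpha> a \<ge> - e (ord_at \<alpha>)) \<and> ord_inf a \<ge> - e ord_inf)" for a
      unfolding riemann_roch_space_def pts by (auto simp: points_P1 e_def)
    let ?b = "\<lambda>i. j (G * X ^ i)"
    have jsum: "(\<Sum>i\<le>d. c (coeff p i) * ?b i) = j (G * to_fract p)" if "degree p \<le> d" for p
    proof -
      have "to_fract p = peval P1 X p"
        using morphism_to_fract[OF curve_morphism_id[OF field_hom_P1]] by simp
      also have "\<dots> = (\<Sum>i\<le>degree p. P1 (coeff p i) * X ^ i)"
        by (simp add: peval_def poly_altdef P1.degree_map_poly_hom P1.coeff_map_poly_hom)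
      also have "\<dots> = (\<Sum>i\<le>d. P1 (coeff p i) * X ^ i)"
        using that by (intro sum.mono_neutral_left) (auto simp: coeff_eq_0)
      finally show ?thesis
        by (simp add: sum_distrib_left j.hom_sum j.hom_mult jc mult_ac)
    qed
    have inj_b: "inj_on ?b {..d}"
    proof (rule inj_onI)
      fix i k assume "?b i = ?b k"
      then have "X ^ i = X ^ k" using G0 by simp
      then have "ord_inf (X ^ i) = ord_inf (X ^ k)" by simp
      then show "i = k" by (simp add: ord_inf.power)
    qed
    have "V.dim (riemann_roch_space c D) = d + 1"
    proof (rule V.dim_unique)
      show "?b ` {..d} \<subseteq> riemann_roch_space c D"
        using G0 by (auto simp: L ord_at.mult ord_inf.mult ord_at.power ord_inf.power Gf Gi)
      show "riemann_roch_space c D \<subseteq> V.span (?b ` {..d})"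
      proof
        fix z assume z: "z \<in> riemann_roch_space c D"
        obtain a where a: "z = j a" using \<open>surj j\<close> by blast
        show "z \<in> V.span (?b ` {..d})"
        proof (cases "a = 0")
          case True
          then show ?thesis using V.span_zero by (simp add: a)
        next
          case False
          have za: "- e (ord_at \<alpha>) \<le> ord_at \<alpha> a" "- e ord_inf \<le> ord_inf a" for \<alpha>
            using z False by (simp_all add: a L)
          have nonneg: "ord_at \<alpha> (a / G) \<ge> 0" for \<alpha>
            using za(1)[of \<alpha>] False G0 by (simp add: ord_at.divide Gf)
          have aG: "a / G \<noteq> 0" using False G0 by simp
          obtain p where p: "a / G = to_fract p" by (rule ratfun_polynomial[OF aG nonneg])
          have "ord_inf (a / G) \<ge> - int d" using za(2) False G0 by (simp add: ord_inf.divide Gi)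
          moreover have "p \<noteq> 0" using p aG by auto
          ultimately have "degree p \<le> d" by (simp add: p ord_inf_to_fract)
          from jsum[OF this] have "z = (\<Sum>i\<le>d. c (coeff p i) * ?b i)"
            using p G0 by (simp add: a field_simps)
          also have "\<dots> \<in> V.span (?b ` {..d})"
            by (intro V.span_sum V.span_scale V.span_base) auto
          finally show ?thesis .
        qed
      qed
      show "card (?b ` {..d}) = d + 1" using inj_b by (simp add: card_image)
      show "\<not> V.dependent (?b ` {..d})"
      proof
        assume "V.dependent (?b ` {..d})"
        then obtain u where u: "\<exists>v\<in>?b ` {..d}. u v \<noteq> 0" "(\<Sum>v\<in>?b ` {..d}. c (u v) * v) = 0"
          using V.dependent_finite[of "?b ` {..d}"] by auto
        define p where "p = (\<Sum>i\<le>d. monom (u (?b i)) i)"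
        have cp: "coeff p i = (if i \<le> d then u (?b i) else 0)" for i
          by (simp add: p_def coeff_sum)
        have "degree p \<le> d" by (rule degree_le) (simp add: cp)
        from jsum[OF this] have "(\<Sum>i\<le>d. c (u (?b i)) * ?b i) = j (G * to_fract p)"
          by (simp add: cp)
        moreover have "(\<Sum>v\<in>?b ` {..d}. c (u v) * v) = (\<Sum>i\<le>d. c (u (?b i)) * ?b i)"
          using inj_b by (subst sum.reindex) auto
        ultimately have "p = 0" using u(2) G0 by simp
        then have "u (?b i) = 0" if "i \<le> d" for i using cp[of i] that by simp
        with u(1) show False by auto
      qed
    qed
    then show ?thesis using False by (simp add: riemann_roch_dim_def d_def)
  qed
  then show ?thesis using genus unfolding has_genus_def by force
qed

text \<open>
  If \<open>y\<^sup>2 = x - \<alpha>\<close>, then \<open>x\<close> is a polynomial in \<open>y\<close>, so \<open>y\<close> alone generates the field.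
\<close>

lemma double_cover_one_branch_point_rational:
  assumes dc: "double_cover c h y (X - P1 \<alpha>)"
  obtains j where "curve_morphism P1 c j" "surj j"
proof -
  note m = dc[unfolded double_cover_def, THEN conjunct1]
  have fc: "field_hom c" by (rule morphism_field_hom(2)[OF m])
  interpret h: field_hom h by (rule morphism_field_hom(1)[OF m])
  have hc: "h (P1 a) = c a" for a using m by (simp add: curve_morphism_def)
  have y: "y \<notin> range c" using dc by (metis double_cover_def hc image_iff rangeI)
  note mj = curve_morphism_subst[OF fc y]
  let ?j = "subst c y"
  interpret j: field_hom ?j by (rule morphism_field_hom(1)[OF mj])
  have jc: "?j (P1 a) = c a" for a using mj by (simp add: curve_morphism_def)
  have jX: "?j X = y" by (rule subst_X[OF fc y])
  have n: "P1 \<alpha> + X\<^sup>2 \<notin> range P1"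
  proof (rule not_const_if_val[OF ord_inf_point])
    show "ord_inf (P1 \<alpha> + X\<^sup>2) \<noteq> 0"
      using ord_inf.add_less[of "X\<^sup>2" "P1 \<alpha>"] by (cases "\<alpha> = 0") (simp_all add: ord_inf.power add.commute)
  qed
  have eq: "?j \<circ> subst P1 (P1 \<alpha> + X\<^sup>2) = h"
  proof (rule morphism_eqI)
    show "curve_morphism P1 c (?j \<circ> subst P1 (P1 \<alpha> + X\<^sup>2))"
      by (rule curve_morphism_comp[OF curve_morphism_subst[OF field_hom_P1 n] mj])
    have "y\<^sup>2 = h X - c \<alpha>" using dc by (simp add: double_cover_def h.hom_minus hc)
    then show "(?j \<circ> subst P1 (P1 \<alpha> + X\<^sup>2)) X = h X"
      by (simp add: subst_X[OF field_hom_P1 n] j.hom_add j.hom_power jc jX)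
  qed (rule m)
  have "surj ?j"
    unfolding surj_def
  proof
    fix z
    obtain a b where z: "z = h a + h b * y" by (rule double_cover_rep[OF dc])
    have "z = ?j (subst P1 (P1 \<alpha> + X\<^sup>2) a + subst P1 (P1 \<alpha> + X\<^sup>2) b * X)"
      unfolding z eq[symmetric] by (simp add: j.hom_add j.hom_mult jX)
    then show "\<exists>x. z = ?j x" by blast
  qed
  with mj show thesis by (rule that)
qed

theorem double_cover_branch_points:
  assumes dc: "double_cover c h y F" and genus: "has_genus c n"
  shows "finite (odd_points F)" "card (odd_points F) \<le> 2 * n + 2"
    "n > 0 \<Longrightarrow> card (odd_points F) > 2"
    "even (card (odd_points F))"
proof -
  obtain h' y' S where S: "finite S" "odd (card S)" and dc': "double_cover c h' y' (branch_product S)"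
    and card: "finite (odd_points F)" "card (odd_points F) = card S + 1"
    by (rule double_cover_normal_form[OF dc])
  obtain g where g: "card S = 2 * g + 1" using S(2) by (auto elim: oddE)
  from double_cover_genus_ge[OF dc' S(1) g genus] have "g \<le> n" .
  with card g show "finite (odd_points F)" "card (odd_points F) \<le> 2 * n + 2" "even (card (odd_points F))" by auto
  show "card (odd_points F) > 2" if "n > 0"
  proof (rule ccontr)
    assume "\<not> ?thesis"
    then have "card S = 1" using card g by simp
    then obtain \<alpha> where "S = {\<alpha>}" by (auto simp: card_1_singleton_iff)
    with dc' have "double_cover c h' y' (X - P1 \<alpha>)" by (simp add: branch_product_def)
    then obtain j where "curve_morphism P1 c j" "surj j"
      by (rule double_cover_one_branch_point_rational)
    from rational_genus[OF this genus] that show False by simp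
  qed
qed

section \<open>Fibres of a morphism between projective lines\<close>

lemma ratfun_divisor_degree:
  assumes "F \<noteq> 0"
  shows "finite {w \<in> points P1. w F \<noteq> 0}" "(\<Sum>w | w \<in> points P1 \<and> w F \<noteq> 0. w F) = 0"
proof -
  let ?Z = "{a. ord_at a F \<noteq> 0}"
  have s: "{w \<in> points P1. w F \<noteq> 0} \<subseteq> insert ord_inf (ord_at ` ?Z)" by (auto simp: points_P1)
  have f: "finite (insert ord_inf (ord_at ` ?Z))" using ratfun_finite_support[of F] by simp
  from s f show "finite {w \<in> points P1. w F \<noteq> 0}" by (rule finite_subset)
  have "(\<Sum>w | w \<in> points P1 \<and> w F \<noteq> 0. w F) = (\<Sum>w\<in>insert ord_inf (ord_at ` ?Z). w F)"
    by (rule sum.mono_neutral_left[OF f s]) auto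
  also have "\<dots> = ord_inf F + (\<Sum>w\<in>ord_at ` ?Z. w F)"
    using f by (subst sum.insert) auto
  also have "(\<Sum>w\<in>ord_at ` ?Z. w F) = (\<Sum>a\<in>?Z. ord_at a F)"
    by (subst sum.reindex) (auto intro!: inj_onI)
  also have "\<dots> = - ord_inf F"
    by (rule ratfun_degree[OF assms ratfun_finite_support subset_refl])
  finally show "(\<Sum>w | w \<in> points P1 \<and> w F \<noteq> 0. w F) = 0" by simp
qed

lemma zeros_poles_balance:
  assumes "F \<noteq> 0"
  shows "(\<Sum>w | w \<in> points P1 \<and> w F > 0. w F) = (\<Sum>w | w \<in> points P1 \<and> w F < 0. - w F)"
proof -
  have e: "{w \<in> points P1. w F \<noteq> 0} = {w \<in> points P1. w F > 0} \<union> {w \<in> points P1. w F < 0}" by auto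
  have f: "finite {w \<in> points P1. w F > 0}" "finite {w \<in> points P1. w F < 0}"
    using ratfun_divisor_degree(1)[OF assms] unfolding e by simp_all
  have "0 = (\<Sum>w | w \<in> points P1 \<and> w F > 0. w F) + (\<Sum>w | w \<in> points P1 \<and> w F < 0. w F)"
    using ratfun_divisor_degree(2)[OF assms] f unfolding e by (subst (asm) sum.union_disjoint) auto
  then show ?thesis by (simp add: sum_negf)
qed

lemma ramification_index_eq:
  assumes "v \<in> points c" "has_ramification_index h v w e"
  shows "ramification_index h v w = e"
  unfolding ramification_index_def
proof (rule the_equality)
  show "has_ramification_index h v w e" by (rule assms(2))
  fix e' assume e': "has_ramification_index h v w e'"
  from assms(1) have "surj v" by (simp add: points_iff)
  then obtain x where x: "v x = 1" by (metis surjD)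
  have "w (h x) = int e' * v x" "w (h x) = int e * v x"
    using e' assms(2) unfolding has_ramification_index_def by blast+
  then have "int e' = int e" by (simp add: x)
  then show "e' = e" by simp
qed

lemma fibreD:
  assumes "v \<in> points c" "w \<in> fibre d h v"
  shows "w \<in> points d" "ramification_index h v w > 0" "w (h F) = int (ramification_index h v w) * v F"
  using assms ramification_index_eq[OF assms(1)]
  by (auto simp: fibre_def has_ramification_index_def)

text \<open>
  If \<open>e v = e' v'\<close> with both valuations surjective, then \<open>e\<close> and \<open>e'\<close> divide each other.
\<close>

lemma fibres_disjoint:
  assumes "v \<in> points c" "v' \<in> points c" "v \<noteq> v'"
  shows "fibre d h v \<inter> fibre d h v' = {}"
proof (rule ccontr)
  assume "\<not> ?thesis"
  then obtain w where w: "w \<in> fibre d h v" "w \<in> fibre d h v'" by blast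
  let ?e = "int (ramification_index h v w)" and ?e' = "int (ramification_index h v' w)"
  have eq: "?e * v F = ?e' * v' F" for F
    using fibreD(3)[OF assms(1) w(1)] fibreD(3)[OF assms(2) w(2)] by metis
  from assms(1,2) have "surj v" "surj v'" by (simp_all add: points_iff)
  then obtain x y where "v x = 1" "v' y = 1" by (metis surjD)
  with eq[of x] eq[of y] have "?e' dvd ?e" "?e dvd ?e'" by (metis dvd_triv_left mult.right_neutral)+
  then have "?e = ?e'" by (simp add: dvd_antisym)
  moreover have "?e > 0" using fibreD(2)[OF assms(1) w(1)] by simp
  ultimately have "v F = v' F" for F using eq[of F] by simp
  with assms(3) show False by (simp add: fun_eq_iff)
qed

lemma fibre_finite_point:
  assumes "curve_morphism P1 P1 \<phi>"
  shows "fibre P1 \<phi> (ord_at \<tau>) = {w \<in> points P1. w (\<phi> X - P1 \<tau>) > 0}"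
    "w \<in> fibre P1 \<phi> (ord_at \<tau>) \<Longrightarrow> int (ramification_index \<phi> (ord_at \<tau>) w) = w (\<phi> X - P1 \<tau>)"
proof -
  have lin: "\<phi> (X - P1 \<tau>) = \<phi> X - P1 \<tau>"
  proof -
    interpret h: field_hom \<phi> using assms by (simp add: curve_morphism_def)
    show ?thesis using assms by (simp add: curve_morphism_def h.hom_minus)
  qed
  show "int (ramification_index \<phi> (ord_at \<tau>) w) = w (\<phi> X - P1 \<tau>)" if "w \<in> fibre P1 \<phi> (ord_at \<tau>)"
    using fibreD(3)[OF ord_at_point that, of "X - P1 \<tau>"] by (simp add: lin)
  show "fibre P1 \<phi> (ord_at \<tau>) = {w \<in> points P1. w (\<phi> X - P1 \<tau>) > 0}"
  proof (intro equalityI subsetI)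
    fix w assume w: "w \<in> fibre P1 \<phi> (ord_at \<tau>)"
    from fibreD[OF ord_at_point this] fibreD(3)[OF ord_at_point w, of "X - P1 \<tau>"]
    show "w \<in> {w \<in> points P1. w (\<phi> X - P1 \<tau>) > 0}" by (simp add: lin)
  next
    fix w assume w: "w \<in> {w \<in> points P1. w (\<phi> X - P1 \<tau>) > 0}"
    then have pre: "preval P1 (w \<circ> \<phi>)" using preval_comp[OF assms] by (simp add: points_iff)
    have pos: "w (\<phi> X - P1 \<tau>) > 0" using w by simp
    have n: "int (nat (w (\<phi> X - P1 \<tau>))) = w (\<phi> X - P1 \<tau>)" using pos by simp
    have "0 < nat (w (\<phi> X - P1 \<tau>))" using pos by simp
    then have "has_ramification_index \<phi> (ord_at \<tau>) w (nat (w (\<phi> X - P1 \<tau>)))"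
      unfolding has_ramification_index_def n
      using preval_finite_center[OF pre, of \<tau>, unfolded comp_apply lin, OF pos] by blast
    with w show "w \<in> fibre P1 \<phi> (ord_at \<tau>)" by (auto simp: fibre_def)
  qed
qed

lemma fibre_infinite_point:
  assumes "curve_morphism P1 P1 \<phi>"
  shows "fibre P1 \<phi> ord_inf = {w \<in> points P1. w (\<phi> X) < 0}"
    "w \<in> fibre P1 \<phi> ord_inf \<Longrightarrow> int (ramification_index \<phi> ord_inf w) = - w (\<phi> X)"
proof -
  show "int (ramification_index \<phi> ord_inf w) = - w (\<phi> X)" if "w \<in> fibre P1 \<phi> ord_inf"
    using fibreD(3)[OF ord_inf_point that, of X] by simp
  show "fibre P1 \<phi> ord_inf = {w \<in> points P1. w (\<phi> X) < 0}"
  proof (intro equalityI subsetI)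
    fix w assume w: "w \<in> fibre P1 \<phi> ord_inf"
    from fibreD[OF ord_inf_point this] fibreD(3)[OF ord_inf_point w, of X]
    show "w \<in> {w \<in> points P1. w (\<phi> X) < 0}" by simp
  next
    fix w assume w: "w \<in> {w \<in> points P1. w (\<phi> X) < 0}"
    then have pre: "preval P1 (w \<circ> \<phi>)" using preval_comp[OF assms] by (simp add: points_iff)
    have neg: "w (\<phi> X) < 0" using w by simp
    have n: "int (nat (- w (\<phi> X))) = - w (\<phi> X)" using neg by simp
    have "0 < nat (- w (\<phi> X))" using neg by simp
    then have "has_ramification_index \<phi> ord_inf w (nat (- w (\<phi> X)))"
      unfolding has_ramification_index_def n
      using preval_infinite_center[OF pre, unfolded comp_apply, OF neg] by blast
    with w show "w \<in> fibre P1 \<phi> ord_inf" by (auto simp: fibre_def)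
  qed
qed

text \<open>
  Subtracting a constant changes zeros, but not poles.
\<close>

lemma pole_translate:
  assumes "w \<in> points P1" "F \<notin> range P1"
  shows "w (F - P1 \<tau>) < 0 \<longleftrightarrow> w F < 0" "w F < 0 \<Longrightarrow> w (F - P1 \<tau>) = w F"
proof -
  interpret w: prevaluation P1 w by (rule prevaluation_point[OF field_hom_P1 assms(1)])
  have nz: "F - P1 \<tau> \<noteq> 0" for \<tau> using assms(2) by auto
  have F0: "F \<noteq> 0" using nz[of 0] by simp
  show *: "w (F - P1 \<tau>) = w F" if "w F < 0"
    using w.add_less[of F "P1 (-\<tau>)"] F0 that by (cases "\<tau> = 0") (simp_all add: P1.hom_uminus)
  show "w (F - P1 \<tau>) < 0 \<longleftrightarrow> w F < 0"
  proof
    assume "w (F - P1 \<tau>) < 0"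
    then have "w F = w (F - P1 \<tau>)"
      using w.add_less[of "F - P1 \<tau>" "P1 \<tau>"] nz[of \<tau>] by (cases "\<tau> = 0") simp_all
    with \<open>w (F - P1 \<tau>) < 0\<close> show "w F < 0" by simp
  qed (simp add: *)
qed

text \<open>
  The points over \<open>\<tau>\<close> are the zeros of \<open>\<phi>(X) - \<tau>\<close>, with their orders as ramification
  indices. There are as many as poles, and the poles are those of \<open>\<phi>(X)\<close> for every \<open>\<tau>\<close>.
\<close>

lemma fibre_degree:
  assumes "curve_morphism P1 P1 \<phi>"
  obtains d where "\<And>v. v \<in> points P1 \<Longrightarrow> finite (fibre P1 \<phi> v)"
    "\<And>v. v \<in> points P1 \<Longrightarrow> (\<Sum>w\<in>fibre P1 \<phi> v. ramification_index \<phi> v w) = d"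
proof -
  define d where "d = (\<Sum>w\<in>fibre P1 \<phi> ord_inf. ramification_index \<phi> ord_inf w)"
  have nc: "\<phi> X \<notin> range P1" by (rule morphism_X_not_const[OF assms])
  then have nz: "\<phi> X - P1 \<tau> \<noteq> 0" for \<tau> by auto
  have R0: "\<phi> X \<noteq> 0" using nz[of 0] by simp
  have fin: "finite {w \<in> points P1. w F < 0}" "finite {w \<in> points P1. w F > 0}" if "F \<noteq> 0" for F
    using ratfun_divisor_degree(1)[OF that] by (rule rev_finite_subset; auto)+
  have d: "int d = (\<Sum>w | w \<in> points P1 \<and> w (\<phi> X) < 0. - w (\<phi> X))"
    unfolding d_def of_nat_sum
    by (rule sum.cong) (use fibre_infinite_point[OF assms] in auto)
  note poles = pole_translate[OF _ nc]
  have "finite (fibre P1 \<phi> v) \<and> (\<Sum>w\<in>fibre P1 \<phi> v. ramification_index \<phi> v w) = d"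
    if v: "v \<in> points P1" for v
  proof (cases "v = ord_inf")
    case True
    then show ?thesis using fin[OF R0] by (simp add: d_def fibre_infinite_point(1)[OF assms])
  next
    case False
    with v obtain \<tau> where \<tau>: "v = ord_at \<tau>" by (auto simp: points_P1)
    have "int (\<Sum>w\<in>fibre P1 \<phi> v. ramification_index \<phi> v w)
        = (\<Sum>w | w \<in> points P1 \<and> w (\<phi> X - P1 \<tau>) > 0. w (\<phi> X - P1 \<tau>))"
      unfolding of_nat_sum \<tau> by (rule sum.cong) (use fibre_finite_point[OF assms] in auto)
    also have "\<dots> = (\<Sum>w | w \<in> points P1 \<and> w (\<phi> X - P1 \<tau>) < 0. - w (\<phi> X - P1 \<tau>))"
      by (rule zeros_poles_balance[OF nz])
    also have "\<dots> = int d"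
      unfolding d by (rule sum.cong) (auto simp: poles)
    finally have "(\<Sum>w\<in>fibre P1 \<phi> v. ramification_index \<phi> v w) = d" by (simp only: of_nat_eq_iff)
    moreover have "finite (fibre P1 \<phi> v)"
      using fin(2)[OF nz] by (simp add: \<tau> fibre_finite_point(1)[OF assms])
    ultimately show ?thesis by simp
  qed
  then show thesis using that by blast
qed

definition fibre_mset :: "(ratfun \<Rightarrow> ratfun) \<Rightarrow> (ratfun \<Rightarrow> int) \<Rightarrow> nat multiset" where
  "fibre_mset \<phi> v = image_mset (ramification_index \<phi> v) (mset_set (fibre P1 \<phi> v))"

text \<open>
  The unramified points contribute the index \<open>1\<close> as often as the degree \<open>d\<close> requires.
\<close>

lemma fibre_mset_branching:
  assumes "v \<in> points P1" "finite (fibre P1 \<phi> v)"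
    "(\<Sum>w\<in>fibre P1 \<phi> v. ramification_index \<phi> v w) = d"
  shows "\<Sum>\<^sub># (branching P1 \<phi> v) \<le> d"
    "fibre_mset \<phi> v = branching P1 \<phi> v + replicate_mset (d - \<Sum>\<^sub># (branching P1 \<phi> v)) 1"
proof -
  let ?M = "fibre_mset \<phi> v" and ?B = "branching P1 \<phi> v"
  let ?N = "filter_mset (\<lambda>e. \<not> 1 < e) ?M"
  have M: "?M = ?B + ?N" by (simp add: branching_def fibre_mset_def)
  have "e = 1" if "e \<in># ?N" for e
    using that assms fibreD(2)[OF assms(1)] by (force simp: fibre_mset_def)
  then have N: "?N = replicate_mset (size ?N) 1"
    by (metis multiset_eqI set_mset_subset_singletonD singletonI subsetI)
  have "d = \<Sum>\<^sub># ?M" using assms(3) by (simp add: fibre_mset_def sum_unfold_sum_mset)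
  also have "\<dots> = \<Sum>\<^sub># ?B + size ?N"
    by (subst M, subst N) (simp add: sum_mset_replicate_mset)
  finally have d: "d = \<Sum>\<^sub># ?B + size ?N" .
  then show "\<Sum>\<^sub># ?B \<le> d" by simp
  from d have "size ?N = d - \<Sum>\<^sub># ?B" by simp
  with M N show "?M = ?B + replicate_mset (d - \<Sum>\<^sub># ?B) 1" by metis
qed

lemma image_mset_mset_set_list:
  assumes "finite A" "image_mset f (mset_set A) = mset ys"
  obtains xs where "distinct xs" "set xs = A" "map f xs = ys"
proof -
  have "\<exists>xs. distinct xs \<and> set xs = A \<and> map f xs = ys"
    using assms
  proof (induction ys arbitrary: A)
    case Nil
    then show ?case by (simp add: mset_set_empty_iff)
  next
    case (Cons y ys)
    have "y \<in># image_mset f (mset_set A)" using Cons.prems by simp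
    then obtain x where x: "x \<in> A" "y = f x" using Cons.prems(1) by auto
    then have "image_mset f (mset_set (A - {x})) = mset ys"
      using Cons.prems by (simp add: mset_set.remove[of A x])
    then obtain xs where "distinct xs" "set xs = A - {x}" "map f xs = ys"
      using Cons.IH[of "A - {x}"] Cons.prems(1) by blast
    with x show ?case by (intro exI[of _ "x # xs"]) auto
  qed
  with that show thesis by blast
qed

definition odd_fibre :: "(ratfun \<Rightarrow> ratfun) \<Rightarrow> (ratfun \<Rightarrow> int) \<Rightarrow> (ratfun \<Rightarrow> int) set" where
  "odd_fibre \<phi> v = {w \<in> fibre P1 \<phi> v. odd (ramification_index \<phi> v w)}"

lemma card_odd_fibre:
  assumes "finite (fibre P1 \<phi> v)"
  shows "card (odd_fibre \<phi> v) = size (filter_mset odd (fibre_mset \<phi> v))"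
proof -
  have "filter_mset odd (fibre_mset \<phi> v)
      = image_mset (ramification_index \<phi> v) (mset_set (odd_fibre \<phi> v))"
    by (simp add: fibre_mset_def filter_mset_image_mset odd_fibre_def filter_mset_mset_set assms)
  then show ?thesis by simp
qed

text \<open>
  Over a point at which \<open>F\<close> has odd order, the pullback has odd order exactly at the points of
  odd ramification index.
\<close>

lemma odd_points_pullback:
  assumes "finite (odd_points F)" "finite (odd_points (\<phi> F))" "\<And>v. v \<in> points P1 \<Longrightarrow> finite (fibre P1 \<phi> v)"
  shows "(\<Sum>v\<in>odd_points F. card (odd_fibre \<phi> v)) \<le> card (odd_points (\<phi> F))"
proof -
  have pts: "odd_points F \<subseteq> points P1" by (auto simp: odd_points_def)
  have "(\<Sum>v\<in>odd_points F. card (odd_fibre \<phi> v)) = card (\<Union>v\<in>odd_points F. odd_fibre \<phi> v)"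
  proof (rule card_UN_disjoint[symmetric])
    show "\<forall>v\<in>odd_points F. finite (odd_fibre \<phi> v)"
      using assms(3) pts by (auto simp: odd_fibre_def)
    show "\<forall>v\<in>odd_points F. \<forall>v'\<in>odd_points F. v \<noteq> v' \<longrightarrow> odd_fibre \<phi> v \<inter> odd_fibre \<phi> v' = {}"
      using fibres_disjoint[of _ P1 _ P1 \<phi>] pts unfolding odd_fibre_def by blast
  qed (rule assms(1))
  also have "\<dots> \<le> card (odd_points (\<phi> F))"
  proof (rule card_mono[OF assms(2)], rule subsetI)
    fix w assume "w \<in> (\<Union>v\<in>odd_points F. odd_fibre \<phi> v)"
    then obtain v where v: "v \<in> points P1" "odd (v F)" "w \<in> fibre P1 \<phi> v" "odd (ramification_index \<phi> v w)"
      by (auto simp: odd_points_def odd_fibre_def)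
    with fibreD(1,3)[OF v(1,3)] show "w \<in> odd_points (\<phi> F)" by (simp add: odd_points_def)
  qed
  finally show ?thesis .
qed

text \<open>
  The third branch point shows \<open>d \<ge> 5\<close>. As \<open>F\<close> has four odd points, at least one differs
  from \<open>q1, q2, q3\<close>. Each such point contributes at least \<open>d - 2 \<ge> 3\<close> and every point at least
  \<open>d - 4 \<ge> 1\<close>, so two of them would give more than six. With exactly one, the bound
  \<open>3 (d - 4) + (d - 2) \<le> 6\<close> leaves \<open>d = 5\<close>, and an unramified fourth point would contribute
  \<open>5\<close> instead of \<open>3\<close>.
\<close>

theorem type_II_branch_points:
  assumes m: "curve_morphism P1 P1 \<phi>" and II: "degenerate_type_II \<phi>"
    and F: "finite (odd_points F)" "card (odd_points F) = 4"
    and \<phi>F: "finite (odd_points (\<phi> F))" "card (odd_points (\<phi> F)) \<le> 6"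
  obtains q1 q2 q3 q4 where "distinct [q1, q2, q3, q4]" "odd_points F = {q1, q2, q3, q4}"
    "fibre_mset \<phi> q1 = {#2, 2, 1#}" "fibre_mset \<phi> q2 = {#2, 2, 1#}"
    "fibre_mset \<phi> q3 = {#2, 3#}" "fibre_mset \<phi> q4 = {#2, 1, 1, 1#}"
proof -
  obtain q1 q2 q3 q4 where q: "distinct [q1, q2, q3, q4]" "branch_points P1 P1 \<phi> = {q1, q2, q3, q4}"
    and B: "branching P1 \<phi> q1 = {#2, 2#}" "branching P1 \<phi> q2 = {#2, 2#}"
      "branching P1 \<phi> q3 = {#2, 3#}" "branching P1 \<phi> q4 = {#2#}"
    using II unfolding degenerate_type_II_def by blast
  obtain d where fin: "\<And>v. v \<in> points P1 \<Longrightarrow> finite (fibre P1 \<phi> v)"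
    and d: "\<And>v. v \<in> points P1 \<Longrightarrow> (\<Sum>w\<in>fibre P1 \<phi> v. ramification_index \<phi> v w) = d"
    using fibre_degree[OF m] by blast
  have pts: "q1 \<in> points P1" "q2 \<in> points P1" "q3 \<in> points P1" "q4 \<in> points P1"
    using q(2) by (auto simp: branch_points_def)
  note fb = fibre_mset_branching[OF _ fin d]
  have M: "fibre_mset \<phi> q1 = {#2, 2#} + replicate_mset (d - 4) 1"
    "fibre_mset \<phi> q2 = {#2, 2#} + replicate_mset (d - 4) 1"
    "fibre_mset \<phi> q3 = {#2, 3#} + replicate_mset (d - 5) 1"
    "fibre_mset \<phi> q4 = {#2#} + replicate_mset (d - 2) 1"
    using fb(2)[OF pts(1) pts(1) pts(1)] fb(2)[OF pts(2) pts(2) pts(2)]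
      fb(2)[OF pts(3) pts(3) pts(3)] fb(2)[OF pts(4) pts(4) pts(4)] by (simp_all add: B)
  have d5: "d \<ge> 5" using fb(1)[OF pts(3) pts(3) pts(3)] by (simp add: B)
  let ?o = "\<lambda>v. card (odd_fibre \<phi> v)"
  have ones: "size (filter_mset odd (replicate_mset n (Suc 0))) = n" for n
    by (induction n) simp_all
  note co = card_odd_fibre[OF fin]
  have o: "?o q1 = d - 4" "?o q2 = d - 4" "?o q3 = d - 4" "?o q4 = d - 2"
    using co[OF pts(1)] co[OF pts(2)] co[OF pts(3)] co[OF pts(4)] d5 by (simp_all add: M ones)
  have other: "?o v = d" if "v \<in> points P1" "v \<notin> {q1, q2, q3, q4}" for v
  proof -
    have "branching P1 \<phi> v = {#}" using that unfolding q(2)[symmetric] by (simp add: branch_points_def)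
    then show ?thesis using fb(2)[OF that(1) that(1) that(1)] co[OF that(1)] by (simp add: ones)
  qed
  let ?A = "odd_points F \<inter> {q1, q2, q3}" and ?B = "odd_points F - {q1, q2, q3}"
  have ptsF: "odd_points F \<subseteq> points P1" by (auto simp: odd_points_def)
  have split: "(\<Sum>v\<in>odd_points F. ?o v) = (\<Sum>v\<in>?A. ?o v) + (\<Sum>v\<in>?B. ?o v)"
    by (rule sum.Int_Diff[OF F(1)])
  have "card (odd_points F) = card ?A + card ?B"
    unfolding card_eq_sum by (rule sum.Int_Diff[OF F(1)])
  with F(2) have cAB: "card ?A + card ?B = 4" by simp
  have cA: "card ?A \<le> 3" using card_mono[of "{q1, q2, q3}" ?A] q(1) by simp
  have sA: "(\<Sum>v\<in>?A. ?o v) = card ?A * (d - 4)"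
  proof -
    have "(\<Sum>v\<in>?A. ?o v) = (\<Sum>v\<in>?A. d - 4)" by (rule sum.cong) (use o in auto)
    then show ?thesis by simp
  qed
  have oB: "?o v \<ge> d - 2" if "v \<in> ?B" for v
    using that o(4) other[of v] ptsF by (cases "v = q4") auto
  have sB: "(\<Sum>v\<in>?B. ?o v) \<ge> card ?B * (d - 2)"
    using sum_bounded_below[of ?B "d - 2" ?o] oB by simp
  have total: "card ?A * (d - 4) + (\<Sum>v\<in>?B. ?o v) \<le> 6"
    using odd_points_pullback[OF F(1) \<phi>F(1) fin] \<phi>F(2) split sA by simp
  \<comment> \<open>\<open>?B\<close> is nonempty, and two of its points would contribute too much.\<close>
  have cB: "card ?B = 1"
  proof (rule ccontr)
    assume "card ?B \<noteq> 1"
    then have "card ?B \<in> {2, 3, 4}" using cAB cA by auto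
    then have "card ?A * (d - 4) + card ?B * (d - 2) \<ge> 8"
      using cAB d5 by auto
    with total sB show False by linarith
  qed
  then have cA3: "card ?A = 3" using cAB by simp
  then have A: "?A = {q1, q2, q3}"
    using q(1) by (intro card_subset_eq) auto
  obtain p where p: "?B = {p}" using cB by (auto simp: card_1_singleton_iff)
  have pB: "p \<in> ?B" unfolding p by simp
  have "(\<Sum>v\<in>?B. ?o v) = ?o p" unfolding p by simp
  then have "3 * (d - 4) + ?o p \<le> 6" using total unfolding cA3 by simp
  moreover have "?o p \<ge> d - 2" by (rule oB[OF pB])
  ultimately have dd: "d = 5" and "?o p \<le> 3" using d5 by linarith+
  have "p \<in> points P1" "p \<notin> {q1, q2, q3}" using pB ptsF by auto
  then have "p = q4" using other[of p] \<open>?o p \<le> 3\<close> dd by (cases "p = q4") auto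
  have "odd_points F = ?A \<union> ?B" by blast
  also have "\<dots> = {q1, q2, q3} \<union> {q4}" using p unfolding A \<open>p = q4\<close> by (simp only:)
  also have "\<dots> = {q1, q2, q3, q4}" by auto
  finally have O: "odd_points F = {q1, q2, q3, q4}" .
  show thesis
    by (rule that[OF q(1) O]) (simp_all add: M dd numeral_3_eq_3 numeral_2_eq_2)
qed

section \<open>Solving for the rational function of degree 5\<close>

lemma linear_power_dvd_factor:
  fixes p q :: "'a::field poly"
  assumes "[:-a, 1:] ^ n dvd p * q" "poly q a \<noteq> 0"
  shows "[:-a, 1:] ^ n dvd p"
proof (cases "p = 0")
  case False
  have "q \<noteq> 0" using assms(2) by auto
  then have "order a (p * q) = order a p"
    using False assms(2) by (simp add: order_mult order_0I)
  with assms(1) False \<open>q \<noteq> 0\<close> show ?thesis by (simp add: order_divides)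
qed simp

text \<open>
  Here \<open>A(z) = k z P(z\<^sup>2) - Q(z\<^sup>2)\<close> and \<open>B(z) = k z P(z\<^sup>2) + Q(z\<^sup>2) = - A(- z)\<close>. They have no
  common root, so each of the factors \<open>(z - 1)\<^sup>3\<close> and \<open>(z - \<omega>)\<^sup>2\<close> of the product \<open>A B\<close>
  divides one of them; the signs of \<open>k\<close> and \<open>\<omega>\<close> are chosen so that it is \<open>A\<close> in both cases.
  As \<open>A\<close> has degree \<open>5\<close> and leading coefficient \<open>k\<close>, this determines \<open>A\<close>.
\<close>

lemma type_II_square_root_factorization:
  fixes p0 p1 q0 q1 c w :: complex
  assumes eq: "\<And>x. c * x * (x\<^sup>2 + p1 * x + p0)\<^sup>2 - (x\<^sup>2 + q1 * x + q0)\<^sup>2 = c * (x - 1) ^ 3 * (x - w)\<^sup>2"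
    and c: "c \<noteq> 0" and q0: "q0 \<noteq> 0" and w: "w \<noteq> 1"
    and coprime: "\<And>x. x\<^sup>2 + p1 * x + p0 = 0 \<Longrightarrow> x\<^sup>2 + q1 * x + q0 \<noteq> 0"
  obtains k \<omega> where "k\<^sup>2 = c" "\<omega>\<^sup>2 = w" "k * (2 * \<omega> + 3) = 1"
    "p1 = \<omega>\<^sup>2 + 6 * \<omega> + 3" "p0 = 3 * \<omega>\<^sup>2 + 2 * \<omega>" "q1 = k * (3 * \<omega>\<^sup>2 + 6 * \<omega> + 1)" "q0 = k * \<omega>\<^sup>2"
proof -
  have "(csqrt c * (1 + p1 + p0))\<^sup>2 = (1 + q1 + q0)\<^sup>2"
    using eq[of 1] by (simp add: power_mult_distrib)
  then have "csqrt c * (1 + p1 + p0) = 1 + q1 + q0 \<or> (- csqrt c) * (1 + p1 + p0) = 1 + q1 + q0"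
    by (auto simp: power2_eq_iff)
  then obtain k where k: "k\<^sup>2 = c" "k * (1 + p1 + p0) = 1 + q1 + q0"
    by (metis power2_csqrt power2_minus)
  have "(k * csqrt w * (w\<^sup>2 + p1 * w + p0))\<^sup>2 = (w\<^sup>2 + q1 * w + q0)\<^sup>2"
    using eq[of w] by (simp add: power_mult_distrib k(1))
  then have "k * csqrt w * (w\<^sup>2 + p1 * w + p0) = w\<^sup>2 + q1 * w + q0 \<or>
      k * (- csqrt w) * (w\<^sup>2 + p1 * w + p0) = w\<^sup>2 + q1 * w + q0"
    by (auto simp: power2_eq_iff)
  then obtain \<omega> where \<omega>: "\<omega>\<^sup>2 = w" "k * \<omega> * (w\<^sup>2 + p1 * w + p0) = w\<^sup>2 + q1 * w + q0"
    by (metis power2_csqrt power2_minus)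
  have k0: "k \<noteq> 0" using k(1) c by auto
  have \<omega>1: "\<omega> \<noteq> 1" using \<omega>(1) w by auto
  define A where "A = [:- q0, k * p0, - q1, k * p1, - 1, k:]"
  define B where "B = [:q0, k * p0, q1, k * p1, 1, k:]"
  have pA: "poly A z = k * z * ((z\<^sup>2)\<^sup>2 + p1 * z\<^sup>2 + p0) - ((z\<^sup>2)\<^sup>2 + q1 * z\<^sup>2 + q0)" for z
    by (simp add: A_def algebra_simps power2_eq_square)
  have pB: "poly B z = k * z * ((z\<^sup>2)\<^sup>2 + p1 * z\<^sup>2 + p0) + ((z\<^sup>2)\<^sup>2 + q1 * z\<^sup>2 + q0)" for z
    by (simp add: B_def algebra_simps power2_eq_square)
  have no_common: "poly B z \<noteq> 0" if "poly A z = 0" for z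
  proof
    assume "poly B z = 0"
    have aux: "b = 0" if "a - b = 0" "a + b = 0" for a b :: complex using that by simp
    have Q: "(z\<^sup>2)\<^sup>2 + q1 * z\<^sup>2 + q0 = 0"
      using that \<open>poly B z = 0\<close> unfolding pA pB by (rule aux)
    with \<open>poly B z = 0\<close> have "k * z * ((z\<^sup>2)\<^sup>2 + p1 * z\<^sup>2 + p0) = 0" unfolding pB by simp
    then have "z = 0 \<or> (z\<^sup>2)\<^sup>2 + p1 * z\<^sup>2 + p0 = 0" using k0 by simp
    with Q coprime[of "z\<^sup>2"] q0 show False by auto
  qed
  have "poly (A * B) z = poly (Polynomial.smult c ([:-1, 1:] ^ 3 * [:1, 1:] ^ 3 * ([:-\<omega>, 1:]\<^sup>2 * [:\<omega>, 1:]\<^sup>2))) z" for z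
  proof -
    have "poly (A * B) z = k\<^sup>2 * z\<^sup>2 * ((z\<^sup>2)\<^sup>2 + p1 * z\<^sup>2 + p0)\<^sup>2 - ((z\<^sup>2)\<^sup>2 + q1 * z\<^sup>2 + q0)\<^sup>2"
      unfolding poly_mult pA pB by (simp add: algebra_simps power2_eq_square)
    also have "\<dots> = c * (z\<^sup>2 - 1) ^ 3 * (z\<^sup>2 - w)\<^sup>2" using eq[of "z\<^sup>2"] by (simp add: k(1))
    also have "\<dots> = c * ((z - 1) ^ 3 * (z + 1) ^ 3 * ((z - \<omega>)\<^sup>2 * (z + \<omega>)\<^sup>2))"
      unfolding \<omega>(1)[symmetric] by (simp add: algebra_simps power2_eq_square power3_eq_cube)
    finally show ?thesis by (simp add: algebra_simps)
  qed
  then have AB: "A * B = Polynomial.smult c ([:-1, 1:] ^ 3 * [:1, 1:] ^ 3 * ([:-\<omega>, 1:]\<^sup>2 * [:\<omega>, 1:]\<^sup>2))"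
    by (intro iffD1[OF poly_eq_poly_eq_iff] ext)
  have "poly A 1 = 0" "poly A \<omega> = 0"
    using k(2) \<omega>(2) unfolding pA \<omega>(1) by simp_all
  then have B1: "poly B 1 \<noteq> 0" "poly B \<omega> \<noteq> 0" by (simp_all add: no_common)
  have "[:-1, 1:] ^ 3 dvd A * B" unfolding AB by (intro dvd_smult dvd_mult2) simp
  from linear_power_dvd_factor[OF this B1(1)] obtain A1 where A1: "A = A1 * [:-1, 1:] ^ 3"
    by (metis dvd_def mult.commute)
  have "[:-\<omega>, 1:]\<^sup>2 dvd A * B" unfolding AB by (intro dvd_smult dvd_mult dvd_mult2) simp
  from linear_power_dvd_factor[OF this B1(2)] have "[:-\<omega>, 1:]\<^sup>2 dvd A" .
  then have "[:-\<omega>, 1:]\<^sup>2 dvd A1 * [:-1, 1:] ^ 3" by (simp only: A1)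
  moreover have "poly ([:-1, 1:] ^ 3) \<omega> \<noteq> 0" using \<omega>1 by (simp add: poly_power)
  ultimately have "[:-\<omega>, 1:]\<^sup>2 dvd A1" by (rule linear_power_dvd_factor)
  then obtain A2 where A2: "A = A2 * ([:-\<omega>, 1:]\<^sup>2 * [:-1, 1:] ^ 3)"
    unfolding A1 by (metis dvd_def mult.commute mult.assoc)
  have degA: "degree A = 5" using k0 by (simp add: A_def)
  then have "A \<noteq> 0" by auto
  then have "A2 \<noteq> 0" using A2 by auto
  then have "degree A = degree A2 + 5"
    unfolding A2 by (subst degree_mult_eq) (auto simp: degree_mult_eq degree_power_eq)
  with degA obtain e where e: "A2 = [:e:]" by (metis add_cancel_left_left degree_eq_zeroE)
  have "A = Polynomial.smult e ([:-\<omega>, 1:]\<^sup>2 * [:-1, 1:] ^ 3)" using A2 e by simp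
  also have "[:-\<omega>, 1:]\<^sup>2 * [:-1, 1:] ^ 3 =
      [:- \<omega>\<^sup>2, 3 * \<omega>\<^sup>2 + 2 * \<omega>, - (3 * \<omega>\<^sup>2 + 6 * \<omega> + 1), \<omega>\<^sup>2 + 6 * \<omega> + 3, - (2 * \<omega> + 3), 1:]"
    by (simp add: power2_eq_square power3_eq_cube algebra_simps)
  finally have "A = Polynomial.smult e
      [:- \<omega>\<^sup>2, 3 * \<omega>\<^sup>2 + 2 * \<omega>, - (3 * \<omega>\<^sup>2 + 6 * \<omega> + 1), \<omega>\<^sup>2 + 6 * \<omega> + 3, - (2 * \<omega> + 3), 1:]" .
  from this[unfolded A_def smult_pCons smult_0_right pCons_eq_iff mult_1_right mult_minus_right neg_equal_iff_equal]
  have cs: "q0 = e * \<omega>\<^sup>2" "k * p0 = e * (3 * \<omega>\<^sup>2 + 2 * \<omega>)" "q1 = e * (3 * \<omega>\<^sup>2 + 6 * \<omega> + 1)"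
      "k * p1 = e * (\<omega>\<^sup>2 + 6 * \<omega> + 3)" "1 = e * (2 * \<omega> + 3)" "k = e"
    by blast+
  note cs = cs(1-5)[folded cs(6)]
  have "k * (2 * \<omega> + 3) = 1" by (rule cs(5)[symmetric])
  moreover have "p1 = \<omega>\<^sup>2 + 6 * \<omega> + 3" "p0 = 3 * \<omega>\<^sup>2 + 2 * \<omega>"
    using cs(4,2) unfolding mult_left_cancel[OF k0] .
  moreover note cs(3,1)
  ultimately show thesis by (rule that[OF k(1) \<omega>(1)])
qed

text \<open>
  The polynomial \<open>[:t0, t1, m:]\<close> is \<open>m Q\<close>, which clears the denominator \<open>m\<close> of \<open>k = 1 / m\<close>.
  The double root \<open>r\<close> of \<open>x P\<^sup>2 - \<mu> (m Q)\<^sup>2\<close> is a critical point of \<open>x P\<^sup>2 / (m Q)\<^sup>2\<close>,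
  that is, a zero of \<open>P (P T + 2 x (P' T - P T'))\<close> with \<open>T = m Q\<close>. The second factor has degree
  \<open>4\<close> and vanishes at the critical points \<open>1, 1, \<omega>\<^sup>2\<close> over the value \<open>1\<close>; what
  remains is linear and gives \<open>m r = \<omega> (3 \<omega> + 2)\<close>. The rest is evaluation at \<open>r\<close> and
  division by \<open>(x - r)\<^sup>2\<close>.
\<close>

lemma type_II_fourth_critical_value:
  fixes \<omega> k r \<mu> :: complex and N :: "complex poly"
  defines "m \<equiv> 2 * \<omega> + 3"
  defines "p1 \<equiv> \<omega>\<^sup>2 + 6 * \<omega> + 3" and "p0 \<equiv> 3 * \<omega>\<^sup>2 + 2 * \<omega>"
    and "t1 \<equiv> 3 * \<omega>\<^sup>2 + 6 * \<omega> + 1" and "t0 \<equiv> \<omega>\<^sup>2"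
  assumes m: "m \<noteq> 0" and \<mu>: "\<mu> \<noteq> 0" "\<mu> \<noteq> 1"
    and r: "r \<noteq> 1" "r \<noteq> \<omega>\<^sup>2" "r\<^sup>2 + p1 * r + p0 \<noteq> 0" "m * r\<^sup>2 + t1 * r + t0 \<noteq> 0"
    and N: "[:0, 1:] * [:p0, p1, 1:]\<^sup>2 - Polynomial.smult \<mu> ([:t0, t1, m:]\<^sup>2) = [:-r, 1:]\<^sup>2 * N"
  shows "\<omega> \<noteq> 0" "\<omega> + 1 \<noteq> 0" "3 * \<omega> + 2 \<noteq> 0" "\<omega> + 9 \<noteq> 0" "9 * \<omega> + 1 \<noteq> 0" "\<omega> \<noteq> 1"
    "\<mu> / (\<mu> - 1) = (3 * \<omega> + 2) ^ 3 * (\<omega> + 9)\<^sup>2 * \<omega> / (27 * (\<omega> + 1) * (\<omega> - 1) ^ 5)"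
    "\<And>a. a = \<omega> + 1 \<Longrightarrow> Polynomial.smult (m * (9 * \<omega> + 1)\<^sup>2) N =
      [:- ((a + 8)^2 * (a - 1)^3 * (3*a - 1)),
        - 18*a^6 + 380*a^5 - 1000*a^4 + 726*a^3 + 499*a^2 - 752*a + 192,
        - 27*a^6 - 54*a^5 + 468*a^4 - 958*a^3 + 381*a^2 + 400*a - 192,
        (2*a + 1) * (9*a - 8)^2:]"
proof -
  let ?P = "r\<^sup>2 + p1 * r + p0" and ?T = "m * r\<^sup>2 + t1 * r + t0"
  let ?P' = "2 * r + p1" and ?T' = "2 * m * r + t1"
  have e0: "r * ?P\<^sup>2 = \<mu> * ?T\<^sup>2"
  proof -
    have "poly ([:0, 1:] * [:p0, p1, 1:]\<^sup>2 - Polynomial.smult \<mu> ([:t0, t1, m:]\<^sup>2)) r = 0"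
      unfolding N by simp
    moreover have "poly [:p0, p1, 1:] r = ?P" "poly [:t0, t1, m:] r = ?T"
      by (simp_all add: algebra_simps power2_eq_square)
    ultimately show ?thesis by (simp only: poly_diff poly_mult poly_power poly_smult) simp
  qed
  have e1: "?P\<^sup>2 + 2 * r * ?P * ?P' = 2 * \<mu> * ?T * ?T'"
  proof -
    define L where "L = [:-r, 1:]"
    have L: "pderiv L = 1" by (simp add: L_def pderiv_pCons one_pCons)
    have "pderiv (L\<^sup>2 * N) = L * (L * pderiv N + 2 * N)"
      by (simp add: pderiv_mult power2_eq_square L algebra_simps)
    then have "poly (pderiv ([:-r, 1:]\<^sup>2 * N)) r = 0" by (simp add: L_def)
    then have "poly (pderiv ([:0, 1:] * [:p0, p1, 1:]\<^sup>2 - Polynomial.smult \<mu> ([:t0, t1, m:]\<^sup>2))) r = 0"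
      by (simp only: N)
    then show ?thesis
      by (simp add: pderiv_mult pderiv_diff pderiv_smult power2_eq_square pderiv_pCons algebra_simps)
  qed
  have "?P * ((?P * ?T + 2 * r * (?P' * ?T - ?P * ?T'))) = 0"
  proof -
    have "?P * ?T * (?P + 2 * r * ?P') = ?T * (?P\<^sup>2 + 2 * r * ?P * ?P')"
      by (simp add: algebra_simps power2_eq_square)
    also have "\<dots> = 2 * (\<mu> * ?T\<^sup>2) * ?T'" unfolding e1 by (simp add: algebra_simps power2_eq_square)
    also have "\<dots> = 2 * (r * ?P\<^sup>2) * ?T'" by (simp only: e0)
    finally show ?thesis by (simp add: algebra_simps power2_eq_square)
  qed
  then have "?P * ?T + 2 * r * (?P' * ?T - ?P * ?T') = 0" using r(3) by simp
  moreover have "?P * ?T + 2 * r * (?P' * ?T - ?P * ?T')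
      = (r - 1)\<^sup>2 * (r - \<omega>\<^sup>2) * (m * r - \<omega> * (3 * \<omega> + 2))"
    unfolding m_def p1_def p0_def t1_def t0_def by (simp add: algebra_simps power2_eq_square)
  ultimately have mr: "m * r = \<omega> * (3 * \<omega> + 2)" using r(1,2) by simp
  have mP: "m\<^sup>2 * ?P = 2 * \<omega> * (3 * \<omega> + 2) * (\<omega> + 1)\<^sup>2 * (\<omega> + 9)"
  proof -
    have "m\<^sup>2 * ?P = (m * r)\<^sup>2 + p1 * m * (m * r) + p0 * m\<^sup>2" by (simp add: algebra_simps power2_eq_square)
    also have "\<dots> = 2 * \<omega> * (3 * \<omega> + 2) * (\<omega> + 1)\<^sup>2 * (\<omega> + 9)"
      unfolding mr unfolding m_def p1_def p0_def by (simp add: algebra_simps power2_eq_square)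
    finally show ?thesis .
  qed
  have mT: "m * ?T = 2 * \<omega> * (\<omega> + 1)\<^sup>2 * (9 * \<omega> + 1)"
  proof -
    have "m * ?T = (m * r)\<^sup>2 + t1 * (m * r) + t0 * m" by (simp add: algebra_simps power2_eq_square)
    also have "\<dots> = 2 * \<omega> * (\<omega> + 1)\<^sup>2 * (9 * \<omega> + 1)"
      unfolding mr unfolding m_def t1_def t0_def by (simp add: algebra_simps power2_eq_square)
    finally show ?thesis .
  qed
  have "m\<^sup>2 * ?P \<noteq> 0" "m * ?T \<noteq> 0" using m r(3,4) by simp_all
  then show nz: "\<omega> \<noteq> 0" "\<omega> + 1 \<noteq> 0" "3 * \<omega> + 2 \<noteq> 0" "\<omega> + 9 \<noteq> 0" "9 * \<omega> + 1 \<noteq> 0"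
    unfolding mP mT by auto
  \<comment> \<open>The common factor of \<open>mP\<close> and \<open>mT\<close>, which cancels in the quotient.\<close>
  define u where "u = 2 * \<omega> * (\<omega> + 1)\<^sup>2"
  have u: "u \<noteq> 0" using nz by (simp add: u_def)
  have lam: "\<mu> * (m ^ 3 * (9 * \<omega> + 1)\<^sup>2) = \<omega> * (3 * \<omega> + 2) ^ 3 * (\<omega> + 9)\<^sup>2"
  proof -
    have "\<mu> * (m * ?T)\<^sup>2 * m ^ 3 = (m * r) * (m\<^sup>2 * ?P)\<^sup>2"
    proof -
      have "\<mu> * (m * T)\<^sup>2 * m ^ 3 = m ^ 5 * (\<mu> * T\<^sup>2)" "(m * r) * (m\<^sup>2 * P)\<^sup>2 = m ^ 5 * (r * P\<^sup>2)" for T P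
        by (simp_all add: eval_nat_numeral algebra_simps)
      then show ?thesis by (simp only: e0)
    qed
    then have "u\<^sup>2 * (\<mu> * (m ^ 3 * (9 * \<omega> + 1)\<^sup>2)) = u\<^sup>2 * (\<omega> * (3 * \<omega> + 2) ^ 3 * (\<omega> + 9)\<^sup>2)"
      unfolding mr mP mT u_def by (simp add: power2_eq_square power3_eq_cube algebra_simps)
    with u show ?thesis by simp
  qed
  define d where "d = m ^ 3 * (9 * \<omega> + 1)\<^sup>2"
  have d: "d \<noteq> 0" using m nz by (simp add: d_def)
  have lam1: "(\<mu> - 1) * d = 27 * (\<omega> + 1) * (\<omega> - 1) ^ 5"
  proof -
    have "(\<mu> - 1) * d = \<mu> * d - d" by (simp add: algebra_simps)
    also have "\<dots> = \<omega> * (3 * \<omega> + 2) ^ 3 * (\<omega> + 9)\<^sup>2 - d" unfolding d_def lam ..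
    also have "\<dots> = 27 * (\<omega> + 1) * (\<omega> - 1) ^ 5"
      unfolding d_def m_def by (simp add: eval_nat_numeral algebra_simps)
    finally show ?thesis .
  qed
  have "(\<mu> - 1) * d \<noteq> 0" using \<mu> d by simp
  then show "\<omega> \<noteq> 1" unfolding lam1 by auto
  have "\<mu> / (\<mu> - 1) = (\<mu> * d) / ((\<mu> - 1) * d)" using d by simp
  also have "\<dots> = (3 * \<omega> + 2) ^ 3 * (\<omega> + 9)\<^sup>2 * \<omega> / (27 * (\<omega> + 1) * (\<omega> - 1) ^ 5)"
    unfolding lam1 unfolding d_def lam by (simp add: mult_ac)
  finally show "\<mu> / (\<mu> - 1) = (3 * \<omega> + 2) ^ 3 * (\<omega> + 9)\<^sup>2 * \<omega> / (27 * (\<omega> + 1) * (\<omega> - 1) ^ 5)" .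
  fix a assume a: "a = \<omega> + 1"
  let ?B = "[:- ((a + 8)^2 * (a - 1)^3 * (3*a - 1)),
        - 18*a^6 + 380*a^5 - 1000*a^4 + 726*a^3 + 499*a^2 - 752*a + 192,
        - 27*a^6 - 54*a^5 + 468*a^4 - 958*a^3 + 381*a^2 + 400*a - 192,
        (2*a + 1) * (9*a - 8)^2:]"
  have "[:-r, 1:]\<^sup>2 * Polynomial.smult (m\<^sup>2) (Polynomial.smult (m * (9 * \<omega> + 1)\<^sup>2) N)
      = Polynomial.smult (m ^ 3 * (9 * \<omega> + 1)\<^sup>2) ([:-r, 1:]\<^sup>2 * N)"
    by (simp add: power2_eq_square power3_eq_cube mult_ac)
  also have "\<dots> = Polynomial.smult (m ^ 3 * (9 * \<omega> + 1)\<^sup>2) ([:0, 1:] * [:p0, p1, 1:]\<^sup>2)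
      - Polynomial.smult (\<mu> * (m ^ 3 * (9 * \<omega> + 1)\<^sup>2)) ([:t0, t1, m:]\<^sup>2)"
    unfolding N[symmetric] by (simp add: smult_diff_right mult_ac)
  also have "\<dots> = [:- (\<omega> * (3 * \<omega> + 2)), m:]\<^sup>2 * ?B"
    unfolding lam unfolding a m_def p1_def p0_def t1_def t0_def
    by (simp add: eval_nat_numeral algebra_simps)
  also have "[:- (\<omega> * (3 * \<omega> + 2)), m:] = Polynomial.smult m [:-r, 1:]" by (simp flip: mr)
  also have "(Polynomial.smult m [:-r, 1:])\<^sup>2 * ?B = [:-r, 1:]\<^sup>2 * Polynomial.smult (m\<^sup>2) ?B"
    by (simp only: power2_eq_square mult_smult_left mult_smult_right smult_smult)
  finally have "Polynomial.smult (m\<^sup>2) (Polynomial.smult (m * (9 * \<omega> + 1)\<^sup>2) N) = Polynomial.smult (m\<^sup>2) ?B"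
    by (subst (asm) mult_left_cancel) auto
  moreover have "p = q" if "Polynomial.smult (m\<^sup>2) p = Polynomial.smult (m\<^sup>2) q" for p q :: "complex poly"
  proof -
    have "Polynomial.smult (m\<^sup>2) (p - q) = 0" using that by (simp add: smult_diff_right)
    with m show ?thesis by simp
  qed
  ultimately show "Polynomial.smult (m * (9 * \<omega> + 1)\<^sup>2) N = ?B" by blast
qed

section \<open>Normal form of a cover of type II\<close>

lemma ramification_transport:
  assumes "aut \<mu>" "aut \<nu>"
  shows "has_ramification_index (inv_into UNIV \<nu> \<circ> \<phi> \<circ> \<mu>) (q \<circ> \<mu>) (w \<circ> \<nu>) e
      \<longleftrightarrow> has_ramification_index \<phi> q w e"
proof -
  have "\<nu> (inv_into UNIV \<nu> F) = F" for F
    using assms(2) by (simp add: aut_def bij_is_surj surj_f_inv_f)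
  moreover have "(\<forall>x. w (\<phi> (\<mu> x)) = int e * q (\<mu> x)) \<longleftrightarrow> (\<forall>x. w (\<phi> x) = int e * q x)"
    using assms(1) unfolding aut_def by (metis bij_is_surj surjD)
  ultimately show ?thesis by (simp add: has_ramification_index_def)
qed

lemma fibre_transport:
  assumes "aut \<mu>" "aut \<nu>" and \<phi>': "\<phi>' = inv_into UNIV \<nu> \<circ> \<phi> \<circ> \<mu>"
  shows "fibre P1 \<phi>' (q \<circ> \<mu>) = (\<lambda>w. w \<circ> \<nu>) ` fibre P1 \<phi> q"
    "ramification_index \<phi>' (q \<circ> \<mu>) (w \<circ> \<nu>) = ramification_index \<phi> q w"
proof -
  note t = ramification_transport[OF assms(1,2)]
  show "ramification_index \<phi>' (q \<circ> \<mu>) (w \<circ> \<nu>) = ramification_index \<phi> q w"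
    by (simp add: ramification_index_def \<phi>' t)
  show "fibre P1 \<phi>' (q \<circ> \<mu>) = (\<lambda>w. w \<circ> \<nu>) ` fibre P1 \<phi> q"
  proof (intro equalityI subsetI)
    fix u assume u: "u \<in> fibre P1 \<phi>' (q \<circ> \<mu>)"
    have "u = u \<circ> inv_into UNIV \<nu> \<circ> \<nu>"
      using assms(2) by (simp add: aut_def bij_is_inj comp_assoc)
    moreover from this u have "u \<circ> inv_into UNIV \<nu> \<in> fibre P1 \<phi> q"
      using points_comp_aut[OF aut_inv[OF assms(2)]] t[of \<phi> q "u \<circ> inv_into UNIV \<nu>"]
      by (auto simp: fibre_def \<phi>')
    ultimately show "u \<in> (\<lambda>w. w \<circ> \<nu>) ` fibre P1 \<phi> q" by blast
  qed (use points_comp_aut[OF assms(2)] t in \<open>auto simp: fibre_def \<phi>'\<close>)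
qed

text \<open>
  At each finite point, a fibre of \<open>\<phi>\<close> records the order of \<open>\<phi>(X) - \<tau>\<close>: the fibre over
  \<open>\<tau>\<close> consists of the zeros and the fibre over infinity of the poles.
\<close>

lemma ord_at_shift:
  assumes m: "curve_morphism P1 P1 \<phi>"
  shows "ord_at x (\<phi> X - P1 \<tau>) =
    (if ord_at x \<in> fibre P1 \<phi> (ord_at \<tau>) then int (ramification_index \<phi> (ord_at \<tau>) (ord_at x))
     else if ord_at x \<in> fibre P1 \<phi> ord_inf then - int (ramification_index \<phi> ord_inf (ord_at x)) else 0)"
proof -
  note pt = pole_translate[OF ord_at_point morphism_X_not_const[OF m], of x \<tau>]
  show ?thesis
    using fibre_finite_point[OF m, where \<tau>=\<tau>] fibre_infinite_point[OF m] pt by auto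
qed

text \<open>
  The coordinate \<open>\<mu>\<close> of the target puts \<open>q1, q2, q3\<close> at \<open>0, \<infinity>, 1\<close>. The coordinate
  \<open>\<nu>\<close> of the source puts the unramified points over \<open>q1\<close> and \<open>q2\<close> at \<open>0\<close> and
  \<open>\<infinity>\<close>, and the triple point over \<open>q3\<close> at \<open>1\<close>. In these coordinates the
  fibres give the orders of \<open>R - \<tau>\<close> for \<open>\<tau> = 0, 1, l\<close> at all finite points. The double
  points over \<open>q1\<close> are \<open>\<alpha>, \<beta>\<close>, those over \<open>q2\<close> are \<open>\<gamma>, \<delta>\<close>, the one over
  \<open>q3\<close> is \<open>w\<close> and the one over \<open>q4\<close> is \<open>r\<close>.
\<close>

lemma type_II_normal_form:
  assumes m: "curve_morphism P1 P1 \<phi>"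
    and pts: "q1 \<in> points P1" "q2 \<in> points P1" "q3 \<in> points P1" "q4 \<in> points P1"
    and dist: "distinct [q1, q2, q3, q4]"
    and M: "fibre_mset \<phi> q1 = {#2, 2, 1#}" "fibre_mset \<phi> q2 = {#2, 2, 1#}"
      "fibre_mset \<phi> q3 = {#2, 3#}" "fibre_mset \<phi> q4 = {#2, 1, 1, 1#}"
  obtains \<mu> \<nu> R l \<alpha> \<beta> \<gamma> \<delta> w r c1 c2 c3 where "aut \<mu>" "aut \<nu>"
    "R = (inv_into UNIV \<nu> \<circ> \<phi> \<circ> \<mu>) X"
    "q1 \<circ> \<mu> = ord_at 0" "q2 \<circ> \<mu> = ord_inf" "q3 \<circ> \<mu> = ord_at 1" "q4 \<circ> \<mu> = ord_at l"
    "distinct [0, 1, \<alpha>, \<beta>, \<gamma>, \<delta>, w, r, c1, c2, c3]" "l \<noteq> 0" "l \<noteq> 1"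
    "\<forall>x. ord_at x R = (if x = \<alpha> \<or> x = \<beta> then 2 else if x = 0 then 1 else if x = \<gamma> \<or> x = \<delta> then -2 else 0)"
    "\<forall>x. ord_at x (R - 1) = (if x = w then 2 else if x = 1 then 3 else if x = \<gamma> \<or> x = \<delta> then -2 else 0)"
    "\<forall>x. ord_at x (R - P1 l) = (if x = r then 2 else if x = c1 \<or> x = c2 \<or> x = c3 then 1
      else if x = \<gamma> \<or> x = \<delta> then -2 else 0)"
proof -
  have fin: "finite (fibre P1 \<phi> v)" if "v \<in> points P1" for v
    using fibre_degree[OF m] that by blast
  obtain L1 where "distinct L1" "set L1 = fibre P1 \<phi> q1" "map (ramification_index \<phi> q1) L1 = [2, 2, 1]"
    by (rule image_mset_mset_set_list[OF fin[OF pts(1)], of "ramification_index \<phi> q1" "[2, 2, 1]"])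
      (use M(1) in \<open>simp_all add: fibre_mset_def\<close>)
  then obtain A1 B1 O1 where L1: "distinct [A1, B1, O1]" "fibre P1 \<phi> q1 = {A1, B1, O1}"
    "ramification_index \<phi> q1 A1 = 2" "ramification_index \<phi> q1 B1 = 2" "ramification_index \<phi> q1 O1 = 1"
    by (auto simp: map_eq_Cons_conv)
  obtain L2 where "distinct L2" "set L2 = fibre P1 \<phi> q2" "map (ramification_index \<phi> q2) L2 = [2, 2, 1]"
    by (rule image_mset_mset_set_list[OF fin[OF pts(2)], of "ramification_index \<phi> q2" "[2, 2, 1]"])
      (use M(2) in \<open>simp_all add: fibre_mset_def\<close>)
  then obtain A2 B2 O2 where L2: "distinct [A2, B2, O2]" "fibre P1 \<phi> q2 = {A2, B2, O2}"
    "ramification_index \<phi> q2 A2 = 2" "ramification_index \<phi> q2 B2 = 2" "ramification_index \<phi> q2 O2 = 1"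
    by (auto simp: map_eq_Cons_conv)
  obtain L3 where "distinct L3" "set L3 = fibre P1 \<phi> q3" "map (ramification_index \<phi> q3) L3 = [2, 3]"
    by (rule image_mset_mset_set_list[OF fin[OF pts(3)], of "ramification_index \<phi> q3" "[2, 3]"])
      (use M(3) in \<open>simp_all add: fibre_mset_def\<close>)
  then obtain A3 O3 where L3: "distinct [A3, O3]" "fibre P1 \<phi> q3 = {A3, O3}"
    "ramification_index \<phi> q3 A3 = 2" "ramification_index \<phi> q3 O3 = 3"
    by (auto simp: map_eq_Cons_conv)
  obtain L4 where "distinct L4" "set L4 = fibre P1 \<phi> q4" "map (ramification_index \<phi> q4) L4 = [2, 1, 1, 1]"
    by (rule image_mset_mset_set_list[OF fin[OF pts(4)], of "ramification_index \<phi> q4" "[2, 1, 1, 1]"])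
      (use M(4) in \<open>simp_all add: fibre_mset_def\<close>)
  then obtain A4 B4 C4 D4 where L4: "distinct [A4, B4, C4, D4]" "fibre P1 \<phi> q4 = {A4, B4, C4, D4}"
    "ramification_index \<phi> q4 A4 = 2" "ramification_index \<phi> q4 B4 = 1" "ramification_index \<phi> q4 C4 = 1"
    "ramification_index \<phi> q4 D4 = 1"
    by (auto simp: map_eq_Cons_conv)
  have disj: "fibre P1 \<phi> q1 \<inter> fibre P1 \<phi> q2 = {}" "fibre P1 \<phi> q1 \<inter> fibre P1 \<phi> q3 = {}"
    "fibre P1 \<phi> q1 \<inter> fibre P1 \<phi> q4 = {}" "fibre P1 \<phi> q2 \<inter> fibre P1 \<phi> q3 = {}"
    "fibre P1 \<phi> q2 \<inter> fibre P1 \<phi> q4 = {}" "fibre P1 \<phi> q3 \<inter> fibre P1 \<phi> q4 = {}"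
    using fibres_disjoint[OF pts(1) pts(2)] fibres_disjoint[OF pts(1) pts(3)] fibres_disjoint[OF pts(1) pts(4)]
      fibres_disjoint[OF pts(2) pts(3)] fibres_disjoint[OF pts(2) pts(4)] fibres_disjoint[OF pts(3) pts(4)] dist
    by simp_all
  have all_dist: "distinct [A1, B1, O1, A2, B2, O2, A3, O3, A4, B4, C4, D4]"
    using L1(1) L2(1) L3(1) L4(1) disj unfolding L1(2) L2(2) L3(2) L4(2) by auto
  have all_pts: "u \<in> points P1" if "u \<in> fibre P1 \<phi> q" for u q
    using that by (simp add: fibre_def)
  have Opts: "O1 \<in> points P1" "O2 \<in> points P1" "O3 \<in> points P1"
    using all_pts L1(2) L2(2) L3(2) by blast+
  obtain \<mu> where \<mu>: "aut \<mu>" "q1 \<circ> \<mu> = ord_at 0" "q2 \<circ> \<mu> = ord_inf" "q3 \<circ> \<mu> = ord_at 1"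
    using three_points_normalization[OF pts(1,2,3)] dist by auto
  obtain \<nu> where \<nu>: "aut \<nu>" "O1 \<circ> \<nu> = ord_at 0" "O2 \<circ> \<nu> = ord_inf" "O3 \<circ> \<nu> = ord_at 1"
    using three_points_normalization[OF Opts] all_dist by auto
  have to_ord_at: "\<exists>x. u \<circ> \<nu> = ord_at x" if "u \<in> points P1" "u \<noteq> O2" for u
  proof -
    have "u \<circ> \<nu> \<noteq> ord_inf" unfolding \<nu>(3)[symmetric] aut_comp_cancel[OF \<nu>(1)] by (rule that(2))
    with points_comp_aut[OF \<nu>(1) that(1)] show ?thesis by (auto simp: points_P1)
  qed
  obtain l where l: "q4 \<circ> \<mu> = ord_at l"
  proof -
    have "q4 \<circ> \<mu> \<noteq> ord_inf" unfolding \<mu>(3)[symmetric] aut_comp_cancel[OF \<mu>(1)] using dist by auto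
    with points_comp_aut[OF \<mu>(1) pts(4)] that show ?thesis by (auto simp: points_P1)
  qed
  obtain \<alpha> \<beta> where \<alpha>: "A1 \<circ> \<nu> = ord_at \<alpha>" and \<beta>: "B1 \<circ> \<nu> = ord_at \<beta>"
    using to_ord_at[of A1] to_ord_at[of B1] all_pts[of A1 q1] all_pts[of B1 q1] all_dist by (auto simp: L1(2))
  obtain \<gamma> \<delta> where \<gamma>: "A2 \<circ> \<nu> = ord_at \<gamma>" and \<delta>: "B2 \<circ> \<nu> = ord_at \<delta>"
    using to_ord_at[of A2] to_ord_at[of B2] all_pts[of A2 q2] all_pts[of B2 q2] all_dist by (auto simp: L2(2))
  obtain w where w: "A3 \<circ> \<nu> = ord_at w"
    using to_ord_at[of A3] all_pts[of A3 q3] all_dist by (auto simp: L3(2))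
  obtain r c1 c2 c3 where r: "A4 \<circ> \<nu> = ord_at r" and c: "B4 \<circ> \<nu> = ord_at c1" "C4 \<circ> \<nu> = ord_at c2" "D4 \<circ> \<nu> = ord_at c3"
    using to_ord_at[of A4] to_ord_at[of B4] to_ord_at[of C4] to_ord_at[of D4]
      all_pts[of A4 q4] all_pts[of B4 q4] all_pts[of C4 q4] all_pts[of D4 q4] all_dist by (auto simp: L4(2))
  have "distinct (map (\<lambda>u. u \<circ> \<nu>) [A1, B1, O1, A2, B2, O2, A3, O3, A4, B4, C4, D4])"
    unfolding distinct_map using all_dist aut_comp_cancel[OF \<nu>(1)] by (auto intro: inj_onI)
  then have dist': "distinct [0, 1, \<alpha>, \<beta>, \<gamma>, \<delta>, w, r, c1, c2, c3]"
    by (simp add: \<alpha> \<beta> \<gamma> \<delta> w r c \<nu>)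
  have "distinct (map (\<lambda>u. u \<circ> \<mu>) [q1, q2, q3, q4])"
    using dist by (simp add: aut_comp_cancel[OF \<mu>(1)])
  then have l01: "l \<noteq> 0" "l \<noteq> 1" by (auto simp: \<mu> l)
  define \<phi>' where "\<phi>' = inv_into UNIV \<nu> \<circ> \<phi> \<circ> \<mu>"
  have m': "curve_morphism P1 P1 \<phi>'"
    unfolding \<phi>'_def using \<mu>(1) aut_inv[OF \<nu>(1)] m by (auto simp: aut_def intro: curve_morphism_comp)
  note ft = fibre_transport[OF \<mu>(1) \<nu>(1) \<phi>'_def]
  have f0: "fibre P1 \<phi>' (ord_at 0) = {ord_at \<alpha>, ord_at \<beta>, ord_at 0}"
    "ramification_index \<phi>' (ord_at 0) (ord_at \<alpha>) = 2" "ramification_index \<phi>' (ord_at 0) (ord_at \<beta>) = 2"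
    "ramification_index \<phi>' (ord_at 0) (ord_at 0) = 1"
    using ft(1)[of q1] ft(2)[of q1 A1] ft(2)[of q1 B1] ft(2)[of q1 O1] L1 by (simp_all add: \<mu> \<nu> \<alpha> \<beta>)
  have fi: "fibre P1 \<phi>' ord_inf = {ord_at \<gamma>, ord_at \<delta>, ord_inf}"
    "ramification_index \<phi>' ord_inf (ord_at \<gamma>) = 2" "ramification_index \<phi>' ord_inf (ord_at \<delta>) = 2"
    using ft(1)[of q2] ft(2)[of q2 A2] ft(2)[of q2 B2] L2 by (simp_all add: \<mu> \<nu> \<gamma> \<delta>)
  have f1: "fibre P1 \<phi>' (ord_at 1) = {ord_at w, ord_at 1}"
    "ramification_index \<phi>' (ord_at 1) (ord_at w) = 2" "ramification_index \<phi>' (ord_at 1) (ord_at 1) = 3"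
    using ft(1)[of q3] ft(2)[of q3 A3] ft(2)[of q3 O3] L3 by (simp_all add: \<mu> \<nu> w)
  have fl: "fibre P1 \<phi>' (ord_at l) = {ord_at r, ord_at c1, ord_at c2, ord_at c3}"
    "ramification_index \<phi>' (ord_at l) (ord_at r) = 2" "ramification_index \<phi>' (ord_at l) (ord_at c1) = 1"
    "ramification_index \<phi>' (ord_at l) (ord_at c2) = 1" "ramification_index \<phi>' (ord_at l) (ord_at c3) = 1"
    using ft(1)[of q4] ft(2)[of q4 A4] ft(2)[of q4 B4] ft(2)[of q4 C4] ft(2)[of q4 D4] L4
    by (simp_all add: l r c)
  define R where "R = \<phi>' X"
  note sh = ord_at_shift[OF m', folded R_def]
  have R0: "ord_at x R = (if x = \<alpha> \<or> x = \<beta> then 2 else if x = 0 then 1 else if x = \<gamma> \<or> x = \<delta> then -2 else 0)" for x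
    using sh[of x 0] f0 fi by auto
  have R1: "ord_at x (R - 1) = (if x = w then 2 else if x = 1 then 3 else if x = \<gamma> \<or> x = \<delta> then -2 else 0)" for x
    using sh[of x 1] f1 fi by auto
  have Rl: "ord_at x (R - P1 l) = (if x = r then 2 else if x = c1 \<or> x = c2 \<or> x = c3 then 1
      else if x = \<gamma> \<or> x = \<delta> then -2 else 0)" for x
    using sh[of x l] fl fi by auto
  show thesis
    by (rule that[OF \<mu>(1) \<nu>(1) R_def[unfolded \<phi>'_def] \<mu>(2,3,4) l dist' l01 allI[OF R0] allI[OF R1] allI[OF Rl]])
qed

text \<open>
  The orders determine \<open>R\<close>, \<open>R - 1\<close> and \<open>R - l\<close> up to constants as quotients of
  polynomials by \<open>Q\<^sup>2\<close>. The leading coefficients show that the three constants agree, and the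
  two resulting identities are those solved above. Modulo squares the product
  \<open>R (R - 1) (R - l)\<close> is \<open>X (X - 1)\<close> times the cubic with the simple roots \<open>c1, c2, c3\<close>.
\<close>

lemma type_II_equations:
  assumes dist: "distinct [0, 1, \<alpha>, \<beta>, \<gamma>, \<delta>, w, r, c1, c2, c3]" and l: "l \<noteq> 0" "l \<noteq> 1"
    and R0: "\<And>x. ord_at x R = (if x = \<alpha> \<or> x = \<beta> then 2 else if x = 0 then 1 else if x = \<gamma> \<or> x = \<delta> then -2 else 0)"
    and R1: "\<And>x. ord_at x (R - 1) = (if x = w then 2 else if x = 1 then 3 else if x = \<gamma> \<or> x = \<delta> then -2 else 0)"
    and Rl: "\<And>x. ord_at x (R - P1 l) = (if x = r then 2 else if x = c1 \<or> x = c2 \<or> x = c3 then 1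
      else if x = \<gamma> \<or> x = \<delta> then -2 else 0)"
  obtains a H where "a * (9*a - 8) * (a + 8) * (2*a + 1) * (3*a - 1) * (a - 1) * (a - 2) \<noteq> 0"
    "l / (l - 1) = (3*a - 1)^3 * (a + 8)^2 * (a - 1) / (27 * a * (a - 2)^5)"
    "R * (R - 1) * (R - P1 l) = to_fract ([:0, 1:] * [:-1, 1:] *
      [:- ((a + 8)^2 * (a - 1)^3 * (3*a - 1)),
        - 18*a^6 + 380*a^5 - 1000*a^4 + 726*a^3 + 499*a^2 - 752*a + 192,
        - 27*a^6 - 54*a^5 + 468*a^4 - 958*a^3 + 381*a^2 + 400*a - 192,
        (2*a + 1) * (9*a - 8)^2:]) * H\<^sup>2"
proof -
  let ?Y = "\<lambda>a. X - P1 a"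
  define Q where "Q = ?Y \<gamma> * ?Y \<delta>"
  define P where "P = ?Y \<alpha> * ?Y \<beta>"
  define NK where "NK = ?Y c1 * ?Y c2 * ?Y c3"
  have nz: "R \<noteq> 0" "R - 1 \<noteq> 0" "R - P1 l \<noteq> 0"
    using R0[of \<alpha>] R1[of w] Rl[of r] by (metis ord_at.zero zero_neq_numeral)+
  have Q0: "Q \<noteq> 0" "P \<noteq> 0" "NK \<noteq> 0" by (simp_all add: Q_def P_def NK_def)
  have Y0: "?Y a \<noteq> 0" for a by simp
  have d: "distinct [0, \<alpha>, \<beta>, \<gamma>, \<delta>]" "distinct [1, w, \<gamma>, \<delta>]" "distinct [r, c1, c2, c3, \<gamma>, \<delta>]"
    using dist by auto
  have vQ: "ord_at x (Q\<^sup>2) = 2 * ((if x = \<gamma> then 1 else 0) + (if x = \<delta> then 1 else 0))" for x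
    by (simp add: Q_def ord_at.power ord_at.mult)
  have same: thesis'
    if "S \<noteq> 0" "G \<noteq> 0" "\<And>x. ord_at x S + ord_at x (Q\<^sup>2) = ord_at x G" "\<And>k. k \<noteq> 0 \<Longrightarrow> S * Q\<^sup>2 = P1 k * G \<Longrightarrow> thesis'"
    for S G thesis'
  proof (rule ratfun_same_divisor)
    show "ord_at x (S * Q\<^sup>2) = ord_at x G" for x using that(1,3) Q0 by (simp add: ord_at.mult)
  qed (use that Q0 in auto)
  have v0: "ord_at x (X * P\<^sup>2) = (if x = 0 then 1 else 0) + 2 * ((if x = \<alpha> then 1 else 0) + (if x = \<beta> then 1 else 0))" for x
    using Q0(2) by (simp add: ord_at.mult ord_at.power) (simp add: P_def ord_at.mult)
  have v1: "ord_at x (?Y 1 ^ 3 * ?Y w ^ 2) = 3 * (if x = 1 then 1 else 0) + 2 * (if x = w then 1 else 0)" for x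
    unfolding ord_at.mult[OF power_not_zero[OF Y0] power_not_zero[OF Y0]] ord_at.power ord_at_linear by simp
  have vl: "ord_at x (?Y r ^ 2 * NK) = 2 * (if x = r then 1 else 0) +
      ((if x = c1 then 1 else 0) + (if x = c2 then 1 else 0) + (if x = c3 then 1 else 0))" for x
  proof -
    have "ord_at x NK = ord_at x (?Y c1) + ord_at x (?Y c2) + ord_at x (?Y c3)"
      by (simp add: NK_def ord_at.mult del: ord_at_linear)
    moreover have "ord_at x (?Y r ^ 2 * NK) = 2 * ord_at x (?Y r) + ord_at x NK"
      using Q0(3) by (simp add: ord_at.mult ord_at.power del: ord_at_linear)
    ultimately show ?thesis by (simp only: ord_at_linear)
  qed
  obtain k0 where k0: "k0 \<noteq> 0" "R * Q\<^sup>2 = P1 k0 * (X * P\<^sup>2)"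
  proof (rule same)
    show "ord_at x R + ord_at x (Q\<^sup>2) = ord_at x (X * P\<^sup>2)" for x
      unfolding R0 vQ v0 using d(1) by auto
  qed (use nz Q0 in auto)
  obtain k1 where k1: "k1 \<noteq> 0" "(R - 1) * Q\<^sup>2 = P1 k1 * (?Y 1 ^ 3 * ?Y w ^ 2)"
  proof (rule same)
    show "ord_at x (R - 1) + ord_at x (Q\<^sup>2) = ord_at x (?Y 1 ^ 3 * ?Y w ^ 2)" for x
      unfolding R1 vQ v1 using d(2) by auto
    show "?Y 1 ^ 3 * ?Y w ^ 2 \<noteq> 0" using Y0 by (intro no_zero_divisors power_not_zero)
  qed (use nz Q0 in auto)
  obtain kl where kl: "kl \<noteq> 0" "(R - P1 l) * Q\<^sup>2 = P1 kl * (?Y r ^ 2 * NK)"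
  proof (rule same)
    show "ord_at x (R - P1 l) + ord_at x (Q\<^sup>2) = ord_at x (?Y r ^ 2 * NK)" for x
      unfolding Rl vQ vl using d(3) by auto
  qed (use nz Q0 in auto)
  define p where "p = [:\<alpha> * \<beta>, - (\<alpha> + \<beta>), 1:]"
  define q where "q = [:\<gamma> * \<delta>, - (\<gamma> + \<delta>), 1:]"
  define N where "N = [:-c1, 1:] * [:-c2, 1:] * [:-c3, 1:]"
  have quad: "to_fract [:a * b, - (a + b), 1:] = ?Y a * ?Y b" for a b
    unfolding X_minus_P1 to_fract_mult[symmetric] by (simp add: algebra_simps)
  have tf: "to_fract p = P" "to_fract q = Q" "to_fract N = NK"
    by (simp_all only: p_def q_def P_def Q_def quad N_def NK_def X_minus_P1 to_fract_mult)
  have tP: "P1 c * to_fract f = to_fract (Polynomial.smult c f)" for c f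
    by (simp add: P1_def flip: to_fract_mult)
  have tX: "X = to_fract [:0, 1:]" by (simp add: X_def)
  have pow: "to_fract (f ^ n) = to_fract f ^ n" for f :: "complex poly" and n
    by (induction n) simp_all
  have e1: "Polynomial.smult k0 ([:0, 1:] * p\<^sup>2) - q\<^sup>2 = Polynomial.smult k1 ([:-1, 1:] ^ 3 * [:-w, 1:]\<^sup>2)"
  proof -
    have "P1 k0 * (X * P\<^sup>2) - Q\<^sup>2 = P1 k1 * (?Y 1 ^ 3 * ?Y w ^ 2)"
      using k0(2) k1(2) by (simp add: left_diff_distrib)
    then have "to_fract (Polynomial.smult k0 ([:0, 1:] * p\<^sup>2) - q\<^sup>2)
        = to_fract (Polynomial.smult k1 ([:-1, 1:] ^ 3 * [:-w, 1:]\<^sup>2))"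
      by (simp only: to_fract_diff tP[symmetric] to_fract_mult pow tf tX[symmetric] X_minus_P1[symmetric])
    then show ?thesis by (simp only: to_fract_eq_iff)
  qed
  have e2: "Polynomial.smult k0 ([:0, 1:] * p\<^sup>2) - Polynomial.smult l (q\<^sup>2) = Polynomial.smult kl ([:-r, 1:]\<^sup>2 * N)"
  proof -
    have "P1 k0 * (X * P\<^sup>2) - P1 l * Q\<^sup>2 = P1 kl * (?Y r ^ 2 * NK)"
      using k0(2) kl(2) by (simp add: left_diff_distrib)
    then have "to_fract (Polynomial.smult k0 ([:0, 1:] * p\<^sup>2) - Polynomial.smult l (q\<^sup>2))
        = to_fract (Polynomial.smult kl ([:-r, 1:]\<^sup>2 * N))"
      by (simp only: to_fract_diff tP[symmetric] to_fract_mult pow tf tX[symmetric] X_minus_P1[symmetric])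
    then show ?thesis by (simp only: to_fract_eq_iff)
  qed
  have "k0 = k1"
    using arg_cong[OF e1, of "\<lambda>f. coeff f 5"]
    by (simp add: p_def q_def power2_eq_square power3_eq_cube eval_nat_numeral)
  have "k0 = kl"
    using arg_cong[OF e2, of "\<lambda>f. coeff f 5"]
    by (simp add: p_def q_def N_def power2_eq_square eval_nat_numeral)
  have pq: "poly p x = x\<^sup>2 + (- (\<alpha> + \<beta>)) * x + \<alpha> * \<beta>" "poly q x = x\<^sup>2 + (- (\<gamma> + \<delta>)) * x + \<gamma> * \<delta>"
    "poly p x = (x - \<alpha>) * (x - \<beta>)" "poly q x = (x - \<gamma>) * (x - \<delta>)" for x
    by (simp_all add: p_def q_def algebra_simps power2_eq_square)
  obtain k \<omega> where k: "k\<^sup>2 = k0" "\<omega>\<^sup>2 = w" "k * (2 * \<omega> + 3) = 1"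
    and P_eq: "- (\<alpha> + \<beta>) = \<omega>\<^sup>2 + 6 * \<omega> + 3" "\<alpha> * \<beta> = 3 * \<omega>\<^sup>2 + 2 * \<omega>"
    and Q_eq: "- (\<gamma> + \<delta>) = k * (3 * \<omega>\<^sup>2 + 6 * \<omega> + 1)" "\<gamma> * \<delta> = k * \<omega>\<^sup>2"
  proof (rule type_II_square_root_factorization[of k0 "- (\<alpha> + \<beta>)" "\<alpha> * \<beta>" "- (\<gamma> + \<delta>)" "\<gamma> * \<delta>" w])
    show "k0 * x * (x\<^sup>2 + (- (\<alpha> + \<beta>)) * x + \<alpha> * \<beta>)\<^sup>2 - (x\<^sup>2 + (- (\<gamma> + \<delta>)) * x + \<gamma> * \<delta>)\<^sup>2
        = k0 * (x - 1) ^ 3 * (x - w)\<^sup>2" for x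
      using arg_cong[OF e1, of "\<lambda>f. poly f x"] unfolding pq(1,2)[symmetric]
      by (simp add: \<open>k0 = k1\<close>[symmetric] mult_ac)
    show "x\<^sup>2 + (- (\<gamma> + \<delta>)) * x + \<gamma> * \<delta> \<noteq> 0" if "x\<^sup>2 + (- (\<alpha> + \<beta>)) * x + \<alpha> * \<beta> = 0" for x
      using that dist unfolding pq(1,2)[symmetric] pq(3,4) by auto
  qed (use k0 dist in auto)
  define m where "m = 2 * \<omega> + 3"
  have m0: "m \<noteq> 0" using k(3) by (auto simp: m_def)
  have km: "k = 1 / m" using k(3) m0 by (simp add: m_def field_simps)
  have p_eq: "p = [:3 * \<omega>\<^sup>2 + 2 * \<omega>, \<omega>\<^sup>2 + 6 * \<omega> + 3, 1:]"
    unfolding p_def P_eq ..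
  have q_eq: "[:\<omega>\<^sup>2, 3 * \<omega>\<^sup>2 + 6 * \<omega> + 1, 2 * \<omega> + 3:] = Polynomial.smult m q"
    unfolding q_def Q_eq km using m0 by (simp add: m_def)
  have N_eq: "[:0, 1:] * [:3 * \<omega>\<^sup>2 + 2 * \<omega>, \<omega>\<^sup>2 + 6 * \<omega> + 3, 1:]\<^sup>2
      - Polynomial.smult l ([:\<omega>\<^sup>2, 3 * \<omega>\<^sup>2 + 6 * \<omega> + 1, 2 * \<omega> + 3:]\<^sup>2) = [:-r, 1:]\<^sup>2 * N"
  proof -
    have k0m: "m\<^sup>2 * k0 = 1" using m0 unfolding k(1)[symmetric] km by (simp add: power_divide)
    have "Polynomial.smult (m\<^sup>2) (Polynomial.smult k0 ([:0, 1:] * p\<^sup>2) - Polynomial.smult l (q\<^sup>2))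
        = Polynomial.smult (m\<^sup>2) (Polynomial.smult k0 ([:-r, 1:]\<^sup>2 * N))"
      by (simp only: e2) (simp only: \<open>k0 = kl\<close>)
    then have "[:0, 1:] * p\<^sup>2 - Polynomial.smult (m\<^sup>2 * l) (q\<^sup>2) = [:-r, 1:]\<^sup>2 * N"
      by (simp only: smult_diff_right smult_smult k0m smult_1_left)
    moreover have "Polynomial.smult l ((Polynomial.smult m q)\<^sup>2) = Polynomial.smult (m\<^sup>2 * l) (q\<^sup>2)"
      by (simp add: power2_eq_square mult_ac)
    ultimately show ?thesis unfolding q_eq p_eq[symmetric] by (simp only:)
  qed
  have r: "r \<noteq> 1" "r \<noteq> \<omega>\<^sup>2" using dist k(2) by auto
  have rP: "r\<^sup>2 + (\<omega>\<^sup>2 + 6 * \<omega> + 3) * r + (3 * \<omega>\<^sup>2 + 2 * \<omega>) \<noteq> 0"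
    unfolding P_eq[symmetric] pq(1)[symmetric] pq(3) using dist by auto
  have rQ: "(2 * \<omega> + 3) * r\<^sup>2 + (3 * \<omega>\<^sup>2 + 6 * \<omega> + 1) * r + \<omega>\<^sup>2 \<noteq> 0"
  proof -
    have "(2 * \<omega> + 3) * r\<^sup>2 + (3 * \<omega>\<^sup>2 + 6 * \<omega> + 1) * r + \<omega>\<^sup>2 = poly (Polynomial.smult m q) r"
      unfolding q_eq[symmetric] by (simp add: algebra_simps power2_eq_square)
    also have "\<dots> \<noteq> 0" using m0 dist by (auto simp: pq(4))
    finally show ?thesis .
  qed
  note F = type_II_fourth_critical_value[OF m0[unfolded m_def] l r rP rQ N_eq]
  define a where "a = \<omega> + 1"
  define b3 where "b3 = m * (9 * \<omega> + 1)\<^sup>2"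
  let ?B = "[:- ((a + 8)^2 * (a - 1)^3 * (3*a - 1)),
        - 18*a^6 + 380*a^5 - 1000*a^4 + 726*a^3 + 499*a^2 - 752*a + 192,
        - 27*a^6 - 54*a^5 + 468*a^4 - 958*a^3 + 381*a^2 + 400*a - 192,
        (2*a + 1) * (9*a - 8)^2:]"
  have B: "Polynomial.smult b3 N = ?B"
    unfolding b3_def m_def by (rule F(8)[OF a_def])
  have b3: "b3 \<noteq> 0" using m0 F(5) by (simp add: b3_def)
  have omega: "\<omega> = a - 1" by (simp add: a_def)
  have A: "a * (9*a - 8) * (a + 8) * (2*a + 1) * (3*a - 1) * (a - 1) * (a - 2) \<noteq> 0"
  proof -
    have "a \<noteq> 0" "9*a - 8 \<noteq> 0" "a + 8 \<noteq> 0" "2*a + 1 \<noteq> 0" "3*a - 1 \<noteq> 0" "a - 1 \<noteq> 0" "a - 2 \<noteq> 0"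
      using F(1-6) m0 unfolding m_def omega by (simp_all add: algebra_simps)
    then show ?thesis by (simp only: mult_eq_0_iff simp_thms)
  qed
  have L: "l / (l - 1) = (3*a - 1)^3 * (a + 8)^2 * (a - 1) / (27 * a * (a - 2)^5)"
  proof -
    have *: "3 * \<omega> + 2 = 3 * a - 1" "\<omega> + 9 = a + 8" "\<omega> + 1 = a" "\<omega> - 1 = a - 2"
      by (simp_all add: a_def)
    show ?thesis using F(7) unfolding * unfolding omega .
  qed
  \<comment> \<open>Multiplying the cubic by its prescribed leading coefficient costs a constant, which is a square.\<close>
  define H where "H = P1 (csqrt (k0 ^ 3 / b3)) * (P * ?Y 1 * ?Y w * ?Y r / Q ^ 3)"
  have "R * (R - 1) * (R - P1 l) = to_fract ([:0, 1:] * [:-1, 1:] * ?B) * H\<^sup>2"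
  proof -
    have "(R * (R - 1) * (R - P1 l)) * Q ^ 6 = (R * Q\<^sup>2) * ((R - 1) * Q\<^sup>2) * ((R - P1 l) * Q\<^sup>2)"
      by (simp add: eval_nat_numeral algebra_simps)
    also have "\<dots> = P1 (k0 ^ 3) * (X * ?Y 1 * NK) * (P * ?Y 1 * ?Y w * ?Y r)\<^sup>2"
      unfolding k0(2) k1(2) kl(2) \<open>k0 = k1\<close>[symmetric] \<open>k0 = kl\<close>[symmetric] P1.hom_power
      by (simp only: power2_eq_square power3_eq_cube mult_ac)
    also have "P1 (k0 ^ 3) = P1 b3 * P1 (csqrt (k0 ^ 3 / b3)) ^ 2"
      unfolding P1.hom_power[symmetric] P1.hom_mult[symmetric] power2_csqrt using b3 by simp
    also have "P1 b3 * P1 (csqrt (k0 ^ 3 / b3)) ^ 2 * (X * ?Y 1 * NK) * (P * ?Y 1 * ?Y w * ?Y r)\<^sup>2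
        = (X * ?Y 1 * (P1 b3 * NK)) * (P1 (csqrt (k0 ^ 3 / b3)) * (P * ?Y 1 * ?Y w * ?Y r))\<^sup>2"
      by (simp only: power_mult_distrib mult_ac)
    also have "P1 b3 * NK = to_fract ?B" unfolding tf(3)[symmetric] tP B ..
    also have "X * ?Y 1 * to_fract ?B = to_fract ([:0, 1:] * [:-1, 1:] * ?B)"
      by (simp only: to_fract_mult tX[symmetric] X_minus_P1[symmetric])
    also have "P1 (csqrt (k0 ^ 3 / b3)) * (P * ?Y 1 * ?Y w * ?Y r) = H * Q ^ 3"
      using Q0 by (simp add: H_def)
    also have "(H * Q ^ 3)\<^sup>2 = H\<^sup>2 * Q ^ 6" by (simp add: power_mult_distrib flip: power_mult)
    finally have eq: "(R * (R - 1) * (R - P1 l)) * Q ^ 6 = (to_fract ([:0, 1:] * [:-1, 1:] * ?B) * H\<^sup>2) * Q ^ 6"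
      by (simp only: mult.assoc)
    have "Q ^ 6 \<noteq> 0" using Q0 by simp
    from mult_right_cancel[OF this, THEN iffD1, OF eq] show ?thesis .
  qed
  with A L show thesis by (rule that)
qed

section \<open>The two curves\<close>

lemma odd_points_same_square:
  assumes "F \<noteq> 0" "G \<noteq> 0" "odd_points F = odd_points G"
  obtains H where "F = G * H\<^sup>2"
proof -
  have "odd (ord_at a F) \<longleftrightarrow> odd (ord_at a G)" for a
  proof -
    have "ord_at a \<in> odd_points F \<longleftrightarrow> ord_at a \<in> odd_points G" by (simp only: assms(3))
    then show ?thesis by (simp add: odd_points_def)
  qed
  then have "even (ord_at a (F / G))" for a using assms(1,2) by (simp add: ord_at.divide)
  moreover have "F / G \<noteq> 0" using assms by simp
  ultimately obtain H where "F / G = H\<^sup>2" using ratfun_square by blast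
  then have "F = G * H\<^sup>2" using assms(2) by (simp add: field_simps)
  then show thesis by (rule that)
qed

lemma odd_points_legendre:
  assumes "l \<noteq> 0" "l \<noteq> 1"
  shows "odd_points (X * (X - 1) * (X - P1 l)) = {ord_at 0, ord_inf, ord_at 1, ord_at l}"
proof -
  have X1: "X - 1 \<noteq> 0" using X_neq_P1(1)[of 1] by simp
  have v1: "ord_at a (X - 1) = (if a = 1 then 1 else 0)" "ord_inf (X - 1) = -1" for a
    using ord_at_linear[of a 1] ord_inf_linear[of 1] by simp_all
  have "ord_at a (X * (X - 1) * (X - P1 l)) = (if a = 0 \<or> a = 1 \<or> a = l then 1 else 0)" for a
    using assms X1 by (simp add: ord_at.mult v1)
  moreover have "ord_inf (X * (X - 1) * (X - P1 l)) = -3"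
    using X1 by (simp add: ord_inf.mult v1)
  ultimately show ?thesis using assms by (auto simp: odd_points_def points_P1 split: if_splits)
qed

text \<open>
  The involution \<open>s = X / (X - 1)\<close> fixes \<open>0\<close>, exchanges \<open>1\<close> and \<open>\<infinity>\<close> and moves
  \<open>l\<close> to \<open>l / (l - 1)\<close>. Since \<open>s (s - 1) (s - l / (l - 1))\<close> and
  \<open>X (X - 1) (X - l)\<close> have the same four odd points, they differ by a square, here given
  explicitly.
\<close>

lemma double_cover_legendre_involution:
  assumes dc: "double_cover c h y (X * (X - 1) * (X - P1 l))" and l: "l \<noteq> 1"
  shows "given_by c (double_cover_eq ([:0, 1:] * [:-1, 1:] * [:- (l / (l - 1)), 1:]))"
proof -
  have X1: "X - 1 \<noteq> 0" using X_neq_P1(1)[of 1] by simp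
  let ?s = "X / (X - 1)"
  have v1: "ord_at a (X - 1) = (if a = 1 then 1 else 0)" for a
    using ord_at_linear[of a 1] by simp
  have s: "?s \<notin> range P1"
    by (rule not_const_if_val[OF ord_at_point[of 1]]) (use X1 in \<open>simp add: ord_at.divide v1\<close>)
  have s1: "?s - 1 = 1 / (X - 1)" using X1 by (simp add: field_simps)
  have inv: "subst P1 ?s ?s = X"
  proof -
    have "subst P1 ?s ?s = ?s / (?s - 1)"
      using subst_P1_simps[OF s] by (metis P1.hom_one)
    also have "\<dots> = X" unfolding s1 using X1 by simp
    finally show ?thesis .
  qed
  have aut: "aut (subst P1 ?s)" by (rule aut_subst[OF s s inv inv])
  define k where "k = csqrt (1 - l)"
  have k: "k \<noteq> 0" "k\<^sup>2 = 1 - l" using l by (simp_all add: k_def)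
  let ?l = "l / (l - 1)"
  let ?F = "to_fract ([:0, 1:] * [:-1, 1:] * [:- ?l, 1:])"
  have F: "?F = X * (X - 1) * (X - P1 ?l)"
    unfolding to_fract_mult X_minus_P1[symmetric] by (simp add: X_def)
  have sl: "(?s - P1 ?l) * P1 (k\<^sup>2) = (X - P1 l) / (X - 1)"
  proof -
    have "?l * (1 - l) = - l" using l by (simp add: field_simps)
    then have "P1 ?l * P1 (k\<^sup>2) = - P1 l"
      unfolding k(2) P1.hom_mult[symmetric] by (simp only: P1.hom_uminus)
    then have "(?s - P1 ?l) * P1 (k\<^sup>2) = ?s * (1 - P1 l) + P1 l"
      by (simp add: left_diff_distrib k(2) P1.hom_minus)
    also have "\<dots> = (X - P1 l) / (X - 1)" using X1 by (simp add: field_simps)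
    finally show ?thesis .
  qed
  have "X * (X - 1) * (X - P1 l) = subst P1 ?s ?F * (P1 k * (X - 1)\<^sup>2)\<^sup>2"
  proof -
    have "subst P1 ?s ?F = ?s * (?s - 1) * (?s - P1 ?l)"
      unfolding F using subst_P1_simps[OF s] by (metis P1.hom_one)
    then have "subst P1 ?s ?F * (P1 k * (X - 1)\<^sup>2)\<^sup>2 = ?s * (?s - 1) * ((?s - P1 ?l) * P1 (k\<^sup>2)) * (X - 1) ^ 4"
      by (simp only: P1.hom_power) (simp add: power2_eq_square eval_nat_numeral mult_ac)
    also have "\<dots> = (?s * (X - 1)) * ((?s - 1) * (X - 1)) * ((X - P1 l) / (X - 1) * (X - 1)) * (X - 1)"
      unfolding sl by (simp add: eval_nat_numeral mult_ac)
    also have "\<dots> = X * (X - 1) * (X - P1 l)" unfolding s1 using X1 by simp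
    finally show ?thesis by simp
  qed
  with dc have "double_cover c h y (subst P1 ?s ?F * (P1 k * (X - 1)\<^sup>2)\<^sup>2)" by simp
  from double_cover_aut[OF double_cover_square[OF this] aut]
  show ?thesis by (rule double_cover_given_by)
qed

lemma fibre_index_one_odd:
  assumes "q \<in> odd_points F" "finite (fibre P1 \<phi> q)" "1 \<in># fibre_mset \<phi> q"
  shows "odd_points (\<phi> F) \<noteq> {}"
proof -
  have q: "q \<in> points P1" "odd (q F)" using assms(1) by (simp_all add: odd_points_def)
  obtain w where w: "w \<in> fibre P1 \<phi> q" "ramification_index \<phi> q w = 1"
    using assms(2,3) by (auto simp: fibre_mset_def)
  from fibreD[OF q(1) w(1)] q(2) w(2) have "w \<in> odd_points (\<phi> F)" by (simp add: odd_points_def)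
  then show ?thesis by blast
qed

text \<open>
  The element \<open>\<psi> y\<close> is a square root of the pullback \<open>\<phi> F\<close>. It lies outside the field of
  rational functions because \<open>\<phi> F\<close> has an odd point, namely the unramified one over
  \<open>q1\<close>; so it generates the function field of \<open>C\<close>.
\<close>

theorem proposition3:
  fixes C :: "complex \<Rightarrow> 'c::field" and E :: "complex \<Rightarrow> 'e::field" and \<psi> :: "'e \<Rightarrow> 'c"
  assumes "in_Y2_via C E \<psi>"
  shows "\<exists>a b3 b2 b1 b0 :: complex.
    a * (9*a - 8) * (a + 8) * (2*a + 1) * (3*a - 1) * (a - 1) * (a - 2) \<noteq> 0 \<and>
    b3 = (2*a + 1) * (9*a - 8)^2 \<and>
    b2 = - 27*a^6 - 54*a^5 + 468*a^4 - 958*a^3 + 381*a^2 + 400*a - 192 \<and>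
    b1 = - 18*a^6 + 380*a^5 - 1000*a^4 + 726*a^3 + 499*a^2 - 752*a + 192 \<and>
    b0 = - ((a + 8)^2 * (a - 1)^3 * (3*a - 1)) \<and>
    given_by C (double_cover_eq ([:0, 1:] * [:-1, 1:] * [:b0, b1, b2, b3:])) \<and>
    given_by E (double_cover_eq ([:0, 1:] * [:-1, 1:] *
      [:- ((3*a - 1)^3 * (a + 8)^2 * (a - 1) / (27 * a * (a - 2)^5)), 1:]))"
proof -
  obtain \<pi>C \<pi>E \<phi> where gC: "has_genus C 2" and gE: "has_genus E 1" and \<psi>: "curve_morphism E C \<psi>"
    and \<pi>C: "is_cover 2 P1 C \<pi>C" and \<pi>E: "is_cover 2 P1 E \<pi>E" and \<phi>: "curve_morphism P1 P1 \<phi>"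
    and comm: "\<pi>C \<circ> \<phi> = \<psi> \<circ> \<pi>E" and II: "degenerate_type_II \<phi>"
    using assms unfolding in_Y2_via_def is_cover_def by blast
  interpret \<psi>: field_hom \<psi> using \<psi> by (simp add: curve_morphism_def)
  interpret \<pi>C: field_hom \<pi>C using \<pi>C by (simp add: is_cover_def curve_morphism_def)
  obtain y F where dcE: "double_cover E \<pi>E y F" by (rule degree_2_double_cover[OF \<pi>E])
  note bE = double_cover_branch_points[OF dcE gE]
  have cardF: "card (odd_points F) = 4"
  proof -
    have "card (odd_points F) \<in> {3, 4}" using bE by auto
    with bE(4) show ?thesis by auto
  qed
  have ysq: "(\<psi> y)\<^sup>2 = \<pi>C (\<phi> F)"
    using dcE comm by (metis \<psi>.hom_power comp_apply double_cover_def)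
  have dcC_if: "double_cover C \<pi>C (\<psi> y) (\<phi> F)" if "\<psi> y \<notin> range \<pi>C"
  proof -
    obtain y0 F0 where "double_cover C \<pi>C y0 F0" by (rule degree_2_double_cover[OF \<pi>C])
    from double_cover_generator[OF this that ysq] show ?thesis .
  qed
  have no_odd: "odd_points (\<phi> F) = {}" if y: "\<psi> y \<in> range \<pi>C"
  proof -
    obtain G where "\<psi> y = \<pi>C G" using y by blast
    then have "\<pi>C (\<phi> F) = \<pi>C (G\<^sup>2)" using ysq by (simp add: \<pi>C.hom_power)
    then have "\<phi> F = G\<^sup>2" by simp
    moreover have "even (v (G\<^sup>2))" if "v \<in> points P1" for v
      using prevaluation.power[OF prevaluation_point[OF field_hom_P1 that], of G 2] by simp
    ultimately show ?thesis by (auto simp: odd_points_def)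
  qed
  \<comment> \<open>The bound holds in either case; the case of no odd points is excluded only afterwards.\<close>
  have oC: "finite (odd_points (\<phi> F))" "card (odd_points (\<phi> F)) \<le> 6"
    using no_odd double_cover_branch_points(1,2)[OF dcC_if gC] by fastforce+
  obtain q1 q2 q3 q4 where dist: "distinct [q1, q2, q3, q4]" and oF: "odd_points F = {q1, q2, q3, q4}"
    and M: "fibre_mset \<phi> q1 = {#2, 2, 1#}" "fibre_mset \<phi> q2 = {#2, 2, 1#}"
      "fibre_mset \<phi> q3 = {#2, 3#}" "fibre_mset \<phi> q4 = {#2, 1, 1, 1#}"
    by (rule type_II_branch_points[OF \<phi> II bE(1) cardF oC])
  have pts: "q1 \<in> points P1" "q2 \<in> points P1" "q3 \<in> points P1" "q4 \<in> points P1"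
    using oF by (auto simp: odd_points_def)
  have "odd_points (\<phi> F) \<noteq> {}"
  proof (rule fibre_index_one_odd[of q1 F \<phi>])
    show "q1 \<in> odd_points F" by (simp add: oF)
    show "finite (fibre P1 \<phi> q1)" using fibre_degree[OF \<phi>] pts(1) by blast
    show "1 \<in># fibre_mset \<phi> q1" by (simp add: M)
  qed
  then have dcC: "double_cover C \<pi>C (\<psi> y) (\<phi> F)" using no_odd dcC_if by blast
  obtain \<mu> \<nu> R l \<alpha> \<beta> \<gamma> \<delta> w r c1 c2 c3 where \<mu>: "aut \<mu>" and \<nu>: "aut \<nu>"
    and R: "R = (inv_into UNIV \<nu> \<circ> \<phi> \<circ> \<mu>) X"
    and q: "q1 \<circ> \<mu> = ord_at 0" "q2 \<circ> \<mu> = ord_inf" "q3 \<circ> \<mu> = ord_at 1" "q4 \<circ> \<mu> = ord_at l"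
    and d: "distinct [0, 1, \<alpha>, \<beta>, \<gamma>, \<delta>, w, r, c1, c2, c3]" and l: "l \<noteq> 0" "l \<noteq> 1"
    and vals: "\<forall>x. ord_at x R = (if x = \<alpha> \<or> x = \<beta> then 2 else if x = 0 then 1 else if x = \<gamma> \<or> x = \<delta> then -2 else 0)"
      "\<forall>x. ord_at x (R - 1) = (if x = w then 2 else if x = 1 then 3 else if x = \<gamma> \<or> x = \<delta> then -2 else 0)"
      "\<forall>x. ord_at x (R - P1 l) = (if x = r then 2 else if x = c1 \<or> x = c2 \<or> x = c3 then 1
        else if x = \<gamma> \<or> x = \<delta> then -2 else 0)"
    by (rule type_II_normal_form[OF \<phi> pts dist M]) (rule that)
  obtain a H where a: "a * (9*a - 8) * (a + 8) * (2*a + 1) * (3*a - 1) * (a - 1) * (a - 2) \<noteq> 0"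
    and la: "l / (l - 1) = (3*a - 1)^3 * (a + 8)^2 * (a - 1) / (27 * a * (a - 2)^5)"
    and RH: "R * (R - 1) * (R - P1 l) = to_fract ([:0, 1:] * [:-1, 1:] *
      [:- ((a + 8)^2 * (a - 1)^3 * (3*a - 1)),
        - 18*a^6 + 380*a^5 - 1000*a^4 + 726*a^3 + 499*a^2 - 752*a + 192,
        - 27*a^6 - 54*a^5 + 468*a^4 - 958*a^3 + 381*a^2 + 400*a - 192,
        (2*a + 1) * (9*a - 8)^2:]) * H\<^sup>2"
    by (rule type_II_equations[OF d l vals[rule_format]]) (rule that)
  have \<mu>inv: "\<mu> (inv_into UNIV \<mu> G) = G" for G
    using \<mu> by (simp add: aut_def bij_is_surj surj_f_inv_f)
  have \<nu>inv: "\<nu> (inv_into UNIV \<nu> G) = G" for G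
    using \<nu> by (simp add: aut_def bij_is_surj surj_f_inv_f)
  define F' where "F' = inv_into UNIV \<mu> F"
  have F': "F = \<mu> F'" by (simp add: F'_def \<mu>inv)
  have dcE': "double_cover E (\<pi>E \<circ> \<mu>) y F'"
    by (rule double_cover_aut[OF _ \<mu>]) (simp add: dcE flip: F')
  have F'0: "F' \<noteq> 0" by (rule double_cover_nonzero[OF dcE'])
  let ?L = "X * (X - 1) * (X - P1 l)"
  have "X - 1 \<noteq> 0" using X_neq_P1(1)[of 1] by simp
  then have L0: "?L \<noteq> 0" by simp
  have "odd_points F' = odd_points ?L"
    unfolding odd_points_aut[OF \<mu>, of F'] F'[symmetric] oF odd_points_legendre[OF l] by (simp add: q)
  from odd_points_same_square[OF F'0 L0 this] obtain G where G: "F' = ?L * G\<^sup>2" .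
  have E_eq: "given_by E (double_cover_eq ([:0, 1:] * [:-1, 1:] *
      [:- ((3*a - 1)^3 * (a + 8)^2 * (a - 1) / (27 * a * (a - 2)^5)), 1:]))"
    using double_cover_legendre_involution[OF double_cover_square[OF dcE'[unfolded G]] l(2)]
    unfolding la .
  define \<phi>' where "\<phi>' = inv_into UNIV \<nu> \<circ> \<phi> \<circ> \<mu>"
  have m': "curve_morphism P1 P1 \<phi>'"
    unfolding \<phi>'_def using \<mu> aut_inv[OF \<nu>] \<phi> by (auto simp: aut_def intro: curve_morphism_comp)
  interpret \<phi>': field_hom \<phi>' using m' by (simp add: curve_morphism_def)
  have \<phi>'c: "\<phi>' (P1 a) = P1 a" for a using m' by (simp add: curve_morphism_def)
  have \<nu>\<phi>': "\<nu> (\<phi>' F') = \<phi> F" by (simp add: \<phi>'_def \<nu>inv F')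
  have "\<phi>' F' = R * (R - 1) * (R - P1 l) * (\<phi>' G)\<^sup>2"
    unfolding G \<phi>'.hom_mult \<phi>'.hom_power \<phi>'.hom_minus \<phi>'.hom_one \<phi>'c R \<phi>'_def[symmetric] ..
  also have "\<dots> = to_fract ([:0, 1:] * [:-1, 1:] *
      [:- ((a + 8)^2 * (a - 1)^3 * (3*a - 1)),
        - 18*a^6 + 380*a^5 - 1000*a^4 + 726*a^3 + 499*a^2 - 752*a + 192,
        - 27*a^6 - 54*a^5 + 468*a^4 - 958*a^3 + 381*a^2 + 400*a - 192,
        (2*a + 1) * (9*a - 8)^2:]) * (H * \<phi>' G)\<^sup>2"
    unfolding RH by (simp only: power_mult_distrib mult.assoc)
  finally have \<phi>'F': "\<phi>' F' = to_fract ([:0, 1:] * [:-1, 1:] *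
      [:- ((a + 8)^2 * (a - 1)^3 * (3*a - 1)),
        - 18*a^6 + 380*a^5 - 1000*a^4 + 726*a^3 + 499*a^2 - 752*a + 192,
        - 27*a^6 - 54*a^5 + 468*a^4 - 958*a^3 + 381*a^2 + 400*a - 192,
        (2*a + 1) * (9*a - 8)^2:]) * (H * \<phi>' G)\<^sup>2" .
  have "double_cover C (\<pi>C \<circ> \<nu>) (\<psi> y) (\<phi>' F')"
    by (rule double_cover_aut[OF _ \<nu>]) (simp add: dcC \<nu>\<phi>')
  from double_cover_given_by[OF double_cover_square[OF this[unfolded \<phi>'F']]]
  have C_eq: "given_by C (double_cover_eq ([:0, 1:] * [:-1, 1:] *
      [:- ((a + 8)^2 * (a - 1)^3 * (3*a - 1)),
        - 18*a^6 + 380*a^5 - 1000*a^4 + 726*a^3 + 499*a^2 - 752*a + 192,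
        - 27*a^6 - 54*a^5 + 468*a^4 - 958*a^3 + 381*a^2 + 400*a - 192,
        (2*a + 1) * (9*a - 8)^2:]))" .
  show ?thesis
    by (intro exI conjI) (rule a refl C_eq E_eq)+
qed

end
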